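(* Let $F$ be a field of characteristic not $2$. Then there are isomorphisms of inductive graded rings $$k^{mil}(F)\cong k^{dm}(G(F))\cong k^{mult}(M(G(F))).$$ If $F$ is formally real and $T$ is a preordering of $F$, then $$k^{dm}(G_T(F))\cong k^{mult}(M(G_T(F))).$$ Moreover, $$k^{mil}(F)\cong k^{dm}(G(F))\cong k^{mult}(F/_m\dot F^2)\quad\text{and}\quad k^{dm}(G_T(F))\cong k^{mult}(F/_mT^* ).$$
   Context: **Special groups.** A special group is $(G,-1,\equiv)$ with $G$ a multiplicative group of exponent 2, $-1\in G$, and $\equiv$ a relation on $G^2$ such that: $\equiv$ is an equivalence relation; $\langle a,b\rangle\equiv\langle b,a\rangle$; $\langle a,-a\rangle\equiv\langle1,-1\rangle$; $\langle a,b\rangle\equiv\langle c,d\rangle\Rightarrow ab=cd$; $\langle a,b\rangle\equiv\langle c,d\rangle\Rightarrow\langle a,-c\rangle\equiv\langle -b,d\rangle$; $\langle a,b\rangle\equiv\langle c,d\rangle\Rightarrow\langle ga,gb\rangle\equiv\langle gc,gd\rangle$ for all $g$; and the relation on $G^3$ given by $\langle a_1,a_2,a_3\rangle\equiv\langle b_1,b_2,b_3\rangle$ iff there are $x,y,z\in G$ with $\langle a_1,x\rangle\equiv\langle b_1,y\rangle$, $\langle a_2,a_3\rangle\equiv\langle x,z\rangle$, $\langle b_2,b_3\rangle\equiv\langle y,z\rangle$, is transitive. $D_G(a,b)=\{c:\exists d,\ \langle c,d\rangle\equiv\langle a,b\rangle\}$. For a field $F$ of characteristic not 2, $G(F)=\dot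 F/\dot F^2$, where $\dot F=F\setminus\{0\}$, with $\equiv$ given by isometry of binary quadratic forms. For a preordering $T$ of a formally real $F$, $T^*=T\setminus\{0\}$ and $G_T(F)=\dot F/T^*$, with $\langle a,b\rangle\equiv\langle c,d\rangle$ iff $ab=cd$ mod $T^*$ and $\{z\in\dot F: z=as+bt,\ s,t\in T\}=\{z\in\dot F: z=cs+dt,\ s,t\in T\}$. **Hyperfields.** A commutative multigroup is $(G,+,-,0)$ with $+:G\times G\to\mathcal P(G)\setminus\{\emptyset\}$, $-:G\to G$, such that: $z\in x+y$ implies $x\in z+(-y)$ and $y\in(-x)+z$; $y\in 0+x$ iff $x=y$; $+$ is associative (extended to sets by unions) and commutative. A multiring is $(R,+,\cdot,-,0,1)$ with $(R,+,-,0)$ a commutative multigroup, $(R,\cdot,1)$ a commutative monoid, $a\cdot 0=0$, $(a+b)d\subseteq ad+bd$. A hyperfield is a multiring in which every non-zero element is invertible. A field is a hyperfield with singleton sums. **$M(G)$.** For a special group $G$, $M(G)=G\cup\{0\}$ is the hyperfield with product extending that of $G$ by $a\cdot0=0$, $-a=(-1)a$, $a+0=0+a=\{a\}$, $a+(-a)=M(G)$ for $a\neq0$, and $a+b=D_G(a,b)$ otherwise. **$A/_mS$.** For a multiring $A$ and a multiplicative subset $S\ni1$: $a\sim b$ iff $as=bt$ for some $s,t\in S$; $A/_mS$ is the set of classes, with $\overline a+\overline b=\{\overline c: cv\in as+bt\text{ for some }s,t,v\in S\}$, $-\overline a=\overline{-a}$, $\overline a\,\overline b=\overline{ab}$. **K-theories.**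 $k^{mil}(F)$ is Milnor's K-theory mod 2: $K_n^{mil}F/2K_n^{mil}F$, where $K^{mil}_*F$ is the tensor algebra over $\mathbb Z$ of $\dot F$ (written additively via $l$) modulo the ideal generated by $l(a)\otimes l(1-a)$, $a\ne0,1$. $k^{dm}(G)$ (Dickmann–Miraglia): the tensor algebra over $\mathbb F_2$ of $k_1G$ ($=G$ written additively via $\lambda$), modulo the ideal generated by $\lambda(a)\otimes\lambda(ab)$ with $a,b\in G$, $a\in D_G(1,b)$. $k^{mult}(F)$ for a hyperfield $F$: $k_n=K_n/2K_n$ where $K_*$ is the tensor algebra over $\mathbb Z$ of $\dot F$ (written additively via $\rho$) modulo the ideal generated by $\rho(a)\otimes\rho(b)$, $a\neq0,1$, $b\in1-a$. In each case the degree-0 part is $\mathbb F_2$. **Inductive graded rings.** An inductive graded ring consists of groups $R_n$ ($n\ge0$) of exponent 2 with distinguished elements $\top_n$, $R_0\cong\mathbb F_2$, products $\ast_{nm}:R_n\times R_m\to R_{n+m}$ making $\bigoplus R_n$ a commutative graded ring, and homomorphisms $h_n=\top_1\ast(\_):R_n\to R_{n+1}$ with $h_n(\top_n)=\top_{n+1}$ and compatible with products (if $h_n^p:R_n\to R_p$ are the iterated maps, $h^p_n(x)\ast h^q_m(y)=h^{p+q}_{n+m}(x\ast y)$). Morphisms are graded unital ring homomorphisms preserving all $\top_n$. The three K-theories are inductive graded rings with $\top_0=1$ and $\top_n$ the $n$-th power of $l(-1)$, $\lambda(-1)$, $\rho(-1)$ respectively. *)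

theory Defs
  imports "HOL-Algebra.Multiplicative_Group" "HOL-Algebra.QuotRing" "HOL-Algebra.Module" "HOL-Algebra.IntRing"
    "HOL-Number_Theory.Residues"
begin

section \<open>Special groups\<close>

record 'g sgroup = "'g monoid" +
  minus_one :: 'g
  form_equiv :: "('g \<times> 'g) rel"

definition sg_neg :: "('g, 'm) sgroup_scheme \<Rightarrow> 'g \<Rightarrow> 'g" where
  "sg_neg G a = minus_one G \<otimes>\<^bsub>G\<^esub> a"

definition form_equiv3 :: "('g, 'm) sgroup_scheme \<Rightarrow> ('g \<times> 'g \<times> 'g) rel" where
  "form_equiv3 G =
    {((a1, a2, a3), (b1, b2, b3)) | a1 a2 a3 b1 b2 b3.
       {a1, a2, a3, b1, b2, b3} \<subseteq> carrier G \<and>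
       (\<exists>x \<in> carrier G. \<exists>y \<in> carrier G. \<exists>z \<in> carrier G.
          ((a1, x), (b1, y)) \<in> form_equiv G \<and>
          ((a2, a3), (x, z)) \<in> form_equiv G \<and>
          ((b2, b3), (y, z)) \<in> form_equiv G)}"

locale special_group = group G for G :: "('g, 'm) sgroup_scheme" (structure) +
  assumes exponent_2: "a \<in> carrier G \<Longrightarrow> a \<otimes> a = \<one>"
    and minus_one_closed: "minus_one G \<in> carrier G"
    and equiv: "equiv (carrier G \<times> carrier G) (form_equiv G)"
    and swap: "\<lbrakk>a \<in> carrier G; b \<in> carrier G\<rbrakk> \<Longrightarrow> ((a, b), (b, a)) \<in> form_equiv G"
    and hyperbolic: "a \<in> carrier G \<Longrightarrow> ((a, sg_neg G a), (\<one>, minus_one G)) \<in> form_equiv G"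
    and discriminant: "((a, b), (c, d)) \<in> form_equiv G \<Longrightarrow> a \<otimes> b = c \<otimes> d"
    and transpose: "((a, b), (c, d)) \<in> form_equiv G \<Longrightarrow>
      ((a, sg_neg G c), (sg_neg G b, d)) \<in> form_equiv G"
    and scale: "\<lbrakk>((a, b), (c, d)) \<in> form_equiv G; g \<in> carrier G\<rbrakk> \<Longrightarrow>
      ((g \<otimes> a, g \<otimes> b), (g \<otimes> c, g \<otimes> d)) \<in> form_equiv G"
    and trans3: "trans (form_equiv3 G)"

definition sg_rep :: "('g, 'm) sgroup_scheme \<Rightarrow> 'g \<Rightarrow> 'g \<Rightarrow> 'g set" where
  "sg_rep G a b = {c \<in> carrier G. \<exists>d \<in> carrier G. ((c, d), (a, b)) \<in> form_equiv G}"

text \<open>Diagonal binary forms \<open>a X\<^sup>2 + b Y\<^sup>2\<close>; an isometry is an invertible linear change of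
  variables carrying one form to the other. In characteristic different from 2 a form is determined
  by its values.\<close>

definition diag_form :: "('a, 'm) ring_scheme \<Rightarrow> 'a \<Rightarrow> 'a \<Rightarrow> 'a \<Rightarrow> 'a \<Rightarrow> 'a" where
  "diag_form F a b x y = a \<otimes>\<^bsub>F\<^esub> (x \<otimes>\<^bsub>F\<^esub> x) \<oplus>\<^bsub>F\<^esub> b \<otimes>\<^bsub>F\<^esub> (y \<otimes>\<^bsub>F\<^esub> y)"

definition isometric :: "('a, 'm) ring_scheme \<Rightarrow> 'a \<times> 'a \<Rightarrow> 'a \<times> 'a \<Rightarrow> bool" where
  "isometric F = (\<lambda>(a, b) (c, d).
     \<exists>p \<in> carrier F. \<exists>q \<in> carrier F. \<exists>r \<in> carrier F. \<exists>s \<in> carrier F.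
       p \<otimes>\<^bsub>F\<^esub> s \<ominus>\<^bsub>F\<^esub> q \<otimes>\<^bsub>F\<^esub> r \<noteq> \<zero>\<^bsub>F\<^esub> \<and>
       (\<forall>x \<in> carrier F. \<forall>y \<in> carrier F.
          diag_form F a b (p \<otimes>\<^bsub>F\<^esub> x \<oplus>\<^bsub>F\<^esub> q \<otimes>\<^bsub>F\<^esub> y) (r \<otimes>\<^bsub>F\<^esub> x \<oplus>\<^bsub>F\<^esub> s \<otimes>\<^bsub>F\<^esub> y)
            = diag_form F c d x y))"

definition nonzero_squares :: "('a, 'm) ring_scheme \<Rightarrow> 'a set" where
  "nonzero_squares F = {x \<otimes>\<^bsub>F\<^esub> x | x. x \<in> carrier (mult_of F)}"

text \<open>The relations on \<open>G(F)\<close> and \<open>G\<^sub>T(F)\<close> are given on representatives and do not depend on their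
  choice.\<close>

definition sg_field :: "('a, 'm) ring_scheme \<Rightarrow> 'a set sgroup" where
  "sg_field F = (let Q = mult_of F Mod nonzero_squares F in
     \<lparr>carrier = carrier Q, mult = mult Q, one = one Q,
      minus_one = nonzero_squares F #>\<^bsub>mult_of F\<^esub> (\<ominus>\<^bsub>F\<^esub> \<one>\<^bsub>F\<^esub>),
      form_equiv = {((A, B), (C, D)) | A B C D. {A, B, C, D} \<subseteq> carrier Q \<and>
        (\<exists>a \<in> A. \<exists>b \<in> B. \<exists>c \<in> C. \<exists>d \<in> D. isometric F (a, b) (c, d))}\<rparr>)"

definition formally_real :: "('a, 'm) ring_scheme \<Rightarrow> bool" where
  "formally_real F \<longleftrightarrow>
     (\<forall>(n :: nat) f. f \<in> {..<n} \<rightarrow> carrier F \<longrightarrow>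
        (\<Oplus>\<^bsub>F\<^esub>i \<in> {..<n}. f i \<otimes>\<^bsub>F\<^esub> f i) \<noteq> \<ominus>\<^bsub>F\<^esub> \<one>\<^bsub>F\<^esub>)"

definition field_preordering :: "('a, 'm) ring_scheme \<Rightarrow> 'a set \<Rightarrow> bool" where
  "field_preordering F T \<longleftrightarrow>
     T \<subseteq> carrier F \<and>
     (\<forall>s \<in> T. \<forall>t \<in> T. s \<oplus>\<^bsub>F\<^esub> t \<in> T \<and> s \<otimes>\<^bsub>F\<^esub> t \<in> T) \<and>
     (\<forall>x \<in> carrier F. x \<otimes>\<^bsub>F\<^esub> x \<in> T) \<and>
     \<ominus>\<^bsub>F\<^esub> \<one>\<^bsub>F\<^esub> \<notin> T"

definition pre_rep :: "('a, 'm) ring_scheme \<Rightarrow> 'a set \<Rightarrow> 'a \<Rightarrow> 'a \<Rightarrow> 'a set" where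
  "pre_rep F T a b =
     {z \<in> carrier (mult_of F). \<exists>s \<in> T. \<exists>t \<in> T. z = a \<otimes>\<^bsub>F\<^esub> s \<oplus>\<^bsub>F\<^esub> b \<otimes>\<^bsub>F\<^esub> t}"

definition sg_pre :: "('a, 'm) ring_scheme \<Rightarrow> 'a set \<Rightarrow> 'a set sgroup" where
  "sg_pre F T = (let S = T - {\<zero>\<^bsub>F\<^esub>}; Q = mult_of F Mod S in
     \<lparr>carrier = carrier Q, mult = mult Q, one = one Q,
      minus_one = S #>\<^bsub>mult_of F\<^esub> (\<ominus>\<^bsub>F\<^esub> \<one>\<^bsub>F\<^esub>),
      form_equiv = {((A, B), (C, D)) | A B C D. {A, B, C, D} \<subseteq> carrier Q \<and>
        A \<otimes>\<^bsub>Q\<^esub> B = C \<otimes>\<^bsub>Q\<^esub> D \<and>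
        (\<exists>a \<in> A. \<exists>b \<in> B. \<exists>c \<in> C. \<exists>d \<in> D. pre_rep F T a b = pre_rep F T c d)}\<rparr>)"


section \<open>Multirings and hyperfields\<close>

record 'r multiring_data = "'r monoid" +
  hzero :: 'r
  hadd :: "'r \<Rightarrow> 'r \<Rightarrow> 'r set"
  hneg :: "'r \<Rightarrow> 'r"

locale multiring = comm_monoid R for R :: "('r, 'm) multiring_data_scheme" (structure) +
  assumes hzero_closed: "hzero R \<in> carrier R"
    and hneg_closed: "x \<in> carrier R \<Longrightarrow> hneg R x \<in> carrier R"
    and hadd_closed: "\<lbrakk>x \<in> carrier R; y \<in> carrier R\<rbrakk> \<Longrightarrow> hadd R x y \<subseteq> carrier R"
    and hadd_nonempty: "\<lbrakk>x \<in> carrier R; y \<in> carrier R\<rbrakk> \<Longrightarrow> hadd R x y \<noteq> {}"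
    and hadd_reversible: "\<lbrakk>x \<in> carrier R; y \<in> carrier R; z \<in> hadd R x y\<rbrakk> \<Longrightarrow>
      x \<in> hadd R z (hneg R y) \<and> y \<in> hadd R (hneg R x) z"
    and hadd_zero: "\<lbrakk>x \<in> carrier R; y \<in> carrier R\<rbrakk> \<Longrightarrow> y \<in> hadd R (hzero R) x \<longleftrightarrow> x = y"
    and hadd_assoc: "\<lbrakk>x \<in> carrier R; y \<in> carrier R; z \<in> carrier R\<rbrakk> \<Longrightarrow>
      (\<Union>u \<in> hadd R x y. hadd R u z) = (\<Union>v \<in> hadd R y z. hadd R x v)"
    and hadd_comm: "\<lbrakk>x \<in> carrier R; y \<in> carrier R\<rbrakk> \<Longrightarrow> hadd R x y = hadd R y x"
    and mult_hzero: "a \<in> carrier R \<Longrightarrow> a \<otimes> hzero R = hzero R"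
    and hadd_mult: "\<lbrakk>a \<in> carrier R; b \<in> carrier R; d \<in> carrier R\<rbrakk> \<Longrightarrow>
      (\<lambda>c. c \<otimes> d) ` hadd R a b \<subseteq> hadd R (a \<otimes> d) (b \<otimes> d)"

locale hyperfield = multiring +
  assumes invertible: "\<lbrakk>a \<in> carrier R; a \<noteq> hzero R\<rbrakk> \<Longrightarrow> \<exists>b \<in> carrier R. a \<otimes> b = \<one>"

definition multiring_of :: "('a, 'm) ring_scheme \<Rightarrow> 'a multiring_data" where
  "multiring_of F = \<lparr>carrier = carrier F, mult = mult F, one = one F, hzero = zero F,
     hadd = (\<lambda>a b. {a \<oplus>\<^bsub>F\<^esub> b}), hneg = a_inv F\<rparr>"

definition hmult_of :: "('r, 'm) multiring_data_scheme \<Rightarrow> 'r monoid" where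
  "hmult_of H = \<lparr>carrier = carrier H - {hzero H}, mult = mult H, one = one H\<rparr>"

text \<open>In \<open>M(G) = G \<union> {0}\<close> the element \<open>0\<close> is \<open>None\<close>.\<close>

definition sg_hyperfield :: "('g, 'm) sgroup_scheme \<Rightarrow> 'g option multiring_data" where
  "sg_hyperfield G =
     \<lparr>carrier = insert None (Some ` carrier G),
      mult = (\<lambda>x y. case (x, y) of (Some a, Some b) \<Rightarrow> Some (a \<otimes>\<^bsub>G\<^esub> b) | _ \<Rightarrow> None),
      one = Some \<one>\<^bsub>G\<^esub>,
      hzero = None,
      hadd = (\<lambda>x y. case (x, y) of
          (None, _) \<Rightarrow> {y}
        | (Some a, None) \<Rightarrow> {Some a}
        | (Some a, Some b) \<Rightarrow>
            if b = sg_neg G a then insert None (Some ` carrier G) else Some ` sg_rep G a b),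
      hneg = map_option (sg_neg G)\<rparr>"

definition mclass :: "('r, 'm) multiring_data_scheme \<Rightarrow> 'r set \<Rightarrow> 'r \<Rightarrow> 'r set" where
  "mclass A S a = {b \<in> carrier A. \<exists>s \<in> S. \<exists>t \<in> S. a \<otimes>\<^bsub>A\<^esub> s = b \<otimes>\<^bsub>A\<^esub> t}"

definition mquot :: "('r, 'm) multiring_data_scheme \<Rightarrow> 'r set \<Rightarrow> 'r set multiring_data" where
  "mquot A S =
     \<lparr>carrier = mclass A S ` carrier A,
      mult = (\<lambda>X Y. \<Union>a \<in> X. \<Union>b \<in> Y. mclass A S (a \<otimes>\<^bsub>A\<^esub> b)),
      one = mclass A S \<one>\<^bsub>A\<^esub>,
      hzero = mclass A S (hzero A),
      hadd = (\<lambda>X Y. {mclass A S c | c a b s t v.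
        c \<in> carrier A \<and> a \<in> X \<and> b \<in> Y \<and> s \<in> S \<and> t \<in> S \<and> v \<in> S \<and>
        c \<otimes>\<^bsub>A\<^esub> v \<in> hadd A (a \<otimes>\<^bsub>A\<^esub> s) (b \<otimes>\<^bsub>A\<^esub> t)}),
      hneg = (\<lambda>X. \<Union>a \<in> X. mclass A S (hneg A a))\<rparr>"


section \<open>Inductive graded rings\<close>

text \<open>The groups \<open>R\<^sub>n\<close> are group records, so \<open>\<otimes>\<close> and \<open>\<one>\<close> of \<open>igr_grp R n\<close> are the addition and
  the zero of \<open>R\<^sub>n\<close>. The ring product and ring unit are \<open>igr_mult\<close> and \<open>igr_one\<close>.\<close>

record 'r igr =
  igr_grp :: "nat \<Rightarrow> 'r monoid"
  igr_one :: 'r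
  igr_mult :: "nat \<Rightarrow> nat \<Rightarrow> 'r \<Rightarrow> 'r \<Rightarrow> 'r"
  igr_top :: "nat \<Rightarrow> 'r"

definition igr_h :: "('r, 'm) igr_scheme \<Rightarrow> nat \<Rightarrow> 'r \<Rightarrow> 'r" where
  "igr_h R n x = igr_mult R 1 n (igr_top R 1) x"

text \<open>The iterated map \<open>R\<^sub>n \<rightarrow> R\<^sub>p\<close>, meaningful for \<open>n \<le> p\<close>.\<close>

primrec igr_h_iter :: "('r, 'm) igr_scheme \<Rightarrow> nat \<Rightarrow> nat \<Rightarrow> 'r \<Rightarrow> 'r" where
  "igr_h_iter R n 0 x = x"
| "igr_h_iter R n (Suc p) x = (if Suc p \<le> n then x else igr_h R p (igr_h_iter R n p x))"

locale inductive_graded_ring =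
  fixes R :: "('r, 'm) igr_scheme"
  assumes grp: "comm_group (igr_grp R n)"
    and exponent_2: "x \<in> carrier (igr_grp R n) \<Longrightarrow> x \<otimes>\<^bsub>igr_grp R n\<^esub> x = \<one>\<^bsub>igr_grp R n\<^esub>"
    and top_closed: "igr_top R n \<in> carrier (igr_grp R n)"
    and degree_0: "igr_grp R 0 \<cong> add_monoid (residue_ring 2)"
    and one_closed: "igr_one R \<in> carrier (igr_grp R 0)"
    and mult_closed: "\<lbrakk>x \<in> carrier (igr_grp R n); y \<in> carrier (igr_grp R m)\<rbrakk> \<Longrightarrow>
      igr_mult R n m x y \<in> carrier (igr_grp R (n + m))"
    and mult_add_left: "\<lbrakk>x \<in> carrier (igr_grp R n); x' \<in> carrier (igr_grp R n);
        y \<in> carrier (igr_grp R m)\<rbrakk> \<Longrightarrow>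
      igr_mult R n m (x \<otimes>\<^bsub>igr_grp R n\<^esub> x') y =
        igr_mult R n m x y \<otimes>\<^bsub>igr_grp R (n + m)\<^esub> igr_mult R n m x' y"
    and mult_add_right: "\<lbrakk>x \<in> carrier (igr_grp R n); y \<in> carrier (igr_grp R m);
        y' \<in> carrier (igr_grp R m)\<rbrakk> \<Longrightarrow>
      igr_mult R n m x (y \<otimes>\<^bsub>igr_grp R m\<^esub> y') =
        igr_mult R n m x y \<otimes>\<^bsub>igr_grp R (n + m)\<^esub> igr_mult R n m x y'"
    and mult_assoc: "\<lbrakk>x \<in> carrier (igr_grp R n); y \<in> carrier (igr_grp R m);
        z \<in> carrier (igr_grp R k)\<rbrakk> \<Longrightarrow>
      igr_mult R (n + m) k (igr_mult R n m x y) z = igr_mult R n (m + k) x (igr_mult R m k y z)"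
    and mult_comm: "\<lbrakk>x \<in> carrier (igr_grp R n); y \<in> carrier (igr_grp R m)\<rbrakk> \<Longrightarrow>
      igr_mult R n m x y = igr_mult R m n y x"
    and mult_one: "x \<in> carrier (igr_grp R n) \<Longrightarrow> igr_mult R 0 n (igr_one R) x = x"
    and h_hom: "igr_h R n \<in> hom (igr_grp R n) (igr_grp R (Suc n))"
    and h_top: "igr_h R n (igr_top R n) = igr_top R (Suc n)"
    and h_mult: "\<lbrakk>n \<le> p; m \<le> q; x \<in> carrier (igr_grp R n); y \<in> carrier (igr_grp R m)\<rbrakk> \<Longrightarrow>
      igr_mult R p q (igr_h_iter R n p x) (igr_h_iter R m q y) =
        igr_h_iter R (n + m) (p + q) (igr_mult R n m x y)"

definition igr_hom :: "('r, 'm) igr_scheme \<Rightarrow> ('s, 'k) igr_scheme \<Rightarrow> (nat \<Rightarrow> 'r \<Rightarrow> 's) set" where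
  "igr_hom R S = {f.
     (\<forall>n. f n \<in> hom (igr_grp R n) (igr_grp S n)) \<and>
     (\<forall>n m. \<forall>x \<in> carrier (igr_grp R n). \<forall>y \<in> carrier (igr_grp R m).
        f (n + m) (igr_mult R n m x y) = igr_mult S n m (f n x) (f m y)) \<and>
     f 0 (igr_one R) = igr_one S \<and>
     (\<forall>n. f n (igr_top R n) = igr_top S n)}"

definition igr_iso :: "('r, 'm) igr_scheme \<Rightarrow> ('s, 'k) igr_scheme \<Rightarrow> bool" where
  "igr_iso R S \<longleftrightarrow> inductive_graded_ring R \<and> inductive_graded_ring S \<and>
     (\<exists>f \<in> igr_hom R S. \<forall>n. bij_betw (f n) (carrier (igr_grp R n)) (carrier (igr_grp S n)))"


section \<open>Tensor algebras\<close>

text \<open>The free associative \<open>R\<close>-algebra on a set \<open>X\<close>: finitely supported \<open>R\<close>-valued functions on the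
  words over \<open>X\<close>, multiplied by concatenation of words.\<close>

definition free_algebra :: "('r, 'm) ring_scheme \<Rightarrow> 'x set \<Rightarrow> ('x list \<Rightarrow> 'r) ring" where
  "free_algebra R X =
     \<lparr>carrier = {f. range f \<subseteq> carrier R \<and> {w. f w \<noteq> \<zero>\<^bsub>R\<^esub>} \<subseteq> lists X \<and> finite {w. f w \<noteq> \<zero>\<^bsub>R\<^esub>}},
      mult = (\<lambda>f g w. \<Oplus>\<^bsub>R\<^esub>k \<in> {..length w}. f (take k w) \<otimes>\<^bsub>R\<^esub> g (drop k w)),
      one = (\<lambda>w. if w = [] then \<one>\<^bsub>R\<^esub> else \<zero>\<^bsub>R\<^esub>),
      zero = (\<lambda>w. \<zero>\<^bsub>R\<^esub>),
      add = (\<lambda>f g w. f w \<oplus>\<^bsub>R\<^esub> g w)\<rparr>"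

definition free_gen :: "('r, 'm) ring_scheme \<Rightarrow> 'x \<Rightarrow> 'x list \<Rightarrow> 'r" where
  "free_gen R x = (\<lambda>w. if w = [x] then \<one>\<^bsub>R\<^esub> else \<zero>\<^bsub>R\<^esub>)"

text \<open>\<open>R\<langle>M\<rangle>\<close> is the direct sum over \<open>n\<close> of the free \<open>R\<close>-modules on \<open>M\<^sup>n\<close>, and the ideal generated by
  the linearity relations is the direct sum of the multilinearity relations, so the quotient is the
  direct sum of the tensor powers of \<open>M\<close>. Those powers are the \<open>tensor_power\<close>s below.\<close>

definition linear_rels :: "('r, 'm) ring_scheme \<Rightarrow> ('r, 'x, 'k) module_scheme \<Rightarrow> ('x list \<Rightarrow> 'r) set" where
  "linear_rels R M =
     {free_gen R (x \<oplus>\<^bsub>M\<^esub> y) \<ominus>\<^bsub>free_algebra R (carrier M)\<^esub>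
        (free_gen R x \<oplus>\<^bsub>free_algebra R (carrier M)\<^esub> free_gen R y) | x y.
        x \<in> carrier M \<and> y \<in> carrier M} \<union>
     {free_gen R (r \<odot>\<^bsub>M\<^esub> x) \<ominus>\<^bsub>free_algebra R (carrier M)\<^esub> (\<lambda>w. r \<otimes>\<^bsub>R\<^esub> free_gen R x w) | r x.
        r \<in> carrier R \<and> x \<in> carrier M}"

definition tensor_ideal :: "('r, 'm) ring_scheme \<Rightarrow> ('r, 'x, 'k) module_scheme \<Rightarrow> ('x list \<Rightarrow> 'r) set" where
  "tensor_ideal R M = Idl\<^bsub>free_algebra R (carrier M)\<^esub> (linear_rels R M)"

definition tensor_algebra ::
    "('r, 'm) ring_scheme \<Rightarrow> ('r, 'x, 'k) module_scheme \<Rightarrow> ('x list \<Rightarrow> 'r) set ring" where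
  "tensor_algebra R M = free_algebra R (carrier M) Quot tensor_ideal R M"

definition tensor_incl ::
    "('r, 'm) ring_scheme \<Rightarrow> ('r, 'x, 'k) module_scheme \<Rightarrow> 'x \<Rightarrow> ('x list \<Rightarrow> 'r) set" where
  "tensor_incl R M x = tensor_ideal R M +>\<^bsub>free_algebra R (carrier M)\<^esub> free_gen R x"

definition tensor_power ::
    "('r, 'm) ring_scheme \<Rightarrow> ('r, 'x, 'k) module_scheme \<Rightarrow> nat \<Rightarrow> ('x list \<Rightarrow> 'r) set set" where
  "tensor_power R M n =
     (\<lambda>f. tensor_ideal R M +>\<^bsub>free_algebra R (carrier M)\<^esub> f) `
       {f \<in> carrier (free_algebra R (carrier M)). \<forall>w. f w \<noteq> \<zero>\<^bsub>R\<^esub> \<longrightarrow> length w = n}"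

text \<open>An abelian group, written multiplicatively, as a module: integers act by powers. This is a
  \<open>\<int>\<close>-module, and for exponent 2 also an \<open>\<bbbF>\<^sub>2\<close>-module, where \<open>\<bbbF>\<^sub>2\<close> is
  \<open>residue_ring 2\<close> with carrier \<open>{0, 1}\<close>. The ring product and unit are irrelevant for modules.\<close>

definition power_module :: "('x, 'm) monoid_scheme \<Rightarrow> (int, 'x) module" where
  "power_module A =
     \<lparr>carrier = carrier A, mult = undefined, one = undefined, zero = \<one>\<^bsub>A\<^esub>, add = mult A,
      smult = (\<lambda>k x. x [^]\<^bsub>A\<^esub> k)\<rparr>"

text \<open>The tensor algebra of \<open>M\<close> modulo the ideal generated by a set \<open>E\<close> of homogeneous elements,
  graded by the images of the tensor powers, where \<open>\<top>\<^sub>n\<close> is the \<open>n\<close>-th power of the class of \<open>e\<close>.\<close>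

definition tensor_quot :: "('r, 'm) ring_scheme \<Rightarrow> ('r, 'x, 'k) module_scheme \<Rightarrow>
    ('x list \<Rightarrow> 'r) set set \<Rightarrow> 'x \<Rightarrow> ('x list \<Rightarrow> 'r) set set igr" where
  "tensor_quot R M E e =
     (let T = tensor_algebra R M; J = Idl\<^bsub>T\<^esub> E; Q = T Quot J in
       \<lparr>igr_grp = (\<lambda>n. \<lparr>carrier = (\<lambda>u. J +>\<^bsub>T\<^esub> u) ` tensor_power R M n, mult = add Q, one = zero Q\<rparr>),
        igr_one = one Q,
        igr_mult = (\<lambda>n m. mult Q),
        igr_top = (\<lambda>n. (J +>\<^bsub>T\<^esub> tensor_incl R M e) [^]\<^bsub>Q\<^esub> n)\<rparr>)"

definition igr_double :: "('r, 'm) igr_scheme \<Rightarrow> nat \<Rightarrow> 'r set" where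
  "igr_double R n = {x \<otimes>\<^bsub>igr_grp R n\<^esub> x | x. x \<in> carrier (igr_grp R n)}"

definition igr_mod2 :: "('r, 'm) igr_scheme \<Rightarrow> 'r set igr" where
  "igr_mod2 R =
     \<lparr>igr_grp = (\<lambda>n. igr_grp R n Mod igr_double R n),
      igr_one = igr_double R 0 #>\<^bsub>igr_grp R 0\<^esub> igr_one R,
      igr_mult = (\<lambda>n m X Y. \<Union>x \<in> X. \<Union>y \<in> Y.
        igr_double R (n + m) #>\<^bsub>igr_grp R (n + m)\<^esub> igr_mult R n m x y),
      igr_top = (\<lambda>n. igr_double R n #>\<^bsub>igr_grp R n\<^esub> igr_top R n)\<rparr>"


section \<open>The three K-theories\<close>

text \<open>\<open>k_dm\<close> and \<open>k_mult\<close> are total functions on the data of a special group and of a hyperfield.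
  In a multiring \<open>0 \<in> 1 - a\<close> only for \<open>a = 1\<close>, so the relations of \<open>K_mult\<close> involve non-zero
  elements only.\<close>

definition K_mil :: "('a, 'm) ring_scheme \<Rightarrow> ('a list \<Rightarrow> int) set set igr" where
  "K_mil F = (let M = power_module (mult_of F); l = tensor_incl \<Z> M in
     tensor_quot \<Z> M
       {l a \<otimes>\<^bsub>tensor_algebra \<Z> M\<^esub> l (\<one>\<^bsub>F\<^esub> \<ominus>\<^bsub>F\<^esub> a) | a. a \<in> carrier F - {\<zero>\<^bsub>F\<^esub>, \<one>\<^bsub>F\<^esub>}}
       (\<ominus>\<^bsub>F\<^esub> \<one>\<^bsub>F\<^esub>))"

definition k_mil :: "('a, 'm) ring_scheme \<Rightarrow> ('a list \<Rightarrow> int) set set set igr" where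
  "k_mil F = igr_mod2 (K_mil F)"

definition k_dm :: "('g, 'm) sgroup_scheme \<Rightarrow> ('g list \<Rightarrow> int) set set igr" where
  "k_dm G = (let M = power_module G; lam = tensor_incl (residue_ring 2) M in
     tensor_quot (residue_ring 2) M
       {lam a \<otimes>\<^bsub>tensor_algebra (residue_ring 2) M\<^esub> lam (a \<otimes>\<^bsub>G\<^esub> b) | a b.
          a \<in> carrier G \<and> b \<in> carrier G \<and> a \<in> sg_rep G \<one>\<^bsub>G\<^esub> b}
       (minus_one G))"

definition K_mult :: "('r, 'm) multiring_data_scheme \<Rightarrow> ('r list \<Rightarrow> int) set set igr" where
  "K_mult H = (let M = power_module (hmult_of H); \<rho> = tensor_incl \<Z> M in
     tensor_quot \<Z> M
       {\<rho> a \<otimes>\<^bsub>tensor_algebra \<Z> M\<^esub> \<rho> b | a b.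
          a \<in> carrier H - {hzero H, \<one>\<^bsub>H\<^esub>} \<and> b \<in> hadd H \<one>\<^bsub>H\<^esub> (hneg H a)}
       (hneg H \<one>\<^bsub>H\<^esub>))"

definition k_mult :: "('r, 'm) multiring_data_scheme \<Rightarrow> ('r list \<Rightarrow> int) set set set igr" where
  "k_mult H = igr_mod2 (K_mult H)"

end

theory Submission
  imports Defs "HOL-Algebra.UnivPoly"
begin

text \<open>All three theories have the form \<open>k = \<int>\<langle>X\<rangle> / I\<close> modulo 2 with \<open>I\<close> generated in degrees 1 and 2, so
  everything reduces to comparing generators and relations. A homomorphism from such a ring is
  the same as an additive symbol map \<open>\<sigma>\<close> on the group of generators that kills the quadratic relations.
  In characteristic 2 the relation \<open>\<sigma>(a) \<sigma>(-a) = 0\<close> gives commutativity, and it follows from the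
  Steinberg relations by \<open>-a = (1 - a) / (1 - 1/a)\<close>. For \<open>c = s + b t\<close> with nonzero \<open>s\<close> and \<open>t\<close> one has
  \<open>c / s = 1 - (-b t / s)\<close>, so the Steinberg relation gives \<open>\<sigma>(c) \<sigma>(-b) = 0\<close>, which is the relation
  \<open>\<sigma>(c) \<sigma>(c b) = 0\<close> of \<open>k\<^sup>d\<^sup>m\<close>. Conversely \<open>a = 1 + (-(1 - a)) \<cdot> 1\<close> lies in \<open>D(1, -(1 - a))\<close>.
  The maps in both directions are mutually inverse because they are so on generators.\<close>


section \<open>Free algebras\<close>

text \<open>The delicate point is that reduction modulo 2 is taken degree by degree, whereas maps
  given by generators and relations are maps of whole rings. From \<open>k_dm\<close> there is no
  map back to the integral ring \<open>Q\<close>, only to \<open>Q/2Q\<close>, so an element of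
  degree \<open>n\<close> killed on the way to \<open>k_dm\<close> is at first only known to be
  \<open>y + y\<close> with \<open>y\<close> of mixed degree. Passing to the degree \<open>n\<close>
  part of \<open>y\<close> requires a grading of \<open>Q\<close>, which its construction as a
  quotient by ideals does not display; a homomorphism to \<open>Q[t]\<close> recovers it. The five
  isomorphisms are treated uniformly with \<open>k_dm\<close> as the hub. Each integral theory has a
  group of generators mapped onto the special group, and must supply three facts: its relations come
  from representations by \<open>\<langle>1, -x\<rangle>\<close>, the Steinberg pairs with
  nontrivial first class are among them, and symbols vanish on the kernel. The special groups enter
  through the sets \<open>D(1, b)\<close>, which in both cases are the nonzero classes of
  \<open>T + b T\<close>. The axioms of inductive graded rings are checked for \<open>k_dm\<close>
  and carried over along the bijections.\<close>

lemma (in abelian_monoid) finsum_triangle: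
  fixes n :: nat
  assumes "\<And>j k. j \<le> k \<Longrightarrow> k \<le> n \<Longrightarrow> \<phi> j k \<in> carrier G"
  shows "(\<Oplus>k\<in>{..n}. \<Oplus>j\<in>{..k}. \<phi> j k) = (\<Oplus>j\<in>{..n}. \<Oplus>i\<in>{..n - j}. \<phi> j (j + i))"
  using assms
proof (induction n)
  case 0
  then show ?case by simp
next
  case (Suc n)
  have IH: "(\<Oplus>k\<in>{..n}. \<Oplus>j\<in>{..k}. \<phi> j k) = (\<Oplus>j\<in>{..n}. \<Oplus>i\<in>{..n - j}. \<phi> j (j + i))"
    using Suc by auto
  have c: "\<And>j k. j \<le> k \<Longrightarrow> k \<le> Suc n \<Longrightarrow> \<phi> j k \<in> carrier G"
    using Suc by auto
  have "(\<Oplus>k\<in>{..Suc n}. \<Oplus>j\<in>{..k}. \<phi> j k)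
      = (\<Oplus>j\<in>{..Suc n}. \<phi> j (Suc n)) \<oplus> (\<Oplus>k\<in>{..n}. \<Oplus>j\<in>{..k}. \<phi> j k)"
    by (subst finsum_Suc) (auto intro!: finsum_closed c)
  also have "\<dots> = (\<phi> (Suc n) (Suc n) \<oplus> (\<Oplus>j\<in>{..n}. \<phi> j (Suc n)))
      \<oplus> (\<Oplus>j\<in>{..n}. \<Oplus>i\<in>{..n - j}. \<phi> j (j + i))"
    by (simp add: IH finsum_Suc c Pi_def)
  also have "\<dots> = \<phi> (Suc n) (Suc n) \<oplus> ((\<Oplus>j\<in>{..n}. \<phi> j (Suc n))
      \<oplus> (\<Oplus>j\<in>{..n}. \<Oplus>i\<in>{..n - j}. \<phi> j (j + i)))"
    by (rule a_assoc) (auto intro!: finsum_closed c)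
  also have "(\<Oplus>j\<in>{..n}. \<phi> j (Suc n)) \<oplus> (\<Oplus>j\<in>{..n}. \<Oplus>i\<in>{..n - j}. \<phi> j (j + i))
     = (\<Oplus>j\<in>{..n}. \<phi> j (Suc n) \<oplus> (\<Oplus>i\<in>{..n - j}. \<phi> j (j + i)))"
    by (rule finsum_addf[symmetric]) (auto intro!: finsum_closed c)
  also have "\<dots> = (\<Oplus>j\<in>{..n}. \<Oplus>i\<in>{..Suc n - j}. \<phi> j (j + i))"
  proof (rule finsum_cong')
    show "(\<lambda>j. \<Oplus>i\<in>{..Suc n - j}. \<phi> j (j + i)) \<in> {..n} \<rightarrow> carrier G"
      by (auto intro!: finsum_closed c)
    fix j assume "j \<in> {..n}"
    then have "{..Suc n - j} = {..Suc (n - j)}" "j \<le> n" by (auto simp: Suc_diff_le)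
    then show "\<phi> j (Suc n) \<oplus> (\<Oplus>i\<in>{..n - j}. \<phi> j (j + i)) = (\<Oplus>i\<in>{..Suc n - j}. \<phi> j (j + i))"
      by (simp add: finsum_Suc c Pi_def)
  qed simp
  also have "\<phi> (Suc n) (Suc n) \<oplus> \<dots> = (\<Oplus>j\<in>{..Suc n}. \<Oplus>i\<in>{..Suc n - j}. \<phi> j (j + i))"
    using c by (simp add: finsum_Suc Pi_def)
  finally show ?case .
qed

definition free_monom :: "('r, 'm) ring_scheme \<Rightarrow> 'r \<Rightarrow> 'x list \<Rightarrow> 'x list \<Rightarrow> 'r" where
  "free_monom R r v = (\<lambda>w. if w = v then r else \<zero>\<^bsub>R\<^esub>)"

context ring
begin

lemma free_algebra_carrierD:
  assumes "f \<in> carrier (free_algebra R X)"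
  shows "f w \<in> carrier R" "w \<notin> lists X \<Longrightarrow> f w = \<zero>" "finite {w. f w \<noteq> \<zero>}"
  using assms by (auto simp: free_algebra_def)

lemma free_monom_closed [simp]:
  assumes "r \<in> carrier R" "v \<in> lists X"
  shows "free_monom R r v \<in> carrier (free_algebra R X)"
proof -
  have "{w. free_monom R r v w \<noteq> \<zero>} \<subseteq> {v}" by (auto simp: free_monom_def)
  then show ?thesis
    using assms finite_subset[OF \<open>_ \<subseteq> {v}\<close>] by (auto simp: free_algebra_def free_monom_def)
qed

lemma free_algebra_add_closed:
  assumes "f \<in> carrier (free_algebra R X)" "g \<in> carrier (free_algebra R X)"
  shows "f \<oplus>\<^bsub>free_algebra R X\<^esub> g \<in> carrier (free_algebra R X)"
proof -
  have "{w. f w \<oplus> g w \<noteq> \<zero>} \<subseteq> {w. f w \<noteq> \<zero>} \<union> {w. g w \<noteq> \<zero>}"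
    using free_algebra_carrierD[OF assms(1)] free_algebra_carrierD[OF assms(2)] by auto
  then have "finite {w. f w \<oplus> g w \<noteq> \<zero>}"
    by (rule finite_subset) (use assms free_algebra_carrierD(3) in auto)
  moreover have "{w. f w \<oplus> g w \<noteq> \<zero>} \<subseteq> lists X"
    using free_algebra_carrierD(2)[OF assms(1)] free_algebra_carrierD(2)[OF assms(2)]
    by fastforce
  ultimately show ?thesis
    using free_algebra_carrierD(1)[OF assms(1)] free_algebra_carrierD(1)[OF assms(2)]
    by (auto simp: free_algebra_def)
qed

text \<open>A word with non-zero coefficient in the product has a cut at which both factors are
  non-zero, so it is a concatenation of two support words. This gives finiteness of the support and
  the restriction to words over \<open>X\<close> together.\<close>

lemma free_algebra_mult_closed:
  assumes "f \<in> carrier (free_algebra R X)" "g \<in> carrier (free_algebra R X)"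
  shows "f \<otimes>\<^bsub>free_algebra R X\<^esub> g \<in> carrier (free_algebra R X)"
proof -
  note f = free_algebra_carrierD[OF assms(1)] and g = free_algebra_carrierD[OF assms(2)]
  let ?h = "\<lambda>w. \<Oplus>k\<in>{..length w}. f (take k w) \<otimes> g (drop k w)"
  have sub: "{w. ?h w \<noteq> \<zero>} \<subseteq> (\<lambda>(u, v). u @ v) ` ({w. f w \<noteq> \<zero>} \<times> {w. g w \<noteq> \<zero>})"
  proof
    fix w assume w: "w \<in> {w. ?h w \<noteq> \<zero>}"
    have "\<exists>k. f (take k w) \<otimes> g (drop k w) \<noteq> \<zero>"
    proof (rule ccontr)
      assume "\<not> ?thesis"
      then have "?h w = \<zero>" by (simp add: finsum_zero)
      with w show False by simp
    qed
    then obtain k where "f (take k w) \<otimes> g (drop k w) \<noteq> \<zero>" by auto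
    then have "f (take k w) \<noteq> \<zero>" "g (drop k w) \<noteq> \<zero>"
      using f(1) g(1) by auto
    then show "w \<in> (\<lambda>(u, v). u @ v) ` ({w. f w \<noteq> \<zero>} \<times> {w. g w \<noteq> \<zero>})"
      by (intro image_eqI[of _ _ "(take k w, drop k w)"]) auto
  qed
  have "finite {w. ?h w \<noteq> \<zero>}"
    by (rule finite_subset[OF sub]) (use f(3) g(3) in auto)
  moreover have "{w. ?h w \<noteq> \<zero>} \<subseteq> lists X"
  proof
    fix w assume "w \<in> {w. ?h w \<noteq> \<zero>}"
    then obtain u v where "w = u @ v" "f u \<noteq> \<zero>" "g v \<noteq> \<zero>"
      using sub by auto
    then show "w \<in> lists X" using f(2) g(2) by (metis append_in_lists_conv)
  qed
  moreover have "?h w \<in> carrier R" for w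
    using f(1) g(1) by (auto intro!: finsum_closed)
  ultimately show ?thesis by (auto simp: free_algebra_def)
qed

text \<open>Both bracketings sum over the ways to cut a word at two places \<open>j \<le> k\<close>.
  \<open>finsum_triangle\<close> passes from the outer index \<open>k\<close> to the outer index
  \<open>j\<close>, the inner one becoming \<open>i = k - j\<close>.\<close>

lemma free_algebra_assoc:
  assumes "f \<in> carrier (free_algebra R X)" "g \<in> carrier (free_algebra R X)"
    "h \<in> carrier (free_algebra R X)"
  shows "(f \<otimes>\<^bsub>free_algebra R X\<^esub> g) \<otimes>\<^bsub>free_algebra R X\<^esub> h
    = f \<otimes>\<^bsub>free_algebra R X\<^esub> (g \<otimes>\<^bsub>free_algebra R X\<^esub> h)"
proof
  fix w
  note c = free_algebra_carrierD(1)[OF assms(1)] free_algebra_carrierD(1)[OF assms(2)]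
    free_algebra_carrierD(1)[OF assms(3)]
  define \<phi> where "\<phi> j k = f (take j w) \<otimes> (g (drop j (take k w)) \<otimes> h (drop k w))" for j k
  have \<phi>: "\<phi> j k \<in> carrier R" for j k using c by (simp add: \<phi>_def)
  have "((f \<otimes>\<^bsub>free_algebra R X\<^esub> g) \<otimes>\<^bsub>free_algebra R X\<^esub> h) w
     = (\<Oplus>k\<in>{..length w}. (\<Oplus>j\<in>{..length (take k w)}. f (take j (take k w)) \<otimes> g (drop j (take k w)))
        \<otimes> h (drop k w))"
    by (simp add: free_algebra_def)
  also have "\<dots> = (\<Oplus>k\<in>{..length w}. \<Oplus>j\<in>{..k}. \<phi> j k)"
  proof (rule finsum_cong')
    fix k assume k: "k \<in> {..length w}"
    then have "(\<Oplus>j\<in>{..length (take k w)}. f (take j (take k w)) \<otimes> g (drop j (take k w)))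
        \<otimes> h (drop k w)
      = (\<Oplus>j\<in>{..k}. f (take j (take k w)) \<otimes> g (drop j (take k w)) \<otimes> h (drop k w))"
      using c by (subst finsum_ldistr) (auto simp: min_absorb2)
    also have "\<dots> = (\<Oplus>j\<in>{..k}. \<phi> j k)"
      using c by (intro finsum_cong') (auto simp: \<phi>_def m_assoc min_absorb1)
    finally show "(\<Oplus>j\<in>{..length (take k w)}. f (take j (take k w)) \<otimes> g (drop j (take k w)))
        \<otimes> h (drop k w) = (\<Oplus>j\<in>{..k}. \<phi> j k)" .
  qed (use \<phi> in \<open>auto intro!: finsum_closed\<close>)
  also have "\<dots> = (\<Oplus>j\<in>{..length w}. \<Oplus>i\<in>{..length w - j}. \<phi> j (j + i))"
    by (rule finsum_triangle) (use \<phi> in auto)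
  also have "\<dots> = (\<Oplus>j\<in>{..length w}. f (take j w) \<otimes>
      (\<Oplus>i\<in>{..length (drop j w)}. g (take i (drop j w)) \<otimes> h (drop i (drop j w))))"
  proof (rule finsum_cong')
    fix j assume j: "j \<in> {..length w}"
    have "f (take j w) \<otimes> (\<Oplus>i\<in>{..length (drop j w)}. g (take i (drop j w)) \<otimes> h (drop i (drop j w)))
       = (\<Oplus>i\<in>{..length w - j}. f (take j w) \<otimes> (g (take i (drop j w)) \<otimes> h (drop i (drop j w))))"
      using c by (subst finsum_rdistr) auto
    also have "\<dots> = (\<Oplus>i\<in>{..length w - j}. \<phi> j (j + i))"
      using c by (intro finsum_cong') (auto simp: \<phi>_def take_drop add.commute[of j])
    finally show "(\<Oplus>i\<in>{..length w - j}. \<phi> j (j + i)) = f (take j w) \<otimes>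
      (\<Oplus>i\<in>{..length (drop j w)}. g (take i (drop j w)) \<otimes> h (drop i (drop j w)))" by simp
  qed (use c in \<open>auto intro!: finsum_closed\<close>)
  also have "\<dots> = (f \<otimes>\<^bsub>free_algebra R X\<^esub> (g \<otimes>\<^bsub>free_algebra R X\<^esub> h)) w"
    by (simp add: free_algebra_def)
  finally show "((f \<otimes>\<^bsub>free_algebra R X\<^esub> g) \<otimes>\<^bsub>free_algebra R X\<^esub> h) w
    = (f \<otimes>\<^bsub>free_algebra R X\<^esub> (g \<otimes>\<^bsub>free_algebra R X\<^esub> h)) w" .
qed

text \<open>In the convolution sum at \<open>w\<close> only the cut after \<open>length u\<close>
  letters can contribute, so the sum collapses to one term.\<close>

lemma free_monom_mult:
  assumes "r \<in> carrier R" "s \<in> carrier R"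
  shows "free_monom R r u \<otimes>\<^bsub>free_algebra R X\<^esub> free_monom R s v = free_monom R (r \<otimes> s) (u @ v)"
proof
  fix w
  have "free_monom R r u (take k w) \<otimes> free_monom R s v (drop k w)
      = (if length u = k then (if w = u @ v then r \<otimes> s else \<zero>) else \<zero>)"
    if "k \<le> length w" for k
  proof (cases "take k w = u \<and> drop k w = v")
    case True
    then have "w = u @ v" "length u = k" using that append_take_drop_id[of k w] length_take[of k w] by (metis, metis min_absorb2)
    then show ?thesis by (simp add: free_monom_def)
  next
    case False
    then have "\<not> (length u = k \<and> w = u @ v)" by auto
    with False show ?thesis using assms by (auto simp: free_monom_def)
  qed
  then have "(free_monom R r u \<otimes>\<^bsub>free_algebra R X\<^esub> free_monom R s v) w
      = (\<Oplus>k\<in>{..length w}. if length u = k then (if w = u @ v then r \<otimes> s else \<zero>) else \<zero>)"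
    unfolding free_algebra_def monoid.simps
    by (intro finsum_cong') (auto simp: assms)
  also have "\<dots> = free_monom R (r \<otimes> s) (u @ v) w"
  proof (cases "w = u @ v")
    case True
    then show ?thesis using assms by (simp add: free_monom_def finsum_singleton)
  next
    case False
    then show ?thesis by (simp add: free_monom_def finsum_zero)
  qed
  finally show "(free_monom R r u \<otimes>\<^bsub>free_algebra R X\<^esub> free_monom R s v) w
    = free_monom R (r \<otimes> s) (u @ v) w" .
qed

lemma free_algebra_one: "\<one>\<^bsub>free_algebra R X\<^esub> = free_monom R \<one> []"
  and free_algebra_zero: "\<zero>\<^bsub>free_algebra R X\<^esub> = (\<lambda>w. \<zero>)"
  and free_gen_monom: "free_gen R x = free_monom R \<one> [x]"
  and free_algebra_add: "f \<oplus>\<^bsub>free_algebra R X\<^esub> g = (\<lambda>w. f w \<oplus> g w)"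
  by (simp_all add: free_algebra_def free_monom_def free_gen_def)

lemma free_gen_closed [simp]: "x \<in> X \<Longrightarrow> free_gen R x \<in> carrier (free_algebra R X)"
  by (simp add: free_gen_monom)

lemma free_algebra_one_mult:
  assumes "f \<in> carrier (free_algebra R X)"
  shows "\<one>\<^bsub>free_algebra R X\<^esub> \<otimes>\<^bsub>free_algebra R X\<^esub> f = f"
    and "f \<otimes>\<^bsub>free_algebra R X\<^esub> \<one>\<^bsub>free_algebra R X\<^esub> = f"
proof -
  note c = free_algebra_carrierD(1)[OF assms]
  have "(\<Oplus>k\<in>{..length w}. (if take k w = [] then \<one> else \<zero>) \<otimes> f (drop k w)) =
    (\<Oplus>k\<in>{..length w}. if 0 = k then f w else \<zero>)" for w
    using c by (intro finsum_cong') auto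
  moreover have "(\<Oplus>k\<in>{..length w}. if 0 = k then f w else \<zero>) = f w" for w
    using c by (subst finsum_singleton) auto
  ultimately show "\<one>\<^bsub>free_algebra R X\<^esub> \<otimes>\<^bsub>free_algebra R X\<^esub> f = f"
    by (simp add: free_algebra_def)
  have "(\<Oplus>k\<in>{..length w}. f (take k w) \<otimes> (if drop k w = [] then \<one> else \<zero>)) =
    (\<Oplus>k\<in>{..length w}. if length w = k then f w else \<zero>)" for w
    using c by (intro finsum_cong') auto
  moreover have "(\<Oplus>k\<in>{..length w}. if length w = k then f w else \<zero>) = f w" for w
    using c by (subst finsum_singleton) auto
  ultimately show "f \<otimes>\<^bsub>free_algebra R X\<^esub> \<one>\<^bsub>free_algebra R X\<^esub> = f"
    by (simp add: free_algebra_def)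
qed

lemma free_algebra_ring: "ring (free_algebra R X)"
proof (rule ringI)
  show "abelian_group (free_algebra R X)"
  proof (rule abelian_groupI)
    fix f assume f: "f \<in> carrier (free_algebra R X)"
    have "(\<lambda>w. \<ominus> f w) \<in> carrier (free_algebra R X)"
    proof -
      have "{w. \<ominus> f w \<noteq> \<zero>} = {w. f w \<noteq> \<zero>}" 
        using free_algebra_carrierD(1)[OF f] by (metis a_inv_closed minus_minus minus_zero)
      with f show ?thesis by (auto simp: free_algebra_def)
    qed
    moreover have "(\<lambda>w. \<ominus> f w) \<oplus>\<^bsub>free_algebra R X\<^esub> f = \<zero>\<^bsub>free_algebra R X\<^esub>"
      using free_algebra_carrierD(1)[OF f] by (auto simp: free_algebra_def l_neg)
    ultimately show "\<exists>y\<in>carrier (free_algebra R X). y \<oplus>\<^bsub>free_algebra R X\<^esub> f = \<zero>\<^bsub>free_algebra R X\<^esub>"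
      by auto
  qed (auto simp: free_algebra_add_closed,
      auto simp: free_algebra_def a_ac image_subset_iff intro!: ext)
  show "monoid (free_algebra R X)"
    by (rule monoidI) (auto simp: free_algebra_mult_closed free_algebra_assoc free_algebra_one_mult,
        auto simp: free_algebra_one)
next
  fix f g h
  assume *: "f \<in> carrier (free_algebra R X)" "g \<in> carrier (free_algebra R X)"
    "h \<in> carrier (free_algebra R X)"
  note c = free_algebra_carrierD(1)[OF *(1)] free_algebra_carrierD(1)[OF *(2)]
    free_algebra_carrierD(1)[OF *(3)]
  show "(f \<oplus>\<^bsub>free_algebra R X\<^esub> g) \<otimes>\<^bsub>free_algebra R X\<^esub> h =
    f \<otimes>\<^bsub>free_algebra R X\<^esub> h \<oplus>\<^bsub>free_algebra R X\<^esub> g \<otimes>\<^bsub>free_algebra R X\<^esub> h"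
    using c by (auto simp: free_algebra_def l_distr finsum_addf Pi_def)
  show "h \<otimes>\<^bsub>free_algebra R X\<^esub> (f \<oplus>\<^bsub>free_algebra R X\<^esub> g) =
    h \<otimes>\<^bsub>free_algebra R X\<^esub> f \<oplus>\<^bsub>free_algebra R X\<^esub> h \<otimes>\<^bsub>free_algebra R X\<^esub> g"
    using c by (auto simp: free_algebra_def r_distr finsum_addf Pi_def)
qed

text \<open>The support is finite, and \<open>f(v := \<zero>)\<close> has one word less in it; the
  induction removes one monomial at a time.\<close>

lemma free_algebra_induct [consumes 1, case_names zero add monom]:
  assumes "f \<in> carrier (free_algebra R X)"
    and "P (\<lambda>w. \<zero>)"
    and add: "\<And>r v g. r \<in> carrier R \<Longrightarrow> v \<in> lists X \<Longrightarrow> g \<in> carrier (free_algebra R X) \<Longrightarrow> P g \<Longrightarrow>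
      P (free_monom R r v \<oplus>\<^bsub>free_algebra R X\<^esub> g)"
  shows "P f"
proof -
  have "finite {w. f w \<noteq> \<zero>}" using assms(1) free_algebra_carrierD(3) by blast
  then show ?thesis using assms(1)
  proof (induction "{w. f w \<noteq> \<zero>}" arbitrary: f rule: finite_induct)
    case empty
    then have "f = (\<lambda>w. \<zero>)" by auto
    then show ?case using assms(2) by simp
  next
    case (insert v S f)
    let ?g = "f(v := \<zero>)"
    have S: "S = {w. ?g w \<noteq> \<zero>}" using insert.hyps by auto
    have g: "?g \<in> carrier (free_algebra R X)"
      using insert.prems insert.hyps S by (auto simp: free_algebra_def)
    have fv: "f v \<in> carrier R" "v \<in> lists X"
      using free_algebra_carrierD[OF insert.prems] insert.hyps(4) by auto
    have "f = free_monom R (f v) v \<oplus>\<^bsub>free_algebra R X\<^esub> ?g"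
      using free_algebra_carrierD(1)[OF insert.prems]
      by (auto simp: free_algebra_def free_monom_def)
    moreover have "P ?g" using insert.hyps(3)[OF S g] .
    ultimately show ?case using add[OF fv g] by metis
  qed
qed

end

section \<open>Universal properties of free algebras and of quotients\<close>

definition word_eval :: "('b, 'n) ring_scheme \<Rightarrow> ('x \<Rightarrow> 'b) \<Rightarrow> 'x list \<Rightarrow> 'b" where
  "word_eval B \<sigma> v = foldr (\<lambda>x y. \<sigma> x \<otimes>\<^bsub>B\<^esub> y) v \<one>\<^bsub>B\<^esub>"

lemma word_eval_simps [simp]:
  "word_eval B \<sigma> [] = \<one>\<^bsub>B\<^esub>" "word_eval B \<sigma> (x # v) = \<sigma> x \<otimes>\<^bsub>B\<^esub> word_eval B \<sigma> v"
  by (simp_all add: word_eval_def)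

lemma (in ring) word_eval_closed [simp]:
  "\<sigma> \<in> X \<rightarrow> carrier R \<Longrightarrow> v \<in> lists X \<Longrightarrow> word_eval R \<sigma> v \<in> carrier R"
  by (induction v) (auto simp: Pi_def)

lemma (in ring) word_eval_append:
  "\<sigma> \<in> X \<rightarrow> carrier R \<Longrightarrow> u \<in> lists X \<Longrightarrow> v \<in> lists X \<Longrightarrow>
    word_eval R \<sigma> (u @ v) = word_eval R \<sigma> u \<otimes> word_eval R \<sigma> v"
  by (induction u) (auto simp: m_assoc Pi_def)

text \<open>Universal property of the free algebra. The values of \<open>\<kappa>\<close> have to be
  central, since multiplying two monomials moves the second coefficient past the first word.\<close>

lemma free_algebra_extend:
  fixes R :: "('r, 'm) ring_scheme" and B :: "('b, 'n) ring_scheme"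
  assumes "ring R" "ring B" and \<kappa>: "\<kappa> \<in> ring_hom R B"
    and central: "\<And>r b. r \<in> carrier R \<Longrightarrow> b \<in> carrier B \<Longrightarrow> \<kappa> r \<otimes>\<^bsub>B\<^esub> b = b \<otimes>\<^bsub>B\<^esub> \<kappa> r"
    and \<sigma>: "\<sigma> \<in> X \<rightarrow> carrier B"
  obtains h where "h \<in> ring_hom (free_algebra R X) B"
    and "\<And>r v. r \<in> carrier R \<Longrightarrow> v \<in> lists X \<Longrightarrow> h (free_monom R r v) = \<kappa> r \<otimes>\<^bsub>B\<^esub> word_eval B \<sigma> v"
proof -
  interpret R: ring R by fact
  interpret B: ring B by fact
  interpret K: ring_hom_ring R B \<kappa> by (rule ring_hom_ringI2) fact+
  let ?A = "free_algebra R X"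
  interpret A: ring ?A by (rule R.free_algebra_ring)
  let ?t = "\<lambda>f w. \<kappa> (f w) \<otimes>\<^bsub>B\<^esub> word_eval B \<sigma> w"
  define h where "h f = finsum B (?t f) {w. f w \<noteq> \<zero>\<^bsub>R\<^esub>}" for f
  note we = B.word_eval_closed[OF \<sigma>]
  have t: "?t f w \<in> carrier B" if "f \<in> carrier ?A" "w \<in> lists X" for f w
    using that R.free_algebra_carrierD(1)[OF that(1)] we by auto
  \<comment> \<open>The sum may run over any finite set of words containing the support. This
    freedom makes \<open>h\<close> additive, because cancellation can shrink the support of a
    sum.\<close>
  have h_eq: "h f = finsum B (?t f) W"
    if "f \<in> carrier ?A" "finite W" "{w. f w \<noteq> \<zero>\<^bsub>R\<^esub>} \<subseteq> W" "W \<subseteq> lists X" for f W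
    unfolding h_def
  proof (rule B.add.finprod_mono_neutral_cong_left)
    have tW: "w \<in> lists X" "?t f w \<in> carrier B" "word_eval B \<sigma> w \<in> carrier B" if "w \<in> W" for w
      using \<open>W \<subseteq> lists X\<close> that t[OF \<open>f \<in> carrier ?A\<close>] we by blast+
    then show "?t f \<in> W \<rightarrow> carrier B" by blast
    show "?t f w = \<zero>\<^bsub>B\<^esub>" if "w \<in> W - {w. f w \<noteq> \<zero>\<^bsub>R\<^esub>}" for w
      using that tW by simp
  qed (use that in auto)
  have h_closed: "h f \<in> carrier B" if "f \<in> carrier ?A" for f
    unfolding h_def using t[OF that] R.free_algebra_carrierD(2)[OF that]
    by (auto intro!: B.finsum_closed)
  have h_monom: "h (free_monom R r v) = \<kappa> r \<otimes>\<^bsub>B\<^esub> word_eval B \<sigma> v"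
    if "r \<in> carrier R" "v \<in> lists X" for r v
  proof -
    have "h (free_monom R r v) = finsum B (?t (free_monom R r v)) {v}"
    proof (rule h_eq)
      show "free_monom R r v \<in> carrier ?A" using that by simp
    qed (use that in \<open>auto simp: free_monom_def\<close>)
    then show ?thesis using that(1) we[OF that(2)] by (simp add: free_monom_def)
  qed
  have h_add: "h (f \<oplus>\<^bsub>?A\<^esub> g) = h f \<oplus>\<^bsub>B\<^esub> h g" if fg: "f \<in> carrier ?A" "g \<in> carrier ?A" for f g
  proof -
    note f = R.free_algebra_carrierD[OF fg(1)] and g = R.free_algebra_carrierD[OF fg(2)]
    obtain W where W: "finite W" "W \<subseteq> lists X" "{w. f w \<noteq> \<zero>\<^bsub>R\<^esub>} \<subseteq> W" "{w. g w \<noteq> \<zero>\<^bsub>R\<^esub>} \<subseteq> W"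
    proof (rule that[of "{w. f w \<noteq> \<zero>\<^bsub>R\<^esub>} \<union> {w. g w \<noteq> \<zero>\<^bsub>R\<^esub>}"])
      show "{w. f w \<noteq> \<zero>\<^bsub>R\<^esub>} \<union> {w. g w \<noteq> \<zero>\<^bsub>R\<^esub>} \<subseteq> lists X"
        using f(2) g(2) by blast
    qed (use f(3) g(3) in simp_all)
    have c: "word_eval B \<sigma> w \<in> carrier B" "?t f w \<in> carrier B" "?t g w \<in> carrier B" if "w \<in> W" for w
    proof -
      have "w \<in> lists X" using that W(2) by (rule subsetD[rotated])
      then show "word_eval B \<sigma> w \<in> carrier B" "?t f w \<in> carrier B" "?t g w \<in> carrier B"
        by (rule we, rule t[OF fg(1)], rule t[OF fg(2)])
    qed
    have "h (f \<oplus>\<^bsub>?A\<^esub> g) = finsum B (?t (f \<oplus>\<^bsub>?A\<^esub> g)) W"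
    proof (rule h_eq)
      show "f \<oplus>\<^bsub>?A\<^esub> g \<in> carrier ?A" using fg by simp
      have "(f \<oplus>\<^bsub>?A\<^esub> g) w = \<zero>\<^bsub>R\<^esub>" if "w \<notin> W" for w
      proof -
        have "f w = \<zero>\<^bsub>R\<^esub>" "g w = \<zero>\<^bsub>R\<^esub>" using that W(3,4) by blast+
        then show ?thesis by (simp add: R.free_algebra_add)
      qed
      then show "{w. (f \<oplus>\<^bsub>?A\<^esub> g) w \<noteq> \<zero>\<^bsub>R\<^esub>} \<subseteq> W" by blast
    qed (rule W)+
    also have "\<dots> = finsum B (\<lambda>w. ?t f w \<oplus>\<^bsub>B\<^esub> ?t g w) W"
      using f(1) g(1) c by (intro B.finsum_cong') (auto simp: R.free_algebra_add B.l_distr)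
    also have "\<dots> = finsum B (?t f) W \<oplus>\<^bsub>B\<^esub> finsum B (?t g) W"
      using c by (intro B.finsum_addf) auto
    also have "\<dots> = h f \<oplus>\<^bsub>B\<^esub> h g"
      using h_eq[OF fg(1) W(1,3,2)] h_eq[OF fg(2) W(1,4,2)] by simp
    finally show ?thesis .
  qed
  have h_zero: "h (\<lambda>w. \<zero>\<^bsub>R\<^esub>) = \<zero>\<^bsub>B\<^esub>" by (simp add: h_def)
  have Z: "(\<lambda>w. \<zero>\<^bsub>R\<^esub>) = \<zero>\<^bsub>?A\<^esub>" by (simp add: free_algebra_def)
  have h_mm: "h (free_monom R r u \<otimes>\<^bsub>?A\<^esub> free_monom R s v) = h (free_monom R r u) \<otimes>\<^bsub>B\<^esub> h (free_monom R s v)"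
    if "r \<in> carrier R" "s \<in> carrier R" "u \<in> lists X" "v \<in> lists X" for r s u v
  proof -
    note wu = we[OF that(3)] and wv = we[OF that(4)]
    have "h (free_monom R r u \<otimes>\<^bsub>?A\<^esub> free_monom R s v)
       = \<kappa> r \<otimes>\<^bsub>B\<^esub> \<kappa> s \<otimes>\<^bsub>B\<^esub> (word_eval B \<sigma> u \<otimes>\<^bsub>B\<^esub> word_eval B \<sigma> v)"
      using that by (simp add: R.free_monom_mult h_monom B.word_eval_append[OF \<sigma>])
    also have "\<dots> = \<kappa> r \<otimes>\<^bsub>B\<^esub> (\<kappa> s \<otimes>\<^bsub>B\<^esub> word_eval B \<sigma> u) \<otimes>\<^bsub>B\<^esub> word_eval B \<sigma> v"
      using that wu wv by (simp add: B.m_assoc)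
    also have "\<dots> = \<kappa> r \<otimes>\<^bsub>B\<^esub> (word_eval B \<sigma> u \<otimes>\<^bsub>B\<^esub> \<kappa> s) \<otimes>\<^bsub>B\<^esub> word_eval B \<sigma> v"
      using that wu by (simp add: central)
    also have "\<dots> = h (free_monom R r u) \<otimes>\<^bsub>B\<^esub> h (free_monom R s v)"
      using that wu wv by (simp add: h_monom B.m_assoc)
    finally show ?thesis .
  qed
  \<comment> \<open>Bilinearity carries multiplicativity from monomials to an arbitrary right
    factor, and afterwards, in \<open>h_mult\<close>, to an arbitrary left factor.\<close>
  have h_mg: "h (free_monom R r u \<otimes>\<^bsub>?A\<^esub> g) = h (free_monom R r u) \<otimes>\<^bsub>B\<^esub> h g"
    if "g \<in> carrier ?A" "r \<in> carrier R" "u \<in> lists X" for r u g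
    using that(1)
  proof (induction rule: R.free_algebra_induct)
    case zero
    then show ?case using that h_zero h_closed by (simp add: Z)
  next
    case (add s v g)
    then show ?case using that by (simp add: A.r_distr h_add h_mm B.r_distr h_closed)
  qed
  have h_mult: "h (f \<otimes>\<^bsub>?A\<^esub> g) = h f \<otimes>\<^bsub>B\<^esub> h g" if "f \<in> carrier ?A" "g \<in> carrier ?A" for f g
    using that
  proof (induction rule: R.free_algebra_induct)
    case zero
    then show ?case using that h_zero h_closed by (simp add: Z)
  next
    case (add s v f)
    then show ?case using that by (simp add: A.l_distr h_add h_mg B.l_distr h_closed)
  qed
  have "h \<in> ring_hom ?A B"
    by (rule ring_hom_memI) (auto simp: h_closed h_add h_mult R.free_algebra_one h_monom)
  then show ?thesis using h_monom that by blast
qed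

text \<open>\<open>h\<close> is constant on each coset of \<open>I\<close>, so the image of a coset
  is a singleton, and \<open>the_elem\<close> reads off its value without a choice of
  representatives.\<close>

lemma quotient_factor:
  assumes "ideal I A" "ring B" "h \<in> ring_hom A B" "\<And>x. x \<in> I \<Longrightarrow> h x = \<zero>\<^bsub>B\<^esub>"
  obtains h' where "h' \<in> ring_hom (A Quot I) B"
    and "\<And>x. x \<in> carrier A \<Longrightarrow> h' (I +>\<^bsub>A\<^esub> x) = h x"
proof -
  interpret I: ideal I A by fact
  interpret B: ring B by fact
  interpret h: ring_hom_ring A B h by (rule ring_hom_ringI2) (rule I.ring_axioms, fact+)
  define h' where "h' X = the_elem (h ` X)" for X
  have h': "h' (I +>\<^bsub>A\<^esub> x) = h x" if "x \<in> carrier A" for x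
  proof -
    have "h y = h x" if "y \<in> I +>\<^bsub>A\<^esub> x" for y
      using that \<open>x \<in> carrier A\<close> assms(4) I.Icarr by (auto simp: a_r_coset_def')
    moreover have "x \<in> I +>\<^bsub>A\<^esub> x" by (simp add: I.a_rcos_self that)
    ultimately have "h ` (I +>\<^bsub>A\<^esub> x) = {h x}" by blast
    then show ?thesis by (simp add: h'_def)
  qed
  have "h' \<in> ring_hom (A Quot I) B"
    by (rule ring_hom_memI)
      (auto simp: FactRing_simps h' I.rcoset_mult_add I.a_rcos_sum set_add_def[symmetric])
  then show ?thesis using h' that by blast
qed

text \<open>The kernel of \<open>h\<close> is an ideal containing \<open>E\<close>, hence it
  contains the ideal generated by \<open>E\<close>.\<close>

lemma genideal_vanish:
  assumes "ring A" "ring B" "h \<in> ring_hom A B" "\<And>x. x \<in> E \<Longrightarrow> x \<in> carrier A \<and> h x = \<zero>\<^bsub>B\<^esub>"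
    and "x \<in> Idl\<^bsub>A\<^esub> E"
  shows "h x = \<zero>\<^bsub>B\<^esub>"
proof -
  have hh: "ring_hom_ring A B h" by (rule ring_hom_ringI2[OF assms(1-3)])
  have K: "ideal (a_kernel A B h) A" by (rule ring_hom_ring.kernel_is_ideal[OF hh])
  have E: "E \<subseteq> a_kernel A B h" unfolding a_kernel_def' using assms(4) by blast
  have "Idl\<^bsub>A\<^esub> E \<subseteq> a_kernel A B h"
    by (rule ring.genideal_minimal[OF assms(1) K E])
  then have "x \<in> a_kernel A B h" using assms(5) by (rule subsetD)
  then show ?thesis unfolding a_kernel_def' by blast
qed

lemma (in ideal) quotient_zero_iff:
  "x \<in> carrier R \<Longrightarrow> I +> x = \<zero>\<^bsub>R Quot I\<^esub> \<longleftrightarrow> x \<in> I"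
  using rcos_const_imp_mem a_rcos_zero[OF is_ideal] by (auto simp: FactRing_def)

section \<open>Rings generated by symbols\<close>

text \<open>Elementary description of a degree part: the additive group generated by products of
  \<open>n\<close> generators, the empty product being one. It presupposes no grading of
  \<open>B\<close>, so an element might a priori lie in several degrees; zero lies in all of
  them.\<close>

inductive graded_span :: "('b, 'n) ring_scheme \<Rightarrow> ('x \<Rightarrow> 'b) \<Rightarrow> 'x set \<Rightarrow> nat \<Rightarrow> 'b \<Rightarrow> bool"
  for B g X where
  one: "graded_span B g X 0 \<one>\<^bsub>B\<^esub>"
| zero: "graded_span B g X n \<zero>\<^bsub>B\<^esub>"
| gen_mult: "a \<in> X \<Longrightarrow> graded_span B g X n x \<Longrightarrow> graded_span B g X (Suc n) (g a \<otimes>\<^bsub>B\<^esub> x)"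
| add: "graded_span B g X n x \<Longrightarrow> graded_span B g X n y \<Longrightarrow> graded_span B g X n (x \<oplus>\<^bsub>B\<^esub> y)"
| neg: "graded_span B g X n x \<Longrightarrow> graded_span B g X n (\<ominus>\<^bsub>B\<^esub> x)"

context ring
begin

lemma graded_span_closed:
  assumes "g \<in> X \<rightarrow> carrier R" "graded_span R g X n x"
  shows "x \<in> carrier R"
  using assms(2) by induction (use assms(1) in \<open>auto simp: Pi_def\<close>)

lemma graded_span_mult:
  assumes g: "g \<in> X \<rightarrow> carrier R" and "graded_span R g X n x" "graded_span R g X m y"
  shows "graded_span R g X (n + m) (x \<otimes> y)"
  using assms(2)
proof induction
  case (zero n)
  then show ?case using assms graded_span.zero by (simp add: graded_span_closed[OF g])
next
  case (gen_mult a n x)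
  then have "g a \<otimes> x \<otimes> y = g a \<otimes> (x \<otimes> y)"
    using g assms(3) by (intro m_assoc) (auto simp: graded_span_closed[OF g])
  then show ?case using gen_mult graded_span.gen_mult by fastforce
next
  case (add n x x')
  then show ?case
    using assms graded_span.add by (fastforce simp: l_distr graded_span_closed[OF g])
next
  case (neg n x)
  then show ?case
    using assms graded_span.neg by (fastforce simp: l_minus graded_span_closed[OF g])
qed (use assms graded_span_closed[OF g] in auto)

lemma graded_span_gen:
  assumes g: "g \<in> X \<rightarrow> carrier R" and "a \<in> X"
  shows "graded_span R g X 1 (g a)"
proof -
  have "graded_span R g X (Suc 0) (g a \<otimes> \<one>)"
    by (rule graded_span.gen_mult[OF assms(2) graded_span.one])
  then show ?thesis using assms by (auto simp: Pi_def)
qed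

lemma graded_span_pow:
  assumes g: "g \<in> X \<rightarrow> carrier R" and "a \<in> X"
  shows "graded_span R g X n (g a [^] n)"
proof (induction n)
  case 0
  show ?case by (simp add: graded_span.one)
next
  case (Suc n)
  show ?case using graded_span_mult[OF g Suc graded_span_gen[OF assms]] by simp
qed

text \<open>Degree 0 is the additive group generated by one, which in characteristic 2 has no
  further elements. The induction keeps the degree as a variable together with \<open>n = 0\<close>,
  which discards the product case.\<close>

lemma graded_span_0:
  assumes "g \<in> X \<rightarrow> carrier R" and two: "\<one> \<oplus> \<one> = \<zero>"
  shows "graded_span R g X 0 x \<longleftrightarrow> x \<in> {\<zero>, \<one>}"
proof
  have "x \<in> {\<zero>, \<one>}" if "graded_span R g X n x" "n = 0" for x n
    using that
  proof induction
    case (neg n x)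
    have "\<ominus> \<one> = \<one>" using two by (simp add: minus_equality)
    with neg show ?case by auto
  qed (use two in auto)
  then show "graded_span R g X 0 x \<Longrightarrow> x \<in> {\<zero>, \<one>}" by blast
  show "x \<in> {\<zero>, \<one>} \<Longrightarrow> graded_span R g X 0 x"
    using graded_span.one graded_span.zero by auto
qed

end

lemma ring_hom_graded_span:
  assumes "ring B" "ring C" "\<phi> \<in> ring_hom B C" "g \<in> X \<rightarrow> carrier B" "q \<in> X \<rightarrow> Y"
    and "\<And>a. a \<in> X \<Longrightarrow> \<phi> (g a) = g' (q a)"
    and "graded_span B g X n x"
  shows "graded_span C g' Y n (\<phi> x)"
proof -
  interpret \<phi>: ring_hom_ring B C \<phi> by (rule ring_hom_ringI2[OF assms(1-3)])
  note c = \<phi>.R.graded_span_closed[OF assms(4)]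
  show ?thesis using assms(7)
  proof induction
    case (gen_mult a n x)
    then have "\<phi> (g a \<otimes>\<^bsub>B\<^esub> x) = g' (q a) \<otimes>\<^bsub>C\<^esub> \<phi> x" using c assms(4,6) by (auto simp: Pi_def)
    then show ?case using gen_mult assms(5) by (auto intro: graded_span.gen_mult)
  qed (use c in \<open>auto intro: graded_span.intros\<close>)
qed

text \<open>A preimage of the same degree is built along the derivation of \<open>y\<close>;
  surjectivity of \<open>q\<close> supplies a preimage of each generator.\<close>

lemma ring_hom_graded_span_surj:
  assumes "ring B" "ring C" "\<phi> \<in> ring_hom B C" "g \<in> X \<rightarrow> carrier B" "q ` X = Y"
    and "\<And>a. a \<in> X \<Longrightarrow> \<phi> (g a) = g' (q a)"
    and "graded_span C g' Y n y"
  shows "\<exists>x. graded_span B g X n x \<and> \<phi> x = y"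
proof -
  interpret \<phi>: ring_hom_ring B C \<phi> by (rule ring_hom_ringI2[OF assms(1-3)])
  note c = \<phi>.R.graded_span_closed[OF assms(4)]
  show ?thesis using assms(7)
  proof induction
    case one
    show ?case using graded_span.one by force
  next
    case (zero n)
    show ?case using graded_span.zero by force
  next
    case (gen_mult b n y)
    then obtain a x where "a \<in> X" "b = q a" "graded_span B g X n x" "\<phi> x = y"
      using assms(5) by auto
    moreover from this have "\<phi> (g a \<otimes>\<^bsub>B\<^esub> x) = g' b \<otimes>\<^bsub>C\<^esub> y"
      using c assms(4,6) by (auto simp: Pi_def)
    ultimately show ?case using graded_span.gen_mult by metis
  next
    case (add n y y')
    then obtain x x' where "graded_span B g X n x" "\<phi> x = y" "graded_span B g X n x'" "\<phi> x' = y'"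
      by auto
    then show ?case using c by (intro exI[of _ "x \<oplus>\<^bsub>B\<^esub> x'"]) (auto intro: graded_span.add)
  next
    case (neg n y)
    then obtain x where "graded_span B g X n x" "\<phi> x = y" by auto
    then show ?case using c by (intro exI[of _ "\<ominus>\<^bsub>B\<^esub> x"]) (auto intro: graded_span.neg)
  qed
qed

section \<open>Presentations of symbol rings\<close>

definition symbol_rels :: "int ring \<Rightarrow> ('x, 'n) monoid_scheme \<Rightarrow> ('x \<times> 'x) set \<Rightarrow> ('x list \<Rightarrow> int) set set"
  where "symbol_rels R A P =
    {tensor_incl R (power_module A) a \<otimes>\<^bsub>tensor_algebra R (power_module A)\<^esub> tensor_incl R (power_module A) b
      | a b. (a, b) \<in> P}"

definition symbol_ring :: "int ring \<Rightarrow> ('x, 'n) monoid_scheme \<Rightarrow> ('x \<times> 'x) set \<Rightarrow> ('x list \<Rightarrow> int) set set ring"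
  where "symbol_ring R A P = tensor_algebra R (power_module A) Quot
    (Idl\<^bsub>tensor_algebra R (power_module A)\<^esub> (symbol_rels R A P))"

definition symbol :: "int ring \<Rightarrow> ('x, 'n) monoid_scheme \<Rightarrow> ('x \<times> 'x) set \<Rightarrow> 'x \<Rightarrow> ('x list \<Rightarrow> int) set set"
  where "symbol R A P a = (Idl\<^bsub>tensor_algebra R (power_module A)\<^esub> (symbol_rels R A P))
    +>\<^bsub>tensor_algebra R (power_module A)\<^esub> tensor_incl R (power_module A) a"

lemma quotient_class:
  assumes "X \<in> carrier (A Quot I)"
  obtains x where "x \<in> carrier A" "X = I +>\<^bsub>A\<^esub> x"
  using assms by (auto simp: FactRing_def A_RCOSETS_def' a_r_coset_def')

locale symbol_presentation = A: comm_group A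
  for A :: "('x, 'n) monoid_scheme" +
  fixes R :: "int ring" and P :: "('x \<times> 'x) set"
  assumes coeffs: "R = \<Z> \<or> R = residue_ring 2"
    and rels_closed: "P \<subseteq> carrier A \<times> carrier A"
begin

abbreviation "FA \<equiv> free_algebra R (carrier A)"
abbreviation "M \<equiv> power_module A"
abbreviation "TI \<equiv> tensor_ideal R M"
abbreviation "TA \<equiv> tensor_algebra R M"
abbreviation "J \<equiv> Idl\<^bsub>TA\<^esub> (symbol_rels R A P)"
abbreviation "Q \<equiv> symbol_ring R A P"
abbreviation "\<rho> \<equiv> symbol R A P"
abbreviation "\<pi> f \<equiv> J +>\<^bsub>TA\<^esub> (TI +>\<^bsub>FA\<^esub> f)"

lemma carrier_M [simp]: "carrier M = carrier A"
  by (simp add: power_module_def)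

lemma coeff_cring: "cring R"
proof -
  have "residues 2" by (simp add: residues_def)
  then show ?thesis using coeffs int_is_cring residues.cring[of 2] by auto
qed

sublocale R: cring R by (rule coeff_cring)
sublocale FA: ring FA by (rule R.free_algebra_ring)

lemma smult_gen:
  "r \<in> carrier R \<Longrightarrow> (\<lambda>w. r \<otimes>\<^bsub>R\<^esub> free_gen R x w) = free_monom R r [x]"
  by (auto simp: free_gen_def free_monom_def)

lemma linear_rels_closed: "linear_rels R M \<subseteq> carrier FA"
proof -
  have "free_gen R (x \<oplus>\<^bsub>M\<^esub> y) \<ominus>\<^bsub>FA\<^esub> (free_gen R x \<oplus>\<^bsub>FA\<^esub> free_gen R y) \<in> carrier FA"
    if "x \<in> carrier A" "y \<in> carrier A" for x y
    using that by (intro FA.minus_closed FA.a_closed R.free_gen_closed) (auto simp: power_module_def)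
  moreover have "free_gen R (r \<odot>\<^bsub>M\<^esub> x) \<ominus>\<^bsub>FA\<^esub> free_monom R r [x] \<in> carrier FA"
    if "x \<in> carrier A" "r \<in> carrier R" for x r
    using that by (intro FA.minus_closed R.free_gen_closed R.free_monom_closed)
      (auto simp: power_module_def)
  ultimately show ?thesis unfolding linear_rels_def by (auto simp: smult_gen)
qed

sublocale TI: ideal TI FA
  using FA.genideal_ideal[OF linear_rels_closed] by (simp add: tensor_ideal_def)

lemma TA_ring: "ring TA"
  using TI.quotient_is_ring by (simp add: tensor_algebra_def)

sublocale TA: ring TA by (rule TA_ring)

lemma tensor_class_hom: "(\<lambda>f. TI +>\<^bsub>FA\<^esub> f) \<in> ring_hom FA TA"
  using TI.rcos_ring_hom by (simp add: tensor_algebra_def)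

lemma tensor_incl_closed: "a \<in> carrier A \<Longrightarrow> tensor_incl R M a \<in> carrier TA"
  using ring_hom_closed[OF tensor_class_hom, of "free_gen R a"] by (simp add: tensor_incl_def)

lemma symbol_rels_closed: "symbol_rels R A P \<subseteq> carrier TA"
  using rels_closed by (auto simp: symbol_rels_def tensor_incl_closed)

sublocale J: ideal J TA
  by (rule TA.genideal_ideal[OF symbol_rels_closed])

lemma Q_ring: "ring Q"
  using J.quotient_is_ring by (simp add: symbol_ring_def)

sublocale Q: ring Q by (rule Q_ring)

lemma class_hom: "\<pi> \<in> ring_hom FA Q"
  using ring_hom_trans[OF tensor_class_hom, of "\<lambda>u. J +>\<^bsub>TA\<^esub> u" Q] J.rcos_ring_hom
  by (simp add: symbol_ring_def comp_def)

sublocale \<pi>: ring_hom_ring FA Q \<pi>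
  by (rule ring_hom_ringI2[OF FA.ring_axioms Q_ring class_hom])

lemma class_surj:
  assumes "y \<in> carrier Q"
  obtains f where "f \<in> carrier FA" "y = \<pi> f"
proof -
  obtain u where u: "u \<in> carrier TA" "y = J +>\<^bsub>TA\<^esub> u"
    by (rule quotient_class[OF assms[unfolded symbol_ring_def]])
  obtain f where "f \<in> carrier FA" "u = TI +>\<^bsub>FA\<^esub> f"
    by (rule quotient_class[OF u(1)[unfolded tensor_algebra_def carrier_M]])
  with u that show ?thesis by simp
qed

lemma symbol_class: "\<rho> a = \<pi> (free_gen R a)"
  by (simp add: symbol_def tensor_incl_def)

lemma symbol_closed [simp]: "a \<in> carrier A \<Longrightarrow> \<rho> a \<in> carrier Q"
  by (simp add: symbol_class)

lemma symbol_Pi: "\<rho> \<in> carrier A \<rightarrow> carrier Q"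
  by simp

lemma symbol_mult:
  assumes "a \<in> carrier A" "b \<in> carrier A"
  shows "\<rho> (a \<otimes>\<^bsub>A\<^esub> b) = \<rho> a \<oplus>\<^bsub>Q\<^esub> \<rho> b"
proof -
  let ?d = "free_gen R (a \<otimes>\<^bsub>A\<^esub> b) \<ominus>\<^bsub>FA\<^esub> (free_gen R a \<oplus>\<^bsub>FA\<^esub> free_gen R b)"
  have "?d \<in> linear_rels R M"
    using assms by (auto simp: linear_rels_def power_module_def)
  then have "?d \<in> TI"
    using FA.genideal_self[OF linear_rels_closed] by (auto simp: tensor_ideal_def)
  then have "TI +>\<^bsub>FA\<^esub> ?d = \<zero>\<^bsub>TA\<^esub>"
    using FA.a_rcos_zero[OF TI.is_ideal] by (simp add: tensor_algebra_def FactRing_def)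
  moreover have "J +>\<^bsub>TA\<^esub> \<zero>\<^bsub>TA\<^esub> = \<zero>\<^bsub>Q\<^esub>"
    using J.quotient_zero_iff[of "\<zero>\<^bsub>TA\<^esub>"] by (simp add: symbol_ring_def)
  ultimately have "\<pi> ?d = \<zero>\<^bsub>Q\<^esub>" by simp
  then have "\<rho> (a \<otimes>\<^bsub>A\<^esub> b) \<ominus>\<^bsub>Q\<^esub> (\<rho> a \<oplus>\<^bsub>Q\<^esub> \<rho> b) = \<zero>\<^bsub>Q\<^esub>"
    using assms by (simp add: symbol_class a_minus_def)
  then show ?thesis using assms by (simp add: Q.r_right_minus_eq)
qed

lemma symbol_rel:
  assumes "(a, b) \<in> P"
  shows "\<rho> a \<otimes>\<^bsub>Q\<^esub> \<rho> b = \<zero>\<^bsub>Q\<^esub>"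
proof -
  let ?x = "tensor_incl R M a \<otimes>\<^bsub>TA\<^esub> tensor_incl R M b"
  have ab: "a \<in> carrier A" "b \<in> carrier A" using assms rels_closed by auto
  have "?x \<in> symbol_rels R A P" using assms by (auto simp: symbol_rels_def)
  then have "?x \<in> J" using TA.genideal_self[OF symbol_rels_closed] by auto
  then have "J +>\<^bsub>TA\<^esub> ?x = \<zero>\<^bsub>Q\<^esub>"
    using J.quotient_zero_iff[of ?x] tensor_incl_closed ab by (simp add: symbol_ring_def)
  moreover have "J +>\<^bsub>TA\<^esub> ?x = \<rho> a \<otimes>\<^bsub>Q\<^esub> \<rho> b"
    using ring_hom_mult[OF J.rcos_ring_hom] tensor_incl_closed ab
    by (simp add: symbol_def symbol_ring_def)
  ultimately show ?thesis by simp
qed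

lemma char_2:
  assumes "R = residue_ring 2"
  shows "\<one>\<^bsub>Q\<^esub> \<oplus>\<^bsub>Q\<^esub> \<one>\<^bsub>Q\<^esub> = \<zero>\<^bsub>Q\<^esub>"
proof -
  have "\<one>\<^bsub>FA\<^esub> \<oplus>\<^bsub>FA\<^esub> \<one>\<^bsub>FA\<^esub> = \<zero>\<^bsub>FA\<^esub>"
    using assms by (auto simp: free_algebra_def residue_ring_def)
  then have "\<pi> (\<one>\<^bsub>FA\<^esub> \<oplus>\<^bsub>FA\<^esub> \<one>\<^bsub>FA\<^esub>) = \<zero>\<^bsub>Q\<^esub>" by simp
  then show ?thesis by (simp del: FA.r_zero)
qed

text \<open>Universal property of the presented ring. After extension to words, the two families of
  relations are killed one after the other: the linear ones because \<open>\<sigma>\<close> turns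
  products of \<open>A\<close> into sums, the quadratic ones by hypothesis. Each time the map
  factors through one more quotient.\<close>

lemma symbol_ring_extend:
  fixes B :: "('b, 'k) ring_scheme"
  assumes "ring B" and two: "R = residue_ring 2 \<Longrightarrow> \<one>\<^bsub>B\<^esub> \<oplus>\<^bsub>B\<^esub> \<one>\<^bsub>B\<^esub> = \<zero>\<^bsub>B\<^esub>"
    and \<sigma>: "\<sigma> \<in> carrier A \<rightarrow> carrier B"
    and \<sigma>_mult: "\<And>a b. a \<in> carrier A \<Longrightarrow> b \<in> carrier A \<Longrightarrow> \<sigma> (a \<otimes>\<^bsub>A\<^esub> b) = \<sigma> a \<oplus>\<^bsub>B\<^esub> \<sigma> b"
    and \<sigma>_rel: "\<And>a b. (a, b) \<in> P \<Longrightarrow> \<sigma> a \<otimes>\<^bsub>B\<^esub> \<sigma> b = \<zero>\<^bsub>B\<^esub>"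
  obtains \<Phi> where "\<Phi> \<in> ring_hom Q B" "\<And>a. a \<in> carrier A \<Longrightarrow> \<Phi> (\<rho> a) = \<sigma> a"
proof -
  interpret B: ring B by fact
  define \<kappa> :: "int \<Rightarrow> 'b" where "\<kappa> k = [k] \<cdot>\<^bsub>B\<^esub> \<one>\<^bsub>B\<^esub>" for k
  have \<kappa>_simps: "\<kappa> 0 = \<zero>\<^bsub>B\<^esub>" "\<kappa> 1 = \<one>\<^bsub>B\<^esub>" by (simp_all add: \<kappa>_def) (simp add: add_pow_def)
  have \<kappa>_mult: "\<kappa> (x * y) = \<kappa> x \<otimes>\<^bsub>B\<^esub> \<kappa> y" for x y
    unfolding \<kappa>_def by (simp add: B.add_pow_ldistr_int B.add.int_pow_pow mult.commute)
  have \<kappa>_add: "\<kappa> (x + y) = \<kappa> x \<oplus>\<^bsub>B\<^esub> \<kappa> y" for x y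
    unfolding \<kappa>_def by (simp add: B.add.int_pow_mult)
  have \<kappa>: "\<kappa> \<in> ring_hom R B"
    using coeffs
  proof
    assume "R = \<Z>"
    then show ?thesis
      by (intro ring_hom_memI) (auto simp: \<kappa>_mult \<kappa>_add, auto simp: \<kappa>_def)
  next
    assume R2: "R = residue_ring 2"
    have *: "x = 0 \<or> x = 1" if "x \<in> carrier R" for x
      using that by (auto simp: R2 residue_ring_def)
    show ?thesis
    proof (rule ring_hom_memI)
      fix x y assume "x \<in> carrier R" "y \<in> carrier R"
      \<comment> \<open>The critical case among the pairs from \<open>{0, 1}\<close> is the sum of
        two ones, which is zero in the coefficients; there the hypothesis \<open>two\<close> on
        \<open>B\<close> is used.\<close>
      from *[OF this(1)] *[OF this(2)]
      show "\<kappa> (x \<otimes>\<^bsub>R\<^esub> y) = \<kappa> x \<otimes>\<^bsub>B\<^esub> \<kappa> y" "\<kappa> (x \<oplus>\<^bsub>R\<^esub> y) = \<kappa> x \<oplus>\<^bsub>B\<^esub> \<kappa> y"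
        by (auto simp: R2 residue_ring_def \<kappa>_simps two)
    qed (auto simp: \<kappa>_def R2 residue_ring_def)
  qed
  have central: "\<kappa> r \<otimes>\<^bsub>B\<^esub> b = b \<otimes>\<^bsub>B\<^esub> \<kappa> r" if "b \<in> carrier B" for r b
    using that by (simp add: \<kappa>_def B.add_pow_ldistr_int B.add_pow_rdistr_int)
  obtain h where h: "h \<in> ring_hom FA B"
    and h_monom: "\<And>r v. r \<in> carrier R \<Longrightarrow> v \<in> lists (carrier A) \<Longrightarrow>
      h (free_monom R r v) = \<kappa> r \<otimes>\<^bsub>B\<^esub> word_eval B \<sigma> v"
    using free_algebra_extend[OF R.ring_axioms B.ring_axioms \<kappa> central \<sigma>] by blast
  interpret h: ring_hom_ring FA B h by (rule ring_hom_ringI2[OF FA.ring_axioms B.ring_axioms h])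
  have \<sigma>_closed: "\<sigma> a \<in> carrier B" if "a \<in> carrier A" for a using that \<sigma> by auto
  have h_gen: "h (free_gen R a) = \<sigma> a" if "a \<in> carrier A" for a
    using that h_monom[of "\<one>\<^bsub>R\<^esub>" "[a]"] ring_hom_one[OF \<kappa>] \<sigma>_closed
    by (simp add: R.free_gen_monom)
  \<comment> \<open>In \<open>power_module\<close> a scalar acts by a power, so the scalar relations
    demand that \<open>\<sigma>\<close> turn integer powers into integer multiples.\<close>
  have "\<sigma> \<in> hom A (add_monoid B)"
    using \<sigma> \<sigma>_mult by (auto simp: hom_def)
  then have \<sigma>_pow: "\<sigma> (a [^]\<^bsub>A\<^esub> r) = [r] \<cdot>\<^bsub>B\<^esub> \<sigma> a" if "a \<in> carrier A" for a and r :: int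
    using that hom_int_pow[of \<sigma> A "add_monoid B"] A.is_group B.add.is_group
    by (simp add: add_pow_def)
  have h_rel: "x \<in> carrier FA \<and> h x = \<zero>\<^bsub>B\<^esub>" if "x \<in> linear_rels R M" for x
  proof
    show "x \<in> carrier FA" using that linear_rels_closed by auto
    from that consider
      (sum) a b where "a \<in> carrier A" "b \<in> carrier A"
        "x = free_gen R (a \<otimes>\<^bsub>A\<^esub> b) \<ominus>\<^bsub>FA\<^esub> (free_gen R a \<oplus>\<^bsub>FA\<^esub> free_gen R b)"
    | (scale) r a where "r \<in> carrier R" "a \<in> carrier A"
        "x = free_gen R (a [^]\<^bsub>A\<^esub> r) \<ominus>\<^bsub>FA\<^esub> free_monom R r [a]"
      by (auto simp: linear_rels_def power_module_def smult_gen)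
    then show "h x = \<zero>\<^bsub>B\<^esub>"
    proof cases
      case sum
      then show ?thesis
        by (simp add: a_minus_def h_gen \<sigma>_mult \<sigma>_closed B.r_neg)
    next
      case scale
      then have "h (free_monom R r [a]) = [r] \<cdot>\<^bsub>B\<^esub> \<sigma> a"
        using \<sigma>_closed by (simp add: h_monom \<kappa>_def B.add_pow_ldistr_int)
      with scale show ?thesis
        by (simp add: a_minus_def h_gen \<sigma>_pow \<sigma>_closed B.r_neg)
    qed
  qed
  have TI_vanish: "h x = \<zero>\<^bsub>B\<^esub>" if "x \<in> TI" for x
    using genideal_vanish[OF FA.ring_axioms B.ring_axioms h h_rel] that
    by (simp add: tensor_ideal_def)
  have TA_eq: "FA Quot TI = TA" by (simp add: tensor_algebra_def)
  obtain h1 where h1: "h1 \<in> ring_hom TA B"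
    and h1_class: "\<And>x. x \<in> carrier FA \<Longrightarrow> h1 (TI +>\<^bsub>FA\<^esub> x) = h x"
    by (rule quotient_factor[OF TI.is_ideal B.ring_axioms h TI_vanish, unfolded TA_eq]) (assumption, rule that)
  have h1_gen: "h1 (tensor_incl R M a) = \<sigma> a" if "a \<in> carrier A" for a
    using that h1_class[of "free_gen R a"] h_gen by (simp add: tensor_incl_def)
  have h1_rel: "x \<in> carrier TA \<and> h1 x = \<zero>\<^bsub>B\<^esub>" if x: "x \<in> symbol_rels R A P" for x
  proof
    show "x \<in> carrier TA" using x symbol_rels_closed by auto
    obtain a b where ab: "(a, b) \<in> P" "x = tensor_incl R M a \<otimes>\<^bsub>TA\<^esub> tensor_incl R M b"
      using x by (auto simp: symbol_rels_def)
    moreover have "a \<in> carrier A" "b \<in> carrier A" using ab(1) rels_closed by auto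
    ultimately show "h1 x = \<zero>\<^bsub>B\<^esub>"
      using \<sigma>_rel[OF ab(1)] ring_hom_mult[OF h1] by (simp add: h1_gen tensor_incl_closed)
  qed
  have J_vanish: "h1 x = \<zero>\<^bsub>B\<^esub>" if "x \<in> J" for x
    using genideal_vanish[OF TA.ring_axioms B.ring_axioms h1 h1_rel that] .
  have Q_eq: "TA Quot J = Q" by (simp add: symbol_ring_def)
  obtain \<Phi> where "\<Phi> \<in> ring_hom Q B"
    and "\<And>x. x \<in> carrier TA \<Longrightarrow> \<Phi> (J +>\<^bsub>TA\<^esub> x) = h1 x"
    by (rule quotient_factor[OF J.is_ideal B.ring_axioms h1 J_vanish, unfolded Q_eq]) (assumption, rule that)
  then show ?thesis
    by (intro that[of \<Phi>]) (simp_all add: symbol_def h1_gen tensor_incl_closed)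
qed

end

text \<open>The product is always that of \<open>B\<close>, and the degree is felt in the carriers
  alone. In this form, to which \<open>tensor_quot_eq\<close> brings \<open>tensor_quot\<close>,
  statements on the grading are proved by induction on \<open>graded_span\<close>.\<close>

definition graded_igr :: "('b, 'n) ring_scheme \<Rightarrow> ('x \<Rightarrow> 'b) \<Rightarrow> 'x set \<Rightarrow> 'x \<Rightarrow> 'b igr" where
  "graded_igr B g X e =
    \<lparr>igr_grp = (\<lambda>n. \<lparr>carrier = {x. graded_span B g X n x}, mult = add B, one = zero B\<rparr>),
     igr_one = one B, igr_mult = (\<lambda>n m. mult B), igr_top = (\<lambda>n. g e [^]\<^bsub>B\<^esub> n)\<rparr>"

section \<open>Homogeneous parts of the symbol ring\<close>

context symbol_presentation
begin

text \<open>\<open>graded_span\<close> has no closure under scalars, so a coefficient has to be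
  built from one: an integer by repeatedly adding or subtracting one, an element of the two-element
  field by inspection. Prefixing letters then raises the degree.\<close>

lemma class_monom: "r \<in> carrier R \<Longrightarrow> v \<in> lists (carrier A) \<Longrightarrow>
  graded_span Q \<rho> (carrier A) (length v) (\<pi> (free_monom R r v))"
proof (induction v)
  case Nil
  have one: "free_monom R \<one>\<^bsub>R\<^esub> [] = \<one>\<^bsub>FA\<^esub>"
    by (simp add: R.free_algebra_one)
  have zero: "free_monom R \<zero>\<^bsub>R\<^esub> [] = \<zero>\<^bsub>FA\<^esub>"
    by (auto simp: R.free_algebra_zero free_monom_def)
  show ?case
    using coeffs
  proof
    assume RZ: "R = \<Z>"
    have add1: "free_monom R (k + 1) [] = free_monom R k [] \<oplus>\<^bsub>FA\<^esub> \<one>\<^bsub>FA\<^esub>" for k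
      by (auto simp: RZ free_algebra_def free_monom_def)
    have monom: "free_monom R k [] \<in> carrier FA" for k
      by (rule R.free_monom_closed) (simp_all add: RZ)
    have plus: "\<pi> (free_monom R (k + 1) []) = \<pi> (free_monom R k []) \<oplus>\<^bsub>Q\<^esub> \<one>\<^bsub>Q\<^esub>" for k
      unfolding add1 using monom by simp
    have minus: "\<pi> (free_monom R (k - 1) []) = \<pi> (free_monom R k []) \<oplus>\<^bsub>Q\<^esub> \<ominus>\<^bsub>Q\<^esub> \<one>\<^bsub>Q\<^esub>" for k
      using plus[of "k - 1"] monom[of "k - 1"] by (simp add: Q.a_assoc Q.r_neg)
    have "graded_span Q \<rho> (carrier A) 0 (\<pi> (free_monom R k []))" for k
    proof (induction k rule: int_induct[where k = 0])
      case base
      have "free_monom R 0 [] = \<zero>\<^bsub>FA\<^esub>" using zero unfolding RZ by simp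
      then have "\<pi> (free_monom R 0 []) = \<zero>\<^bsub>Q\<^esub>" using \<pi>.hom_zero by metis
      then show ?case by (simp only: graded_span.zero)
    next
      case (step1 k)
      then show ?case unfolding plus by (intro graded_span.add graded_span.one)
    next
      case (step2 k)
      then show ?case unfolding minus by (intro graded_span.add graded_span.neg graded_span.one)
    qed
    then show ?thesis by simp
  next
    assume "R = residue_ring 2"
    then have "r = \<zero>\<^bsub>R\<^esub> \<or> r = \<one>\<^bsub>R\<^esub>" using Nil by (auto simp: residue_ring_def)
    moreover have "\<pi> (free_monom R \<zero>\<^bsub>R\<^esub> []) = \<zero>\<^bsub>Q\<^esub>" unfolding zero by simp
    moreover have "\<pi> (free_monom R \<one>\<^bsub>R\<^esub> []) = \<one>\<^bsub>Q\<^esub>" unfolding one by simp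
    ultimately show ?thesis
      by (elim disjE) (simp_all only: list.size graded_span.zero graded_span.one)
  qed
next
  case (Cons x v)
  have v: "v \<in> lists (carrier A)" and x: "x \<in> carrier A" using Cons.prems by auto
  have "free_monom R r (x # v) = free_gen R x \<otimes>\<^bsub>FA\<^esub> free_monom R r v"
    using Cons.prems by (simp add: R.free_gen_monom R.free_monom_mult)
  then have "\<pi> (free_monom R r (x # v)) = \<rho> x \<otimes>\<^bsub>Q\<^esub> \<pi> (free_monom R r v)"
    using x R.free_monom_closed[OF Cons.prems(1) v] by (simp add: symbol_class)
  moreover have "graded_span Q \<rho> (carrier A) (Suc (length v)) (\<rho> x \<otimes>\<^bsub>Q\<^esub> \<pi> (free_monom R r v))"
    by (rule graded_span.gen_mult[OF x Cons.IH[OF Cons.prems(1) v]])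
  ultimately show ?case by (simp only: list.size add_Suc_right add_0_right)
qed

text \<open>Classes of monomials are homogeneous and every class is a finite sum of them, so one
  homogeneous summand can be added at a time.\<close>

lemma symbol_ring_induct [consumes 1, case_names zero add]:
  assumes "y \<in> carrier Q" and "S \<zero>\<^bsub>Q\<^esub>"
    and step: "\<And>n x y. graded_span Q \<rho> (carrier A) n x \<Longrightarrow> y \<in> carrier Q \<Longrightarrow> S y \<Longrightarrow> S (x \<oplus>\<^bsub>Q\<^esub> y)"
  shows "S y"
proof -
  obtain f where f: "f \<in> carrier FA" "y = \<pi> f" using class_surj[OF assms(1)] .
  have "S (\<pi> f)" using f(1)
  proof (induction rule: R.free_algebra_induct)
    case zero
    have "\<pi> (\<lambda>w. \<zero>\<^bsub>R\<^esub>) = \<zero>\<^bsub>Q\<^esub>" using \<pi>.hom_zero by (simp only: R.free_algebra_zero)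
    then show ?case using assms(2) by simp
  next
    case (add r v g)
    have "\<pi> (free_monom R r v \<oplus>\<^bsub>FA\<^esub> g) = \<pi> (free_monom R r v) \<oplus>\<^bsub>Q\<^esub> \<pi> g"
      by (rule \<pi>.hom_add[OF R.free_monom_closed[OF add(1,2)] add(3)])
    then show ?case
      using step[OF class_monom[OF add(1,2)] \<pi>.hom_closed[OF add(3)] add(4)] by simp
  qed
  then show ?thesis using f(2) by simp
qed

definition homogeneous :: "nat \<Rightarrow> ('x list \<Rightarrow> int) set" where
  "homogeneous n = {f \<in> carrier FA. \<forall>w. f w \<noteq> \<zero>\<^bsub>R\<^esub> \<longrightarrow> length w = n}"

lemma class_homogeneous: "f \<in> homogeneous n \<Longrightarrow> graded_span Q \<rho> (carrier A) n (\<pi> f)"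
proof -
  \<comment> \<open>The induction rule for the free algebra carries no homogeneity of the remainder.
    The claim is therefore proved for the length \<open>n\<close> truncation of an arbitrary
    \<open>f\<close>, which leaves a homogeneous \<open>f\<close> unchanged.\<close>
  define tr where "tr f = (\<lambda>w. if length w = n then f w else \<zero>\<^bsub>R\<^esub>)" for f :: "'x list \<Rightarrow> int"
  have tr_closed: "tr f \<in> carrier FA" if "f \<in> carrier FA" for f
  proof -
    have "{w. tr f w \<noteq> \<zero>\<^bsub>R\<^esub>} \<subseteq> {w. f w \<noteq> \<zero>\<^bsub>R\<^esub>}" by (auto simp: tr_def)
    moreover have "range (tr f) \<subseteq> carrier R"
      using R.free_algebra_carrierD(1)[OF that] by (auto simp: tr_def)
    ultimately show ?thesis
      using that finite_subset unfolding free_algebra_def by fastforce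
  qed
  have zero: "\<pi> (\<lambda>w. \<zero>\<^bsub>R\<^esub>) = \<zero>\<^bsub>Q\<^esub>" using \<pi>.hom_zero by (simp only: R.free_algebra_zero)
  have *: "graded_span Q \<rho> (carrier A) n (\<pi> (tr f))" if "f \<in> carrier FA" for f
    using that
  proof (induction rule: R.free_algebra_induct)
    case zero
    then show ?case using \<open>\<pi> (\<lambda>w. \<zero>\<^bsub>R\<^esub>) = \<zero>\<^bsub>Q\<^esub>\<close> graded_span.zero[of Q \<rho> "carrier A" n]
      by (simp add: tr_def)
  next
    case (add r v g)
    have g: "g w \<in> carrier R" for w by (rule R.free_algebra_carrierD(1)[OF add(3)])
    show ?case
    proof (cases "length v = n")
      case True
      then have "tr (free_monom R r v \<oplus>\<^bsub>FA\<^esub> g) = free_monom R r v \<oplus>\<^bsub>FA\<^esub> tr g"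
        using add(1) by (auto simp: tr_def free_monom_def R.free_algebra_add)
      then have "\<pi> (tr (free_monom R r v \<oplus>\<^bsub>FA\<^esub> g)) = \<pi> (free_monom R r v) \<oplus>\<^bsub>Q\<^esub> \<pi> (tr g)"
        using \<pi>.hom_add[OF R.free_monom_closed[OF add(1,2)] tr_closed[OF add(3)]] by simp
      then show ?thesis
        using class_monom[OF add(1,2)] add(4) True by (simp add: graded_span.add)
    next
      case False
      then have "tr (free_monom R r v \<oplus>\<^bsub>FA\<^esub> g) = tr g"
        using g by (auto simp: tr_def free_monom_def R.free_algebra_add)
      then show ?thesis using add(4) by simp
    qed
  qed
  assume f: "f \<in> homogeneous n"
  then have "tr f w = f w" for w
    by (cases "f w = \<zero>\<^bsub>R\<^esub>") (auto simp: tr_def homogeneous_def)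
  then have "tr f = f" by (rule ext)
  with *[of f] f show ?thesis by (simp add: homogeneous_def)
qed

lemma homogeneous_gen_mult:
  assumes "a \<in> carrier A" "f \<in> homogeneous n"
  shows "free_gen R a \<otimes>\<^bsub>FA\<^esub> f \<in> homogeneous (Suc n)"
proof -
  have f: "f \<in> carrier FA" "\<And>w. f w \<noteq> \<zero>\<^bsub>R\<^esub> \<Longrightarrow> length w = n"
    using assms(2) by (auto simp: homogeneous_def)
  have "length w = Suc n" if w: "(free_gen R a \<otimes>\<^bsub>FA\<^esub> f) w \<noteq> \<zero>\<^bsub>R\<^esub>" for w
  proof -
    have "\<exists>k \<le> length w. free_gen R a (take k w) \<otimes>\<^bsub>R\<^esub> f (drop k w) \<noteq> \<zero>\<^bsub>R\<^esub>"
    proof (rule ccontr)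
      assume "\<not> ?thesis"
      then have "(free_gen R a \<otimes>\<^bsub>FA\<^esub> f) w = (\<Oplus>\<^bsub>R\<^esub>k\<in>{..length w}. \<zero>\<^bsub>R\<^esub>)"
        unfolding free_algebra_def monoid.simps by (intro R.finsum_cong') auto
      with w show False by (simp add: R.finsum_zero)
    qed
    then obtain k where k: "k \<le> length w" "free_gen R a (take k w) \<otimes>\<^bsub>R\<^esub> f (drop k w) \<noteq> \<zero>\<^bsub>R\<^esub>"
      by auto
    then have "take k w = [a]"
      using R.free_algebra_carrierD(1)[OF f(1)] by (auto simp: free_gen_def split: if_splits)
    moreover have "f (drop k w) \<noteq> \<zero>\<^bsub>R\<^esub>"
      using k(2) by (auto simp: free_gen_def split: if_splits)
    then have "length (drop k w) = n" by (rule f(2))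
    moreover have "length w = length (take k w) + length (drop k w)"
      by (metis append_take_drop_id length_append)
    ultimately show ?thesis by (simp only: list.size)
  qed
  then show ?thesis using f(1) assms(1) by (simp add: homogeneous_def)
qed

text \<open>Converse of \<open>class_homogeneous\<close>: each rule of \<open>graded_span\<close> is
  matched by an operation on homogeneous representatives.\<close>

lemma graded_span_homogeneous:
  "graded_span Q \<rho> (carrier A) n x \<Longrightarrow> \<exists>f \<in> homogeneous n. x = \<pi> f"
proof (induction rule: graded_span.induct)
  case one
  have "\<one>\<^bsub>FA\<^esub> \<in> homogeneous 0"
    using FA.one_closed by (auto simp: homogeneous_def free_algebra_def split: if_splits)
  then show ?case using \<pi>.hom_one by metis
next
  case (zero n)
  have "\<zero>\<^bsub>FA\<^esub> \<in> homogeneous n"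
    using FA.zero_closed by (auto simp: homogeneous_def R.free_algebra_zero)
  then show ?case using \<pi>.hom_zero by metis
next
  case (gen_mult a n x)
  then obtain f where f: "f \<in> homogeneous n" "x = \<pi> f" by auto
  have "f \<in> carrier FA" using f(1) by (simp add: homogeneous_def)
  then have "\<rho> a \<otimes>\<^bsub>Q\<^esub> x = \<pi> (free_gen R a \<otimes>\<^bsub>FA\<^esub> f)"
    using \<pi>.hom_mult[of "free_gen R a" f] gen_mult(1) by (simp add: symbol_class f(2))
  then show ?case using homogeneous_gen_mult[OF gen_mult(1) f(1)] by metis
next
  case (add n x y)
  then obtain f g where fg: "f \<in> homogeneous n" "x = \<pi> f" "g \<in> homogeneous n" "y = \<pi> g" by auto
  have c: "f \<in> carrier FA" "g \<in> carrier FA" using fg by (auto simp: homogeneous_def)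
  have "x \<oplus>\<^bsub>Q\<^esub> y = \<pi> (f \<oplus>\<^bsub>FA\<^esub> g)" using \<pi>.hom_add[OF c] fg by simp
  moreover have "f \<oplus>\<^bsub>FA\<^esub> g \<in> homogeneous n"
  proof -
    have "length w = n" if "(f \<oplus>\<^bsub>FA\<^esub> g) w \<noteq> \<zero>\<^bsub>R\<^esub>" for w
    proof (rule ccontr)
      assume "length w \<noteq> n"
      then have "f w = \<zero>\<^bsub>R\<^esub>" "g w = \<zero>\<^bsub>R\<^esub>" using fg by (auto simp: homogeneous_def)
      with that show False by (simp add: R.free_algebra_add)
    qed
    then show ?thesis using FA.a_closed[OF c] by (simp add: homogeneous_def)
  qed
  ultimately show ?case by metis
next
  case (neg n x)
  then obtain f where f: "f \<in> homogeneous n" "x = \<pi> f" by auto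
  have c: "f \<in> carrier FA" using f by (auto simp: homogeneous_def)
  have "\<ominus>\<^bsub>Q\<^esub> x = \<pi> (\<ominus>\<^bsub>FA\<^esub> f)" using \<pi>.hom_a_inv[OF c] f by simp
  moreover have "\<ominus>\<^bsub>FA\<^esub> f \<in> homogeneous n"
  proof -
    \<comment> \<open>Negation in the free algebra is available only through the ring axioms; its
      effect on vanishing coefficients is read off from \<open>-f + f = 0\<close> at each
      word.\<close>
    have "(\<ominus>\<^bsub>FA\<^esub> f \<oplus>\<^bsub>FA\<^esub> f) w = \<zero>\<^bsub>FA\<^esub> w" for w
      using FA.l_neg[OF c] by simp
    then have "(\<ominus>\<^bsub>FA\<^esub> f) w \<oplus>\<^bsub>R\<^esub> f w = \<zero>\<^bsub>R\<^esub>" for w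
      by (simp add: R.free_algebra_add R.free_algebra_zero)
    moreover have "(\<ominus>\<^bsub>FA\<^esub> f) w \<in> carrier R" for w
      by (rule R.free_algebra_carrierD(1)[OF FA.a_inv_closed[OF c]])
    ultimately have "f w = \<zero>\<^bsub>R\<^esub> \<Longrightarrow> (\<ominus>\<^bsub>FA\<^esub> f) w = \<zero>\<^bsub>R\<^esub>" for w
      using R.r_zero by metis
    then show ?thesis using f(1) FA.a_inv_closed[OF c] by (auto simp: homogeneous_def)
  qed
  ultimately show ?case by metis
qed

text \<open>The image of a tensor power consists of the classes of homogeneous elements of the free
  algebra, and the two preceding inclusions identify these classes with the span of
  \<open>n\<close>-fold products of symbols.\<close>

lemma tensor_quot_eq:
  "tensor_quot R M (symbol_rels R A P) e = graded_igr Q \<rho> (carrier A) e"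
proof -
  have "(\<lambda>u. J +>\<^bsub>TA\<^esub> u) ` tensor_power R M n = {x. graded_span Q \<rho> (carrier A) n x}" for n
  proof -
    have "(\<lambda>u. J +>\<^bsub>TA\<^esub> u) ` tensor_power R M n = \<pi> ` homogeneous n"
      by (simp add: tensor_power_def homogeneous_def image_image)
    moreover have "\<pi> ` homogeneous n = {x. graded_span Q \<rho> (carrier A) n x}"
      using class_homogeneous graded_span_homogeneous by blast
    ultimately show ?thesis by simp
  qed
  then show ?thesis
    by (simp add: tensor_quot_def graded_igr_def Let_def symbol_ring_def[symmetric] symbol_def)
qed

text \<open>The homomorphism to \<open>Q[t]\<close> that sends \<open>\<rho>(a)\<close> to \<open>\<rho>(a) t\<close> separates the degrees.\<close>

lemma graded_span_double:
  assumes RZ: "R = \<Z>" and x: "graded_span Q \<rho> (carrier A) n x"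
    and y: "y \<in> carrier Q" "x = y \<oplus>\<^bsub>Q\<^esub> y"
  shows "\<exists>z. graded_span Q \<rho> (carrier A) n z \<and> x = z \<oplus>\<^bsub>Q\<^esub> z"
proof -
  interpret U: UP_ring Q "UP Q" by unfold_locales
  have "R \<noteq> residue_ring 2" unfolding RZ by (auto simp: residue_ring_def)
  \<comment> \<open>Multiplying every generator by the central variable respects the relations: the
    linear ones are homogeneous of degree 1, and a product \<open>\<rho> a \<rho> b = 0\<close>
    merely becomes the coefficient of \<open>t^2\<close>.\<close>
  obtain \<delta> where \<delta>: "\<delta> \<in> ring_hom Q (UP Q)"
    and \<delta>_sym: "\<And>a. a \<in> carrier A \<Longrightarrow> \<delta> (\<rho> a) = monom (UP Q) (\<rho> a) 1"
    by (rule symbol_ring_extend[OF U.UP_ring, where \<sigma> = "\<lambda>a. monom (UP Q) (\<rho> a) 1"])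
      (use \<open>R \<noteq> residue_ring 2\<close> rels_closed in
        \<open>auto simp: symbol_mult symbol_rel simp flip: U.monom_mult\<close>)
  interpret \<delta>: ring_hom_ring Q "UP Q" \<delta> by (rule ring_hom_ringI2[OF Q_ring U.UP_ring \<delta>])
  note c = Q.graded_span_closed[OF symbol_Pi]
  have \<delta>_graded: "\<delta> x = monom (UP Q) x n" if "graded_span Q \<rho> (carrier A) n x" for n x
    using that
  proof induction
    case one
    then show ?case by (simp add: U.monom_one)
  next
    case (gen_mult a n x)
    then show ?case using U.monom_mult[of "\<rho> a" x 1 n] c \<delta>_sym by simp
  qed (use c in simp_all)
  \<comment> \<open>The coefficient of \<open>t^n\<close> acts as projection to degree
    \<open>n\<close>: on a homogeneous summand of degree \<open>m\<close> it gives the summand if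
    \<open>m = n\<close> and zero otherwise.\<close>
  have coeff: "graded_span Q \<rho> (carrier A) n (coeff (UP Q) (\<delta> y) n)" if "y \<in> carrier Q" for y
    using that
  proof (induction rule: symbol_ring_induct)
    case zero
    then show ?case by (simp add: graded_span.zero)
  next
    case (add m x y)
    then have "coeff (UP Q) (\<delta> (x \<oplus>\<^bsub>Q\<^esub> y)) n
        = (if m = n then x else \<zero>\<^bsub>Q\<^esub>) \<oplus>\<^bsub>Q\<^esub> coeff (UP Q) (\<delta> y) n"
      using c by (simp add: \<delta>_graded)
    with add show ?case by (auto intro!: graded_span.add graded_span.zero)
  qed
  \<comment> \<open>Comparing coefficients of \<open>t^n\<close> in
    \<open>\<delta> x = \<delta> y + \<delta> y\<close> replaces \<open>y\<close> by its degree
    \<open>n\<close> part.\<close>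
  have "x = coeff (UP Q) (\<delta> x) n" using x c by (simp add: \<delta>_graded)
  also have "\<dots> = coeff (UP Q) (\<delta> y) n \<oplus>\<^bsub>Q\<^esub> coeff (UP Q) (\<delta> y) n"
    using y by simp
  finally show ?thesis using coeff[OF y(1)] by blast
qed

end

section \<open>The inductive graded ring of a ring with generators\<close>

lemma (in ring) char_2_double:
  assumes "\<one> \<oplus> \<one> = \<zero>" "x \<in> carrier R"
  shows "x \<oplus> x = \<zero>"
  using assms l_distr[of \<one> \<one> x] by simp

text \<open>Two inductions: a generator moves through the factors of \<open>y\<close>, and then the
  factors of \<open>x\<close> move past \<open>y\<close> one by one. The generators commute
  strictly, so no signs arise.\<close>

lemma (in ring) graded_span_commute:
  assumes g: "g \<in> X \<rightarrow> carrier R"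
    and comm: "\<And>a b. a \<in> X \<Longrightarrow> b \<in> X \<Longrightarrow> g a \<otimes> g b = g b \<otimes> g a"
    and x: "graded_span R g X n x" and y: "graded_span R g X m y"
  shows "x \<otimes> y = y \<otimes> x"
proof -
  note c = graded_span_closed[OF g]
  have ga: "g a \<in> carrier R" if "a \<in> X" for a using that g by auto
  have gen: "g a \<otimes> y = y \<otimes> g a" if a: "a \<in> X" for a
    using y
  proof induction
    case (gen_mult b n y)
    have "g a \<otimes> (g b \<otimes> y) = (g a \<otimes> g b) \<otimes> y"
      using ga a gen_mult(1) c[OF gen_mult(2)] by (simp add: m_assoc)
    also have "\<dots> = (g b \<otimes> g a) \<otimes> y"
      by (simp only: comm[OF a gen_mult(1)])
    also have "\<dots> = g b \<otimes> (g a \<otimes> y)"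
      using ga a gen_mult(1) c[OF gen_mult(2)] by (simp add: m_assoc)
    also have "\<dots> = g b \<otimes> y \<otimes> g a"
      using ga a gen_mult(1,3) c[OF gen_mult(2)] by (simp add: m_assoc)
    finally show ?case .
  next
    case (add n x y)
    then show ?case using ga[OF a] c by (simp add: l_distr r_distr)
  next
    case (neg n x)
    then show ?case using ga[OF a] c by (simp add: l_minus r_minus)
  qed (use ga[OF a] in auto)
  have yc: "y \<in> carrier R" by (rule c[OF y])
  show ?thesis using x
  proof induction
    case (gen_mult a n x)
    have "g a \<otimes> x \<otimes> y = g a \<otimes> (y \<otimes> x)"
      using ga gen_mult(1,3) c[OF gen_mult(2)] yc by (simp add: m_assoc)
    also have "\<dots> = (g a \<otimes> y) \<otimes> x"
      using ga gen_mult(1) c[OF gen_mult(2)] yc by (simp add: m_assoc)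
    also have "\<dots> = y \<otimes> (g a \<otimes> x)"
      using ga gen_mult(1) c[OF gen_mult(2)] yc by (simp add: gen m_assoc)
    finally show ?case .
  next
    case (add n x x')
    then show ?case using yc c by (simp add: l_distr r_distr)
  next
    case (neg n x)
    then show ?case using yc c by (simp add: l_minus r_minus)
  qed (use yc in auto)
qed

lemma graded_igr_simps [simp]:
  "carrier (igr_grp (graded_igr B g X e) n) = {x. graded_span B g X n x}"
  "mult (igr_grp (graded_igr B g X e) n) = add B"
  "one (igr_grp (graded_igr B g X e) n) = zero B"
  "igr_one (graded_igr B g X e) = one B"
  "igr_mult (graded_igr B g X e) n m = mult B"
  "igr_top (graded_igr B g X e) n = g e [^]\<^bsub>B\<^esub> n"
  by (simp_all add: graded_igr_def)

text \<open>Every step multiplies on the left by \<open>g e\<close>, and there are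
  \<open>p - n\<close> steps.\<close>

lemma graded_igr_h_iter:
  assumes "ring B" "g e \<in> carrier B" "x \<in> carrier B" "n \<le> p"
  shows "igr_h_iter (graded_igr B g X e) n p x = g e [^]\<^bsub>B\<^esub> (p - n) \<otimes>\<^bsub>B\<^esub> x"
proof -
  interpret ring B by fact
  show ?thesis using assms(4)
  proof (induction p)
    case 0
    then show ?case using assms by simp
  next
    case (Suc p)
    show ?case
    proof (cases "n = Suc p")
      case True
      then show ?thesis using assms by simp
    next
      case False
      then have n: "n \<le> p" "Suc p - n = Suc (p - n)" using Suc.prems by auto
      \<comment> \<open>Powers append the new factor on the right whereas \<open>igr_h\<close>
        multiplies on the left; \<open>nat_pow_Suc2\<close> reconciles the two.\<close>
      have "g e [^]\<^bsub>B\<^esub> Suc (p - n) = g e \<otimes>\<^bsub>B\<^esub> g e [^]\<^bsub>B\<^esub> (p - n)"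
        by (rule nat_pow_Suc2[OF assms(2)])
      then show ?thesis
        using Suc.IH[OF n(1)] n assms(2,3) False Suc.prems
        by (simp add: igr_h_def m_assoc del: nat_pow_Suc)
    qed
  qed
qed

text \<open>Commuting generators give commutativity, \<open>1 + 1 = 0\<close> gives exponent 2, and
  \<open>1 \<noteq> 0\<close> makes degree 0 the group with two elements instead of the trivial
  group.\<close>

lemma graded_igr_inductive:
  assumes "ring B" and g: "g \<in> X \<rightarrow> carrier B" and e: "e \<in> X"
    and two: "\<one>\<^bsub>B\<^esub> \<oplus>\<^bsub>B\<^esub> \<one>\<^bsub>B\<^esub> = \<zero>\<^bsub>B\<^esub>" and nontrivial: "\<one>\<^bsub>B\<^esub> \<noteq> \<zero>\<^bsub>B\<^esub>"
    and comm: "\<And>a b. a \<in> X \<Longrightarrow> b \<in> X \<Longrightarrow> g a \<otimes>\<^bsub>B\<^esub> g b = g b \<otimes>\<^bsub>B\<^esub> g a"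
  shows "inductive_graded_ring (graded_igr B g X e)" (is "inductive_graded_ring ?G")
proof -
  interpret B: ring B by fact
  note c = B.graded_span_closed[OF g]
  have ge: "g e \<in> carrier B" using g e by auto
  have comm': "x \<otimes>\<^bsub>B\<^esub> y = y \<otimes>\<^bsub>B\<^esub> x" if "graded_span B g X n x" "graded_span B g X m y" for x y n m
    using B.graded_span_commute[OF g comm] that by blast
  have deg0: "igr_grp ?G 0 \<cong> add_monoid (residue_ring 2)"
  proof -
    let ?f = "\<lambda>x. if x = \<zero>\<^bsub>B\<^esub> then 0 else (1::int)"
    have car: "carrier (igr_grp ?G 0) = {\<zero>\<^bsub>B\<^esub>, \<one>\<^bsub>B\<^esub>}"
      using B.graded_span_0[OF g two] by auto
    have "?f \<in> iso (igr_grp ?G 0) (add_monoid (residue_ring 2))"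
    proof (rule isoI)
      show "?f \<in> hom (igr_grp ?G 0) (add_monoid (residue_ring 2))"
        unfolding hom_def car using two nontrivial by (auto simp: residue_ring_def)
      show "bij_betw ?f (carrier (igr_grp ?G 0)) (carrier (add_monoid (residue_ring 2)))"
        unfolding car using nontrivial by (auto simp: bij_betw_def inj_on_def residue_ring_def)
    qed
    then show ?thesis by (auto simp: is_iso_def)
  qed
  show ?thesis
  proof (rule inductive_graded_ring.intro)
    fix n
    show "comm_group (igr_grp ?G n)"
    proof (rule comm_groupI)
      fix x assume "x \<in> carrier (igr_grp ?G n)"
      then show "\<exists>y\<in>carrier (igr_grp ?G n). y \<otimes>\<^bsub>igr_grp ?G n\<^esub> x = \<one>\<^bsub>igr_grp ?G n\<^esub>"
        using c by (auto intro!: exI[of _ "\<ominus>\<^bsub>B\<^esub> x"] simp: graded_span.neg B.l_neg)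
    qed (use c in \<open>auto simp: B.a_ac graded_span.zero graded_span.add\<close>)
    show "igr_top ?G n \<in> carrier (igr_grp ?G n)"
      using B.graded_span_pow[OF g e] by simp
    show "igr_h ?G n \<in> hom (igr_grp ?G n) (igr_grp ?G (Suc n))"
      using c ge e graded_span.gen_mult[of e X B g]
      by (auto simp: hom_def igr_h_def B.r_distr)
    show "igr_h ?G n (igr_top ?G n) = igr_top ?G (Suc n)"
      using ge B.nat_pow_Suc2[OF ge, of n] by (simp add: igr_h_def)
  next
    fix x n
    assume "x \<in> carrier (igr_grp ?G n)"
    then have x: "x \<in> carrier B" using c by auto
    show "x \<otimes>\<^bsub>igr_grp ?G n\<^esub> x = \<one>\<^bsub>igr_grp ?G n\<^esub>"
      using B.char_2_double[OF two x] by simp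
    show "igr_mult ?G 0 n (igr_one ?G) x = x" using x by simp
  next
    show "igr_one ?G \<in> carrier (igr_grp ?G 0)" by (simp add: graded_span.one)
    fix n m x y
    assume xy: "x \<in> carrier (igr_grp ?G n)" "y \<in> carrier (igr_grp ?G m)"
    show "igr_mult ?G n m x y \<in> carrier (igr_grp ?G (n + m))"
      using B.graded_span_mult[OF g] xy by simp
    show "igr_mult ?G n m x y = igr_mult ?G m n y x"
      using comm' xy by simp
    fix p q
    assume pq: "n \<le> p" "m \<le> q"
    have gs: "graded_span B g X n x" "graded_span B g X m y" using xy by auto
    have xyc: "x \<in> carrier B" "y \<in> carrier B" using gs c by auto
    let ?P = "\<lambda>k :: nat. g e [^]\<^bsub>B\<^esub> k"
    have P: "?P k \<in> carrier B" for k using ge by simp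
    have sum: "(p - n) + (q - m) = p + q - (n + m)" using pq by simp
    \<comment> \<open>Compatibility of the iterated maps with products amounts to moving the power
      of \<open>g e\<close> from the second factor to the left past \<open>x\<close>.\<close>
    have "?P (p - n) \<otimes>\<^bsub>B\<^esub> x \<otimes>\<^bsub>B\<^esub> (?P (q - m) \<otimes>\<^bsub>B\<^esub> y)
        = ?P (p - n) \<otimes>\<^bsub>B\<^esub> (x \<otimes>\<^bsub>B\<^esub> ?P (q - m)) \<otimes>\<^bsub>B\<^esub> y"
      using xyc P by (simp add: B.m_assoc)
    also have "x \<otimes>\<^bsub>B\<^esub> ?P (q - m) = ?P (q - m) \<otimes>\<^bsub>B\<^esub> x"
      by (rule comm'[OF gs(1) B.graded_span_pow[OF g e]])
    also have "?P (p - n) \<otimes>\<^bsub>B\<^esub> (?P (q - m) \<otimes>\<^bsub>B\<^esub> x) \<otimes>\<^bsub>B\<^esub> y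
        = (?P (p - n) \<otimes>\<^bsub>B\<^esub> ?P (q - m)) \<otimes>\<^bsub>B\<^esub> (x \<otimes>\<^bsub>B\<^esub> y)"
      using xyc P by (simp add: B.m_assoc)
    also have "?P (p - n) \<otimes>\<^bsub>B\<^esub> ?P (q - m) = ?P (p + q - (n + m))"
      using B.nat_pow_mult[OF ge, of "p - n" "q - m"] unfolding sum .
    finally show "igr_mult ?G p q (igr_h_iter ?G n p x) (igr_h_iter ?G m q y) =
        igr_h_iter ?G (n + m) (p + q) (igr_mult ?G n m x y)"
      using graded_igr_h_iter[where B = B and g = g and e = e, OF B.ring_axioms ge xyc(1) pq(1)]
        graded_igr_h_iter[where B = B and g = g and e = e, OF B.ring_axioms ge xyc(2) pq(2)]
        graded_igr_h_iter[where B = B and g = g and e = e, OF B.ring_axioms ge B.m_closed[OF xyc] add_mono[OF pq]]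
      by simp
  qed (use c deg0 in \<open>auto simp: B.l_distr B.r_distr B.m_assoc\<close>)
qed

text \<open>Transport of structure along degreewise bijections: the equational axioms are checked
  after applying \<open>f\<close>. As \<open>R\<close> is not yet known to be such a ring, closure
  under its operations is part of the hypotheses. This spares a verification of the axioms in groups
  of cosets.\<close>

lemma inductive_graded_ring_transfer:
  assumes S: "inductive_graded_ring S" and f: "f \<in> igr_hom R S"
    and bij: "\<And>n. bij_betw (f n) (carrier (igr_grp R n)) (carrier (igr_grp S n))"
    and add_closed: "\<And>n x y. x \<in> carrier (igr_grp R n) \<Longrightarrow> y \<in> carrier (igr_grp R n) \<Longrightarrow>
      x \<otimes>\<^bsub>igr_grp R n\<^esub> y \<in> carrier (igr_grp R n)"
    and zero: "\<And>n. \<one>\<^bsub>igr_grp R n\<^esub> \<in> carrier (igr_grp R n)"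
      "\<And>n. f n \<one>\<^bsub>igr_grp R n\<^esub> = \<one>\<^bsub>igr_grp S n\<^esub>"
    and one: "igr_one R \<in> carrier (igr_grp R 0)"
    and top: "\<And>n. igr_top R n \<in> carrier (igr_grp R n)"
    and mult: "\<And>n m x y. x \<in> carrier (igr_grp R n) \<Longrightarrow> y \<in> carrier (igr_grp R m) \<Longrightarrow>
      igr_mult R n m x y \<in> carrier (igr_grp R (n + m))"
  shows "inductive_graded_ring R"
proof -
  interpret S: inductive_graded_ring S by fact
  have f_closed: "f n x \<in> carrier (igr_grp S n)" if "x \<in> carrier (igr_grp R n)" for n x
    using bij that by (auto simp: bij_betw_def)
  have f_add: "f n (x \<otimes>\<^bsub>igr_grp R n\<^esub> y) = f n x \<otimes>\<^bsub>igr_grp S n\<^esub> f n y"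
    if "x \<in> carrier (igr_grp R n)" "y \<in> carrier (igr_grp R n)" for n x y
    using f that by (auto simp: igr_hom_def hom_def)
  have f_mult: "f (n + m) (igr_mult R n m x y) = igr_mult S n m (f n x) (f m y)"
    if "x \<in> carrier (igr_grp R n)" "y \<in> carrier (igr_grp R m)" for n m x y
    using f that by (auto simp: igr_hom_def)
  have f_one: "f 0 (igr_one R) = igr_one S" and f_top: "f n (igr_top R n) = igr_top S n" for n
    using f by (auto simp: igr_hom_def)
  have eqI: "x = y" if "f n x = f n y" "x \<in> carrier (igr_grp R n)" "y \<in> carrier (igr_grp R n)" for n x y
    using bij that by (auto simp: bij_betw_def inj_on_def)
  have comm_R: "comm_group (igr_grp R n)" for n
  proof -
    interpret Sn: comm_group "igr_grp S n" by (rule S.grp)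
    show ?thesis
    proof (rule comm_groupI)
      fix x assume x: "x \<in> carrier (igr_grp R n)"
      obtain y where "y \<in> carrier (igr_grp R n)" "f n y = inv\<^bsub>igr_grp S n\<^esub> f n x"
        using bij[of n] Sn.inv_closed[OF f_closed[OF x]] unfolding bij_betw_def by (metis imageE)
      moreover from this have "y \<otimes>\<^bsub>igr_grp R n\<^esub> x = \<one>\<^bsub>igr_grp R n\<^esub>"
        using x by (intro eqI[of n]) (auto simp: f_add zero add_closed f_closed)
      ultimately show "\<exists>y\<in>carrier (igr_grp R n). y \<otimes>\<^bsub>igr_grp R n\<^esub> x = \<one>\<^bsub>igr_grp R n\<^esub>"
        by blast
    qed (auto intro!: eqI[of n] simp: f_add zero add_closed f_closed Sn.m_ac)
  qed
  have add_right: "igr_mult R n m x (y \<otimes>\<^bsub>igr_grp R m\<^esub> y') =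
      igr_mult R n m x y \<otimes>\<^bsub>igr_grp R (n + m)\<^esub> igr_mult R n m x y'"
    if "x \<in> carrier (igr_grp R n)" "y \<in> carrier (igr_grp R m)" "y' \<in> carrier (igr_grp R m)"
    for n m x y y'
    using that
    by (intro eqI[of "n + m"]) (simp_all add: f_add f_mult mult add_closed f_closed S.mult_add_right)
  have iter: "igr_h_iter R n p x \<in> carrier (igr_grp R p) \<and>
      f p (igr_h_iter R n p x) = igr_h_iter S n p (f n x)"
    if "x \<in> carrier (igr_grp R n)" "n \<le> p" for n p x
    using that(2)
  proof (induction p)
    case 0
    then show ?case using that by simp
  next
    case (Suc p)
    show ?case
    proof (cases "n = Suc p")
      case True
      then show ?thesis using that by simp
    next
      case False
      then have np: "n \<le> p" using Suc.prems by simp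
      then show ?thesis
        using Suc.IH[OF np] mult[OF top[of 1], of _ p] f_mult[OF top[of 1], of _ p] False Suc.prems
        by (simp add: igr_h_def f_top)
    qed
  qed
  show ?thesis
  proof (rule inductive_graded_ring.intro)
    fix n
    show "comm_group (igr_grp R n)" by (rule comm_R)
    show "igr_h R n \<in> hom (igr_grp R n) (igr_grp R (Suc n))"
      using mult[OF top[of 1], of _ n] add_right[OF top[of 1], of _ n]
      by (auto simp: hom_def igr_h_def)
    show "igr_h R n (igr_top R n) = igr_top R (Suc n)"
      using S.h_top[of n] mult[OF top[of 1] top[of n]] f_mult[OF top[of 1] top[of n]] top[of "Suc n"]
      by (intro eqI[of "Suc n"]) (simp_all add: igr_h_def f_top)
    have "f 0 \<in> iso (igr_grp R 0) (igr_grp S 0)"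
      using f bij by (auto simp: igr_hom_def iso_def)
    then show "igr_grp R 0 \<cong> add_monoid (residue_ring 2)"
      using iso_trans[OF _ S.degree_0] by (auto simp: is_iso_def)
  next
    fix n m k x y z
    assume xyz: "x \<in> carrier (igr_grp R n)" "y \<in> carrier (igr_grp R m)" "z \<in> carrier (igr_grp R k)"
    show "igr_mult R (n + m) k (igr_mult R n m x y) z = igr_mult R n (m + k) x (igr_mult R m k y z)"
    proof (rule eqI[of "n + m + k"])
      show "f (n + m + k) (igr_mult R (n + m) k (igr_mult R n m x y) z)
        = f (n + m + k) (igr_mult R n (m + k) x (igr_mult R m k y z))"
        using xyz f_mult[of _ "n + m" _ k] f_mult[of x n _ "m + k"]
        by (simp add: f_mult mult f_closed S.mult_assoc add.assoc)
      show "igr_mult R (n + m) k (igr_mult R n m x y) z \<in> carrier (igr_grp R (n + m + k))"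
        using xyz mult by simp
      show "igr_mult R n (m + k) x (igr_mult R m k y z) \<in> carrier (igr_grp R (n + m + k))"
        using xyz mult[of x n _ "m + k"] mult by (simp add: add.assoc)
    qed
  next
    fix n m x y
    assume xy: "x \<in> carrier (igr_grp R n)" "y \<in> carrier (igr_grp R m)"
    show "igr_mult R n m x y = igr_mult R m n y x"
      using xy f_mult[OF xy] f_mult[OF xy(2,1)] mult[OF xy] mult[OF xy(2,1)] S.mult_comm f_closed
      by (intro eqI[of "n + m"]) (simp_all add: add.commute)
    fix p q
    assume pq: "n \<le> p" "m \<le> q"
    show "igr_mult R p q (igr_h_iter R n p x) (igr_h_iter R m q y) =
        igr_h_iter R (n + m) (p + q) (igr_mult R n m x y)"
      using iter[OF xy(1) pq(1)] iter[OF xy(2) pq(2)] iter[OF mult[OF xy] add_mono[OF pq]] xy pq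
      by (intro eqI[of "p + q"]) (simp_all add: mult f_mult S.h_mult f_closed)
  next
    fix n x assume x: "x \<in> carrier (igr_grp R n)"
    show "x \<otimes>\<^bsub>igr_grp R n\<^esub> x = \<one>\<^bsub>igr_grp R n\<^esub>"
      using x by (intro eqI[of n]) (simp_all add: f_add zero add_closed f_closed S.exponent_2)
    show "igr_mult R 0 n (igr_one R) x = x"
      using x mult[OF one x] f_mult[OF one x]
      by (intro eqI[of n]) (simp_all add: f_one S.mult_one f_closed)
  next
    fix n m x x' y
    assume *: "x \<in> carrier (igr_grp R n)" "x' \<in> carrier (igr_grp R n)" "y \<in> carrier (igr_grp R m)"
    then show "igr_mult R n m (x \<otimes>\<^bsub>igr_grp R n\<^esub> x') y =
        igr_mult R n m x y \<otimes>\<^bsub>igr_grp R (n + m)\<^esub> igr_mult R n m x' y"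
      by (intro eqI[of "n + m"]) (simp_all add: f_add f_mult mult add_closed f_closed S.mult_add_left)
  qed (fact top one mult add_right)+
qed

text \<open>First isomorphism theorem in every degree. By \<open>kernel\<close>, an element of
  degree \<open>n\<close> killed by \<open>\<phi>\<close> is the double of an element of the same
  degree; conversely doubles vanish in \<open>C\<close>, which has characteristic 2.\<close>

lemma graded_igr_mod2_iso:
  assumes "ring B" "ring C" and \<phi>: "\<phi> \<in> ring_hom B C"
    and g: "g \<in> X \<rightarrow> carrier B" and g': "g' \<in> Y \<rightarrow> carrier C"
    and q: "q ` X = Y" and \<phi>_gen: "\<And>a. a \<in> X \<Longrightarrow> \<phi> (g a) = g' (q a)" and e: "e \<in> X"
    and two: "\<one>\<^bsub>C\<^esub> \<oplus>\<^bsub>C\<^esub> \<one>\<^bsub>C\<^esub> = \<zero>\<^bsub>C\<^esub>"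
    and kernel: "\<And>n x. graded_span B g X n x \<Longrightarrow> \<phi> x = \<zero>\<^bsub>C\<^esub> \<Longrightarrow>
      \<exists>z. graded_span B g X n z \<and> x = z \<oplus>\<^bsub>B\<^esub> z"
    and igr: "inductive_graded_ring (graded_igr C g' Y (q e))"
  shows "igr_iso (igr_mod2 (graded_igr B g X e)) (graded_igr C g' Y (q e))"
proof -
  interpret B: ring B by fact
  interpret C: ring C by fact
  interpret \<phi>: ring_hom_ring B C \<phi> by (rule ring_hom_ringI2[OF B.ring_axioms C.ring_axioms \<phi>])
  let ?G = "graded_igr B g X e" and ?S = "graded_igr C g' Y (q e)"
  let ?gs = "graded_span B g X"
  note c = B.graded_span_closed[OF g]
  \<comment> \<open>The fibre of \<open>\<phi>\<close> through \<open>x\<close> inside degree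
    \<open>n\<close>. It equals the coset of \<open>x\<close> modulo doubles, and fibres are easier
    to add and multiply than cosets.\<close>
  define fib where "fib n x = {y. ?gs n y \<and> \<phi> y = \<phi> x}" for n x
  have fib_eq: "fib n x = fib n y \<longleftrightarrow> \<phi> x = \<phi> y" if "?gs n x" "?gs n y" for n x y
    using that by (auto simp: fib_def)
  have coset: "igr_double ?G n #>\<^bsub>igr_grp ?G n\<^esub> x = fib n x" if x: "?gs n x" for n x
  proof
    show "igr_double ?G n #>\<^bsub>igr_grp ?G n\<^esub> x \<subseteq> fib n x"
      using x c C.char_2_double[OF two]
      by (auto simp: igr_double_def r_coset_def fib_def graded_span.add)
    show "fib n x \<subseteq> igr_double ?G n #>\<^bsub>igr_grp ?G n\<^esub> x"
    proof
      fix y assume "y \<in> fib n x"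
      then have y: "?gs n y" "\<phi> y = \<phi> x" by (auto simp: fib_def)
      have "?gs n (y \<oplus>\<^bsub>B\<^esub> \<ominus>\<^bsub>B\<^esub> x)" using x y by (intro graded_span.add graded_span.neg)
      moreover have "\<phi> (y \<oplus>\<^bsub>B\<^esub> \<ominus>\<^bsub>B\<^esub> x) = \<zero>\<^bsub>C\<^esub>"
        using x y c by (simp add: C.r_neg)
      ultimately obtain z where z: "?gs n z" "y \<oplus>\<^bsub>B\<^esub> \<ominus>\<^bsub>B\<^esub> x = z \<oplus>\<^bsub>B\<^esub> z" using kernel by blast
      have "y = (y \<oplus>\<^bsub>B\<^esub> \<ominus>\<^bsub>B\<^esub> x) \<oplus>\<^bsub>B\<^esub> x"
        using x y c by (simp add: B.a_assoc B.l_neg)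
      then show "y \<in> igr_double ?G n #>\<^bsub>igr_grp ?G n\<^esub> x"
        using z by (auto simp: igr_double_def r_coset_def)
    qed
  qed
  have double: "igr_double ?G n = fib n \<zero>\<^bsub>B\<^esub>" for n
  proof
    show "igr_double ?G n \<subseteq> fib n \<zero>\<^bsub>B\<^esub>"
      using c C.char_2_double[OF two] by (auto simp: igr_double_def fib_def graded_span.add)
    show "fib n \<zero>\<^bsub>B\<^esub> \<subseteq> igr_double ?G n"
      using kernel by (auto simp: igr_double_def fib_def)
  qed
  let ?R = "igr_mod2 ?G"
  have car: "carrier (igr_grp ?R n) = fib n ` {x. ?gs n x}" for n
    by (auto simp: igr_mod2_def FactGroup_def RCOSETS_def coset)
  have zero_R: "\<one>\<^bsub>igr_grp ?R n\<^esub> = fib n \<zero>\<^bsub>B\<^esub>" for n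
    by (simp add: igr_mod2_def FactGroup_def double)
  have add_R: "fib n x \<otimes>\<^bsub>igr_grp ?R n\<^esub> fib n y = fib n (x \<oplus>\<^bsub>B\<^esub> y)"
    if xy: "?gs n x" "?gs n y" for n x y
  proof -
    have "fib n x <#>\<^bsub>igr_grp ?G n\<^esub> fib n y = fib n (x \<oplus>\<^bsub>B\<^esub> y)"
    proof
      show "fib n x <#>\<^bsub>igr_grp ?G n\<^esub> fib n y \<subseteq> fib n (x \<oplus>\<^bsub>B\<^esub> y)"
        using xy c by (auto simp: set_mult_def fib_def graded_span.add)
      show "fib n (x \<oplus>\<^bsub>B\<^esub> y) \<subseteq> fib n x <#>\<^bsub>igr_grp ?G n\<^esub> fib n y"
      proof
        fix z assume "z \<in> fib n (x \<oplus>\<^bsub>B\<^esub> y)"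
        then have z: "?gs n z" "\<phi> z = \<phi> x \<oplus>\<^bsub>C\<^esub> \<phi> y" using xy c by (auto simp: fib_def)
        have "?gs n (z \<oplus>\<^bsub>B\<^esub> \<ominus>\<^bsub>B\<^esub> y)" using z xy by (intro graded_span.add graded_span.neg)
        moreover have "\<phi> (z \<oplus>\<^bsub>B\<^esub> \<ominus>\<^bsub>B\<^esub> y) = \<phi> x"
          using z xy c by (simp add: C.a_assoc C.r_neg)
        ultimately have "z \<oplus>\<^bsub>B\<^esub> \<ominus>\<^bsub>B\<^esub> y \<in> fib n x" by (simp add: fib_def)
        moreover have "y \<in> fib n y" using xy by (simp add: fib_def)
        moreover have "z = (z \<oplus>\<^bsub>B\<^esub> \<ominus>\<^bsub>B\<^esub> y) \<oplus>\<^bsub>B\<^esub> y"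
          using z xy c by (simp add: B.a_assoc B.l_neg)
        ultimately show "z \<in> fib n x <#>\<^bsub>igr_grp ?G n\<^esub> fib n y"
          by (auto simp: set_mult_def)
      qed
    qed
    then show ?thesis by (simp add: igr_mod2_def FactGroup_def)
  qed
  have one_R: "igr_one ?R = fib 0 \<one>\<^bsub>B\<^esub>"
    by (simp add: igr_mod2_def coset[OF graded_span.one] del: One_nat_def)
  have gse: "?gs n (g e [^]\<^bsub>B\<^esub> n)" for n by (rule B.graded_span_pow[OF g e])
  have top_R: "igr_top ?R n = fib n (g e [^]\<^bsub>B\<^esub> n)" for n
    by (simp add: igr_mod2_def coset[OF gse])
  have mult_R: "igr_mult ?R n m (fib n x) (fib m y) = fib (n + m) (x \<otimes>\<^bsub>B\<^esub> y)"
    if xy: "?gs n x" "?gs m y" for n m x y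
  proof -
    \<comment> \<open>The product in \<open>igr_mod2\<close> is a union over all pairs of
      representatives; it is a single class because every pair yields the same fibre.\<close>
    have "igr_double ?G (n + m) #>\<^bsub>igr_grp ?G (n + m)\<^esub> (x' \<otimes>\<^bsub>B\<^esub> y') = fib (n + m) (x \<otimes>\<^bsub>B\<^esub> y)"
      if "x' \<in> fib n x" "y' \<in> fib m y" for x' y'
    proof -
      have gs': "?gs n x'" "?gs m y'" and eq: "\<phi> x' = \<phi> x" "\<phi> y' = \<phi> y"
        using that by (auto simp: fib_def)
      have "\<phi> (x' \<otimes>\<^bsub>B\<^esub> y') = \<phi> (x \<otimes>\<^bsub>B\<^esub> y)"
        using gs' xy c eq by simp
      then show ?thesis
        using coset[OF B.graded_span_mult[OF g gs']]
          fib_eq[OF B.graded_span_mult[OF g gs'] B.graded_span_mult[OF g xy]] by simp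
    qed
    moreover have "x \<in> fib n x" "y \<in> fib m y" using xy by (auto simp: fib_def)
    ultimately show ?thesis by (auto simp: igr_mod2_def)
  qed
  define f where "f n X = the_elem (\<phi> ` X)" for n :: nat and X
  have f_fib: "f n (fib n x) = \<phi> x" if "?gs n x" for n x
  proof -
    have "\<phi> ` fib n x = {\<phi> x}" using that by (auto simp: fib_def)
    then show ?thesis by (simp add: f_def)
  qed
  have \<phi>_gs: "graded_span C g' Y n (\<phi> x)" if "?gs n x" for n x
    by (rule ring_hom_graded_span[OF B.ring_axioms C.ring_axioms \<phi> g, of q])
      (use q \<phi>_gen that in auto)
  have \<phi>_pow: "\<phi> (g e [^]\<^bsub>B\<^esub> n) = g' (q e) [^]\<^bsub>C\<^esub> n" for n :: nat
  proof (induction n)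
    case (Suc n)
    then show ?case using g e \<phi>_gen[OF e] by (auto simp: Pi_def)
  qed simp
  have bij: "bij_betw (f n) (carrier (igr_grp ?R n)) (carrier (igr_grp ?S n))" for n
    unfolding bij_betw_def
  proof
    show "inj_on (f n) (carrier (igr_grp ?R n))"
      unfolding car by (auto simp: inj_on_def f_fib fib_eq)
    have "y \<in> f n ` carrier (igr_grp ?R n)" if y: "graded_span C g' Y n y" for y
    proof -
      obtain x where "?gs n x" "\<phi> x = y"
        using ring_hom_graded_span_surj[OF B.ring_axioms C.ring_axioms \<phi> g q \<phi>_gen y] by blast
      then show ?thesis unfolding car using f_fib[of n x] by (intro image_eqI[of _ _ "fib n x"]) auto
    qed
    then show "f n ` carrier (igr_grp ?R n) = carrier (igr_grp ?S n)"
      unfolding car by (auto simp: f_fib \<phi>_gs)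
  qed
  have gs_add: "?gs n (x \<oplus>\<^bsub>B\<^esub> y)" if "?gs n x" "?gs n y" for n x y
    using that by (rule graded_span.add)
  have gs_mult: "?gs (n + m) (x \<otimes>\<^bsub>B\<^esub> y)" if "?gs n x" "?gs m y" for n m x y
    by (rule B.graded_span_mult[OF g that])
  have hom: "f \<in> igr_hom ?R ?S"
    unfolding igr_hom_def
  proof (intro CollectI conjI allI ballI)
    fix n
    show "f n \<in> hom (igr_grp ?R n) (igr_grp ?S n)"
      unfolding hom_def car by (auto simp: f_fib add_R \<phi>_gs gs_add c)
    show "f n (igr_top ?R n) = igr_top ?S n"
      using f_fib[OF gse] by (simp add: top_R \<phi>_pow)
    fix m X Y assume "X \<in> carrier (igr_grp ?R n)" "Y \<in> carrier (igr_grp ?R m)"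
    then show "f (n + m) (igr_mult ?R n m X Y) = igr_mult ?S n m (f n X) (f m Y)"
      unfolding car by (auto simp: f_fib mult_R gs_mult c)
  next
    show "f 0 (igr_one ?R) = igr_one ?S"
      using f_fib[OF graded_span.one] by (simp add: one_R)
  qed
  have "inductive_graded_ring ?R"
  proof (rule inductive_graded_ring_transfer[OF igr hom bij])
    show "\<one>\<^bsub>igr_grp ?R n\<^esub> \<in> carrier (igr_grp ?R n)" for n
      unfolding car zero_R using graded_span.zero by blast
    show "f n \<one>\<^bsub>igr_grp ?R n\<^esub> = \<one>\<^bsub>igr_grp ?S n\<^esub>" for n
      unfolding zero_R using f_fib[OF graded_span.zero] by simp
    show "igr_one ?R \<in> carrier (igr_grp ?R 0)"
      unfolding car one_R using graded_span.one by blast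
    show "igr_top ?R n \<in> carrier (igr_grp ?R n)" for n
      unfolding car top_R using gse by blast
    show "x \<otimes>\<^bsub>igr_grp ?R n\<^esub> y \<in> carrier (igr_grp ?R n)"
      if "x \<in> carrier (igr_grp ?R n)" "y \<in> carrier (igr_grp ?R n)" for n x y
      using that unfolding car by (auto simp: add_R gs_add)
    show "igr_mult ?R n m x y \<in> carrier (igr_grp ?R (n + m))"
      if "x \<in> carrier (igr_grp ?R n)" "y \<in> carrier (igr_grp ?R m)" for n m x y
      using that unfolding car by (auto simp: mult_R gs_mult)
  qed
  then show ?thesis using igr hom bij by (auto simp: igr_iso_def)
qed

lemma igr_iso_sym:
  assumes "igr_iso R S"
  shows "igr_iso S R"
proof -
  obtain f where R: "inductive_graded_ring R" and S: "inductive_graded_ring S"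
    and f: "f \<in> igr_hom R S"
    and bij: "\<And>n. bij_betw (f n) (carrier (igr_grp R n)) (carrier (igr_grp S n))"
    using assms by (auto simp: igr_iso_def)
  interpret R: inductive_graded_ring R by fact
  interpret S: inductive_graded_ring S by fact
  let ?h = "\<lambda>n. inv_into (carrier (igr_grp R n)) (f n)"
  have bij': "bij_betw (?h n) (carrier (igr_grp S n)) (carrier (igr_grp R n))" for n
    using bij by (rule bij_betw_inv_into)
  have h_closed: "?h n y \<in> carrier (igr_grp R n)" if "y \<in> carrier (igr_grp S n)" for n y
    using bij'[of n] that by (auto simp: bij_betw_def)
  have fh: "f n (?h n y) = y" if "y \<in> carrier (igr_grp S n)" for n y
    using bij[of n] that by (simp add: bij_betw_inv_into_right)
  have h_eq: "?h n y = x" if "x \<in> carrier (igr_grp R n)" "f n x = y" for n x y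
    using bij[of n] that by (auto simp: bij_betw_inv_into_left)
  have f_mult: "f (n + m) (igr_mult R n m x y) = igr_mult S n m (f n x) (f m y)"
    if "x \<in> carrier (igr_grp R n)" "y \<in> carrier (igr_grp R m)" for n m x y
    using f that by (auto simp: igr_hom_def)
  have "?h \<in> igr_hom S R"
    unfolding igr_hom_def
  proof (intro CollectI conjI allI ballI)
    fix n
    have "f n \<in> iso (igr_grp R n) (igr_grp S n)"
      using f bij by (auto simp: igr_hom_def iso_def)
    then show "?h n \<in> hom (igr_grp S n) (igr_grp R n)"
      using group.iso_set_sym[OF comm_group.axioms(2)[OF R.grp]] by (auto simp: iso_def)
    show "?h n (igr_top S n) = igr_top R n"
      using f by (intro h_eq R.top_closed) (auto simp: igr_hom_def)
    fix m x y assume xy: "x \<in> carrier (igr_grp S n)" "y \<in> carrier (igr_grp S m)"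
    show "?h (n + m) (igr_mult S n m x y) = igr_mult R n m (?h n x) (?h m y)"
      using xy h_closed by (intro h_eq R.mult_closed) (auto simp: f_mult fh)
  next
    show "?h 0 (igr_one S) = igr_one R"
      using f by (intro h_eq R.one_closed) (auto simp: igr_hom_def)
  qed
  with R S bij' show ?thesis
    unfolding igr_iso_def by (intro conjI bexI[of _ ?h] allI)
qed

section \<open>Symbol maps into rings of characteristic 2\<close>

locale symbol_map = A: comm_group A + B: ring B
  for A :: "('x, 'n) monoid_scheme" and B :: "('b, 'k) ring_scheme" +
  fixes P :: "('x \<times> 'x) set" and \<sigma> :: "'x \<Rightarrow> 'b"
  assumes two: "\<one>\<^bsub>B\<^esub> \<oplus>\<^bsub>B\<^esub> \<one>\<^bsub>B\<^esub> = \<zero>\<^bsub>B\<^esub>"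
    and closed [simp]: "a \<in> carrier A \<Longrightarrow> \<sigma> a \<in> carrier B"
    and map_mult: "a \<in> carrier A \<Longrightarrow> b \<in> carrier A \<Longrightarrow> \<sigma> (a \<otimes>\<^bsub>A\<^esub> b) = \<sigma> a \<oplus>\<^bsub>B\<^esub> \<sigma> b"
    and map_rel: "(a, b) \<in> P \<Longrightarrow> \<sigma> a \<otimes>\<^bsub>B\<^esub> \<sigma> b = \<zero>\<^bsub>B\<^esub>"
begin

lemma double [simp]: "x \<in> carrier B \<Longrightarrow> x \<oplus>\<^bsub>B\<^esub> x = \<zero>\<^bsub>B\<^esub>"
  by (rule B.char_2_double[OF two])

lemma eq_if_sum_zero:
  assumes "x \<in> carrier B" "y \<in> carrier B" "x \<oplus>\<^bsub>B\<^esub> y = \<zero>\<^bsub>B\<^esub>"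
  shows "x = y"
  using B.minus_equality[OF assms(3,2,1)] B.minus_equality[OF double[OF assms(2)] assms(2,2)] by simp

lemma map_one [simp]: "\<sigma> \<one>\<^bsub>A\<^esub> = \<zero>\<^bsub>B\<^esub>"
  using map_mult[of "\<one>\<^bsub>A\<^esub>" "\<one>\<^bsub>A\<^esub>"] by simp

text \<open>The value at a square is a double, hence zero. In this way the quotient by squares is
  forced on Milnor symbols modulo 2.\<close>

lemma map_square [simp]: "a \<in> carrier A \<Longrightarrow> \<sigma> (a \<otimes>\<^bsub>A\<^esub> a) = \<zero>\<^bsub>B\<^esub>"
  by (simp add: map_mult)

lemma map_inv: "a \<in> carrier A \<Longrightarrow> \<sigma> (inv\<^bsub>A\<^esub> a) = \<sigma> a"
  by (rule eq_if_sum_zero) (simp_all flip: map_mult)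

text \<open>\<open>a\<close> and \<open>b\<close> differ by an element of the kernel of
  \<open>q\<close>, where \<open>\<sigma>\<close> vanishes. Hence \<open>\<sigma>\<close> descends
  along \<open>q\<close>.\<close>

lemma map_cong:
  assumes "group H" and q: "q \<in> hom A H"
    and kernel: "\<And>a. a \<in> carrier A \<Longrightarrow> q a = \<one>\<^bsub>H\<^esub> \<Longrightarrow> \<sigma> a = \<zero>\<^bsub>B\<^esub>"
    and ab: "a \<in> carrier A" "b \<in> carrier A" "q a = q b"
  shows "\<sigma> a = \<sigma> b"
proof -
  interpret q: group_hom A H q
    using assms(1) q by (simp add: group_hom_def group_hom_axioms_def A.is_group)
  have "q (a \<otimes>\<^bsub>A\<^esub> inv\<^bsub>A\<^esub> b) = \<one>\<^bsub>H\<^esub>" using ab by simp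
  then have "\<sigma> (a \<otimes>\<^bsub>A\<^esub> inv\<^bsub>A\<^esub> b) = \<zero>\<^bsub>B\<^esub>" using ab by (intro kernel) auto
  then have "\<sigma> a \<oplus>\<^bsub>B\<^esub> \<sigma> b = \<zero>\<^bsub>B\<^esub>"
    using ab by (simp add: map_mult map_inv)
  then show ?thesis by (rule eq_if_sum_zero[OF closed[OF ab(1)] closed[OF ab(2)]])
qed

text \<open>Here \<open>e\<close> plays the part of minus one. Expanding the vanishing product for
  \<open>a b\<close>, namely \<open>(x + y)(e + x + y)\<close>, and removing the vanishing products
  for \<open>a\<close> and for \<open>b\<close> leaves \<open>x y + y x = 0\<close>, and signs do
  not matter.\<close>

lemma commute_if_neg:
  assumes e: "e \<in> carrier A" and neg: "\<And>a. a \<in> carrier A \<Longrightarrow> \<sigma> a \<otimes>\<^bsub>B\<^esub> \<sigma> (e \<otimes>\<^bsub>A\<^esub> a) = \<zero>\<^bsub>B\<^esub>"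
    and ab: "a \<in> carrier A" "b \<in> carrier A"
  shows "\<sigma> a \<otimes>\<^bsub>B\<^esub> \<sigma> b = \<sigma> b \<otimes>\<^bsub>B\<^esub> \<sigma> a"
proof -
  let ?x = "\<sigma> a" and ?y = "\<sigma> b" and ?e = "\<sigma> e"
  have c: "?x \<in> carrier B" "?y \<in> carrier B" "?e \<in> carrier B" using ab e by auto
  have x: "?x \<otimes>\<^bsub>B\<^esub> (?e \<oplus>\<^bsub>B\<^esub> ?x) = \<zero>\<^bsub>B\<^esub>" and y: "?y \<otimes>\<^bsub>B\<^esub> (?e \<oplus>\<^bsub>B\<^esub> ?y) = \<zero>\<^bsub>B\<^esub>"
    using neg[OF ab(1)] neg[OF ab(2)] e ab by (simp_all add: map_mult)
  have "\<zero>\<^bsub>B\<^esub> = (?x \<oplus>\<^bsub>B\<^esub> ?y) \<otimes>\<^bsub>B\<^esub> (?e \<oplus>\<^bsub>B\<^esub> (?x \<oplus>\<^bsub>B\<^esub> ?y))"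
    using neg[of "a \<otimes>\<^bsub>A\<^esub> b"] e ab by (simp add: map_mult)
  also have "\<dots> = ?x \<otimes>\<^bsub>B\<^esub> (?e \<oplus>\<^bsub>B\<^esub> ?x \<oplus>\<^bsub>B\<^esub> ?y) \<oplus>\<^bsub>B\<^esub> ?y \<otimes>\<^bsub>B\<^esub> (?e \<oplus>\<^bsub>B\<^esub> ?y \<oplus>\<^bsub>B\<^esub> ?x)"
    using c by (simp add: B.l_distr B.a_ac)
  also have "\<dots> = (?x \<otimes>\<^bsub>B\<^esub> (?e \<oplus>\<^bsub>B\<^esub> ?x) \<oplus>\<^bsub>B\<^esub> ?x \<otimes>\<^bsub>B\<^esub> ?y) \<oplus>\<^bsub>B\<^esub> (?y \<otimes>\<^bsub>B\<^esub> (?e \<oplus>\<^bsub>B\<^esub> ?y) \<oplus>\<^bsub>B\<^esub> ?y \<otimes>\<^bsub>B\<^esub> ?x)"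
    using c by (simp only: B.r_distr B.a_closed)
  also have "\<dots> = ?x \<otimes>\<^bsub>B\<^esub> ?y \<oplus>\<^bsub>B\<^esub> ?y \<otimes>\<^bsub>B\<^esub> ?x"
    using c by (simp only: x y B.l_zero B.m_closed)
  finally have "?x \<otimes>\<^bsub>B\<^esub> ?y \<oplus>\<^bsub>B\<^esub> ?y \<otimes>\<^bsub>B\<^esub> ?x = \<zero>\<^bsub>B\<^esub>" by (rule sym)
  with c show ?thesis by (metis eq_if_sum_zero B.m_closed)
qed

end

lemma (in symbol_presentation) symbol_symbol_map:
  assumes "R = residue_ring 2"
  shows "symbol_map A Q P \<rho>"
  by unfold_locales (simp_all add: char_2[OF assms] symbol_mult symbol_rel)

section \<open>Comparison of an integral presentation with one modulo 2\<close>

lemma (in ring) doubles_ideal: "ideal {x \<oplus> x | x. x \<in> carrier R} R"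
proof (rule idealI)
  show "subgroup {x \<oplus> x | x. x \<in> carrier R} (add_monoid R)"
  proof
    fix x y assume "x \<in> {x \<oplus> x | x. x \<in> carrier R}" "y \<in> {x \<oplus> x | x. x \<in> carrier R}"
    then obtain a b where "a \<in> carrier R" "b \<in> carrier R" "x = a \<oplus> a" "y = b \<oplus> b" by auto
    then show "x \<otimes>\<^bsub>add_monoid R\<^esub> y \<in> {x \<oplus> x | x. x \<in> carrier R}"
      by (auto intro!: exI[of _ "a \<oplus> b"] simp: a_ac)
  next
    fix x assume "x \<in> {x \<oplus> x | x. x \<in> carrier R}"
    then obtain a where a: "a \<in> carrier R" "x = a \<oplus> a" by auto
    have "inv\<^bsub>add_monoid R\<^esub> x = \<ominus> a \<oplus> \<ominus> a"
      using a minus_add[of a a] by (simp add: a_inv_def)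
    then show "inv\<^bsub>add_monoid R\<^esub> x \<in> {x \<oplus> x | x. x \<in> carrier R}" using a by auto
  qed (auto intro!: exI[of _ \<zero>])
  fix a x assume "a \<in> {x \<oplus> x | x. x \<in> carrier R}" and x: "x \<in> carrier R"
  then obtain b where "b \<in> carrier R" "a = b \<oplus> b" by auto
  with x show "x \<otimes> a \<in> {x \<oplus> x | x. x \<in> carrier R}" "a \<otimes> x \<in> {x \<oplus> x | x. x \<in> carrier R}"
    by (auto simp: r_distr l_distr)
qed (rule ring_axioms)

text \<open>The type of \<open>B\<close> in the last two hypotheses is that of the quotient of the integral symbol ring by
  its doubles, the only ring they are applied to.\<close>

theorem symbol_mod2_iso:
  fixes A :: "('x, 'n) monoid_scheme" and A' :: "('y, 'k) monoid_scheme"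
  assumes "symbol_presentation A \<Z> P" "symbol_presentation A' (residue_ring 2) P'"
    and q: "q \<in> hom A A'" "q ` carrier A = carrier A'" and e: "e \<in> carrier A"
    and rel: "\<And>a b. (a, b) \<in> P \<Longrightarrow>
      symbol (residue_ring 2) A' P' (q a) \<otimes>\<^bsub>symbol_ring (residue_ring 2) A' P'\<^esub>
      symbol (residue_ring 2) A' P' (q b) = \<zero>\<^bsub>symbol_ring (residue_ring 2) A' P'\<^esub>"
    and neg: "\<And>a. a \<in> carrier A' \<Longrightarrow>
      symbol (residue_ring 2) A' P' a \<otimes>\<^bsub>symbol_ring (residue_ring 2) A' P'\<^esub>
      symbol (residue_ring 2) A' P' (q e \<otimes>\<^bsub>A'\<^esub> a) = \<zero>\<^bsub>symbol_ring (residue_ring 2) A' P'\<^esub>"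
    and lift_one: "\<And>(B :: ('x list \<Rightarrow> int) set set set ring) \<sigma> a. symbol_map A B P \<sigma> \<Longrightarrow>
      a \<in> carrier A \<Longrightarrow> q a = \<one>\<^bsub>A'\<^esub> \<Longrightarrow> \<sigma> a = \<zero>\<^bsub>B\<^esub>"
    and lift_rel: "\<And>(B :: ('x list \<Rightarrow> int) set set set ring) \<sigma> a b. symbol_map A B P \<sigma> \<Longrightarrow>
      a \<in> carrier A \<Longrightarrow> b \<in> carrier A \<Longrightarrow> (q a, q b) \<in> P' \<Longrightarrow> \<sigma> a \<otimes>\<^bsub>B\<^esub> \<sigma> b = \<zero>\<^bsub>B\<^esub>"
  shows "igr_iso
    (igr_mod2 (tensor_quot \<Z> (power_module A) (symbol_rels \<Z> A P) e))
    (tensor_quot (residue_ring 2) (power_module A') (symbol_rels (residue_ring 2) A' P') (q e))"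
proof -
  interpret A: symbol_presentation A \<Z> P by (rule assms(1))
  interpret A': symbol_presentation A' "residue_ring 2" P' by (rule assms(2))
  interpret sy: symbol_map A' A'.Q P' A'.\<rho> by (rule A'.symbol_symbol_map) simp
  have qc: "q a \<in> carrier A'" if "a \<in> carrier A" for a using that q by auto
  have q_mult: "q (a \<otimes>\<^bsub>A\<^esub> b) = q a \<otimes>\<^bsub>A'\<^esub> q b" if "a \<in> carrier A" "b \<in> carrier A" for a b
    using that q(1) by (auto simp: hom_def)
  obtain \<phi> where \<phi>: "\<phi> \<in> ring_hom A.Q A'.Q"
    and \<phi>_sym: "\<And>a. a \<in> carrier A \<Longrightarrow> \<phi> (A.\<rho> a) = A'.\<rho> (q a)"
    by (rule A.symbol_ring_extend[OF A'.Q_ring, where \<sigma> = "\<lambda>a. A'.\<rho> (q a)"])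
      (auto simp: qc q_mult A'.symbol_mult rel sy.two)
  interpret \<phi>: ring_hom_ring A.Q A'.Q \<phi> by (rule ring_hom_ringI2[OF A.Q_ring A'.Q_ring \<phi>])
  \<comment> \<open>The map back from the presentation modulo 2 has its target in the quotient by
    doubles. Doubles of elements of all degrees are collected, so that the quotient is again a
    ring.\<close>
  define D where "D = {x \<oplus>\<^bsub>A.Q\<^esub> x | x. x \<in> carrier A.Q}"
  interpret D: ideal D A.Q unfolding D_def by (rule A.Q.doubles_ideal)
  let ?Q2 = "A.Q Quot D"
  interpret Q2: ring ?Q2 by (rule D.quotient_is_ring)
  interpret cl: ring_hom_ring A.Q ?Q2 "\<lambda>x. D +>\<^bsub>A.Q\<^esub> x" by (rule D.rcos_ring_hom_ring)
  let ?\<sigma> = "\<lambda>a. D +>\<^bsub>A.Q\<^esub> A.\<rho> a"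
  have two: "\<one>\<^bsub>?Q2\<^esub> \<oplus>\<^bsub>?Q2\<^esub> \<one>\<^bsub>?Q2\<^esub> = \<zero>\<^bsub>?Q2\<^esub>"
  proof -
    have "\<one>\<^bsub>A.Q\<^esub> \<oplus>\<^bsub>A.Q\<^esub> \<one>\<^bsub>A.Q\<^esub> \<in> D"
      unfolding D_def using A.Q.one_closed by blast
    then have "D +>\<^bsub>A.Q\<^esub> (\<one>\<^bsub>A.Q\<^esub> \<oplus>\<^bsub>A.Q\<^esub> \<one>\<^bsub>A.Q\<^esub>) = \<zero>\<^bsub>?Q2\<^esub>"
      by (rule iffD2[OF D.quotient_zero_iff, rotated]) simp
    then show ?thesis
      by simp
  qed
  interpret \<sigma>: symbol_map A ?Q2 P ?\<sigma>
  proof (unfold_locales, goal_cases)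
    case 1
    show ?case by (rule two)
  next
    case (2 a)
    then show ?case by (intro cl.hom_closed A.symbol_closed)
  next
    case (3 a b)
    then show ?case
      using cl.hom_add[OF A.symbol_closed A.symbol_closed] by (simp add: A.symbol_mult)
  next
    case (4 a b)
    then have "a \<in> carrier A" "b \<in> carrier A" using A.rels_closed by auto
    then show ?case
      using cl.hom_mult[OF A.symbol_closed A.symbol_closed, of a b] A.symbol_rel[OF 4] cl.hom_zero
      by metis
  qed
  note \<sigma>_map = \<sigma>.symbol_map_axioms
  \<comment> \<open>\<open>q\<close> may have a kernel, and any choice of preimages will do:
    \<open>\<sigma>_cong\<close> makes the class of the symbol independent of it.\<close>
  define lift where "lift b = (SOME a. a \<in> carrier A \<and> q a = b)" for b
  have lift: "lift b \<in> carrier A" "q (lift b) = b" if "b \<in> carrier A'" for b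
  proof -
    have "b \<in> q ` carrier A" using that by (simp only: q(2))
    then have "\<exists>a. a \<in> carrier A \<and> q a = b" by blast
    then show "lift b \<in> carrier A" "q (lift b) = b"
      using someI_ex[of "\<lambda>a. a \<in> carrier A \<and> q a = b"] unfolding lift_def by simp_all
  qed
  have \<sigma>_cong: "?\<sigma> a = ?\<sigma> b" if "a \<in> carrier A" "b \<in> carrier A" "q a = q b" for a b
    by (rule \<sigma>.map_cong[OF A'.A.is_group q(1) lift_one[OF \<sigma>_map] that])
  obtain \<psi> where \<psi>: "\<psi> \<in> ring_hom A'.Q ?Q2"
    and \<psi>_sym: "\<And>b. b \<in> carrier A' \<Longrightarrow> \<psi> (A'.\<rho> b) = ?\<sigma> (lift b)"
  proof (rule A'.symbol_ring_extend[OF Q2.ring_axioms, where \<sigma> = "\<lambda>b. ?\<sigma> (lift b)"])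
    show "\<one>\<^bsub>?Q2\<^esub> \<oplus>\<^bsub>?Q2\<^esub> \<one>\<^bsub>?Q2\<^esub> = \<zero>\<^bsub>?Q2\<^esub>" by (rule two)
    show "(\<lambda>b. ?\<sigma> (lift b)) \<in> carrier A' \<rightarrow> carrier ?Q2"
      using lift(1) \<sigma>.closed by blast
    show "?\<sigma> (lift (a \<otimes>\<^bsub>A'\<^esub> b)) = ?\<sigma> (lift a) \<oplus>\<^bsub>?Q2\<^esub> ?\<sigma> (lift b)"
      if "a \<in> carrier A'" "b \<in> carrier A'" for a b
    proof -
      have "?\<sigma> (lift (a \<otimes>\<^bsub>A'\<^esub> b)) = ?\<sigma> (lift a \<otimes>\<^bsub>A\<^esub> lift b)"
        using that lift by (intro \<sigma>_cong) (auto simp: q_mult)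
      then show ?thesis using \<sigma>.map_mult lift(1) that by metis
    qed
    show "?\<sigma> (lift a) \<otimes>\<^bsub>?Q2\<^esub> ?\<sigma> (lift b) = \<zero>\<^bsub>?Q2\<^esub>" if "(a, b) \<in> P'" for a b
      using that lift A'.rels_closed by (intro lift_rel[OF \<sigma>_map]) auto
  qed (rule that)
  interpret \<psi>: ring_hom_ring A'.Q ?Q2 \<psi> by (rule ring_hom_ringI2[OF A'.Q_ring Q2.ring_axioms \<psi>])
  let ?gs = "graded_span A.Q A.\<rho> (carrier A)"
  note c = A.Q.graded_span_closed[OF A.symbol_Pi]
  \<comment> \<open>This composite gives injectivity modulo doubles; surjectivity comes from that of
    \<open>q\<close> on generators.\<close>
  have \<psi>\<phi>: "\<psi> (\<phi> x) = D +>\<^bsub>A.Q\<^esub> x" if "?gs n x" for n x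
    using that
  proof induction
    case one
    show ?case using cl.hom_one by simp
  next
    case (zero n)
    show ?case using cl.hom_zero by simp
  next
    case (gen_mult a n x)
    note a = gen_mult(1) and x = c[OF gen_mult(2)]
    have "\<psi> (\<phi> (A.\<rho> a)) = ?\<sigma> (lift (q a))"
      using a by (simp add: \<phi>_sym \<psi>_sym qc)
    also have "\<dots> = ?\<sigma> a"
      by (rule \<sigma>_cong[OF lift(1)[OF qc[OF a]] a lift(2)[OF qc[OF a]]])
    finally have eq: "\<psi> (\<phi> (A.\<rho> a)) = ?\<sigma> a" .
    have "\<psi> (\<phi> (A.\<rho> a \<otimes>\<^bsub>A.Q\<^esub> x)) = \<psi> (\<phi> (A.\<rho> a)) \<otimes>\<^bsub>?Q2\<^esub> \<psi> (\<phi> x)"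
      using a x by simp
    also have "\<dots> = ?\<sigma> a \<otimes>\<^bsub>?Q2\<^esub> (D +>\<^bsub>A.Q\<^esub> x)"
      by (simp only: eq gen_mult(3))
    also have "\<dots> = D +>\<^bsub>A.Q\<^esub> (A.\<rho> a \<otimes>\<^bsub>A.Q\<^esub> x)"
      by (rule cl.hom_mult[OF A.symbol_closed[OF a] x, symmetric])
    finally show ?case .
  next
    case (add n x y)
    then show ?case using c cl.hom_add[of x y] by simp
  next
    case (neg n x)
    then show ?case using c cl.hom_a_inv[of x] by simp
  qed
  have kernel: "\<exists>z. ?gs n z \<and> x = z \<oplus>\<^bsub>A.Q\<^esub> z" if x: "?gs n x" "\<phi> x = \<zero>\<^bsub>A'.Q\<^esub>" for n x
  proof -
    have "D +>\<^bsub>A.Q\<^esub> x = \<zero>\<^bsub>?Q2\<^esub>" using \<psi>\<phi>[OF x(1)] x(2) by simp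
    then have "x \<in> D" using D.quotient_zero_iff c[OF x(1)] by simp
    then obtain y where "y \<in> carrier A.Q" "x = y \<oplus>\<^bsub>A.Q\<^esub> y" unfolding D_def by blast
    \<comment> \<open>The element \<open>y\<close> has arbitrary degree; it is replaced here by one
      of degree \<open>n\<close>.\<close>
    then show ?thesis using A.graded_span_double[OF refl x(1)] by blast
  qed
  have nontrivial: "\<one>\<^bsub>A'.Q\<^esub> \<noteq> \<zero>\<^bsub>A'.Q\<^esub>"
  proof
    assume eq: "\<one>\<^bsub>A'.Q\<^esub> = \<zero>\<^bsub>A'.Q\<^esub>"
    \<comment> \<open>The augmentation: all symbols go to zero and the unit goes to the unit of the
      field with two elements, so the presented ring is not zero.\<close>
    obtain \<epsilon> where \<epsilon>: "\<epsilon> \<in> ring_hom A'.Q (residue_ring 2)"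
      by (rule A'.symbol_ring_extend[OF A'.R.ring_axioms, where \<sigma> = "\<lambda>a. 0"])
        (auto simp: residue_ring_def)
    interpret \<epsilon>: ring_hom_ring A'.Q "residue_ring 2" \<epsilon>
      by (rule ring_hom_ringI2[OF A'.Q_ring A'.R.ring_axioms \<epsilon>])
    have "\<one>\<^bsub>residue_ring 2\<^esub> = \<zero>\<^bsub>residue_ring 2\<^esub>" using eq \<epsilon>.hom_one \<epsilon>.hom_zero by metis
    then show False by (simp add: residue_ring_def)
  qed
  have "inductive_graded_ring (graded_igr A'.Q A'.\<rho> (carrier A') (q e))"
  proof (rule graded_igr_inductive[OF A'.Q_ring A'.symbol_Pi qc[OF e] sy.two nontrivial])
    show "A'.\<rho> a \<otimes>\<^bsub>A'.Q\<^esub> A'.\<rho> b = A'.\<rho> b \<otimes>\<^bsub>A'.Q\<^esub> A'.\<rho> a"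
      if "a \<in> carrier A'" "b \<in> carrier A'" for a b
      by (rule sy.commute_if_neg[OF qc[OF e] neg that])
  qed
  then have "igr_iso (igr_mod2 (graded_igr A.Q A.\<rho> (carrier A) e))
      (graded_igr A'.Q A'.\<rho> (carrier A') (q e))"
    by (intro graded_igr_mod2_iso[OF A.Q_ring A'.Q_ring \<phi> A.symbol_Pi A'.symbol_Pi q(2) \<phi>_sym e
          sy.two kernel])
  then show ?thesis by (simp only: A.tensor_quot_eq A'.tensor_quot_eq)
qed

section \<open>Fields\<close>

definition dm_rels :: "('g, 'm) sgroup_scheme \<Rightarrow> ('g \<times> 'g) set" where
  "dm_rels G = {(a, a \<otimes>\<^bsub>G\<^esub> b) | a b. a \<in> carrier G \<and> b \<in> carrier G \<and> a \<in> sg_rep G \<one>\<^bsub>G\<^esub> b}"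

definition mil_rels :: "('a, 'm) ring_scheme \<Rightarrow> ('a \<times> 'a) set" where
  "mil_rels F = {(a, \<one>\<^bsub>F\<^esub> \<ominus>\<^bsub>F\<^esub> a) | a. a \<in> carrier F - {\<zero>\<^bsub>F\<^esub>, \<one>\<^bsub>F\<^esub>}}"

definition mult_rels :: "('r, 'm) multiring_data_scheme \<Rightarrow> ('r \<times> 'r) set" where
  "mult_rels H = {(a, b). a \<in> carrier H - {hzero H, \<one>\<^bsub>H\<^esub>} \<and> b \<in> hadd H \<one>\<^bsub>H\<^esub> (hneg H a)}"

lemma k_dm_tensor_quot:
  "k_dm G = tensor_quot (residue_ring 2) (power_module G)
    (symbol_rels (residue_ring 2) G (dm_rels G)) (minus_one G)"
proof -
  have "symbol_rels (residue_ring 2) G (dm_rels G) =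
    {tensor_incl (residue_ring 2) (power_module G) a
      \<otimes>\<^bsub>tensor_algebra (residue_ring 2) (power_module G)\<^esub>
      tensor_incl (residue_ring 2) (power_module G) (a \<otimes>\<^bsub>G\<^esub> b) | a b.
      a \<in> carrier G \<and> b \<in> carrier G \<and> a \<in> sg_rep G \<one>\<^bsub>G\<^esub> b}"
    unfolding symbol_rels_def dm_rels_def by blast
  then show ?thesis by (simp add: k_dm_def Let_def)
qed

lemma k_mil_tensor_quot:
  "k_mil F = igr_mod2 (tensor_quot \<Z> (power_module (mult_of F))
    (symbol_rels \<Z> (mult_of F) (mil_rels F)) (\<ominus>\<^bsub>F\<^esub> \<one>\<^bsub>F\<^esub>))"
proof -
  have "symbol_rels \<Z> (mult_of F) (mil_rels F) =
    {tensor_incl \<Z> (power_module (mult_of F)) a \<otimes>\<^bsub>tensor_algebra \<Z> (power_module (mult_of F))\<^esub>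
      tensor_incl \<Z> (power_module (mult_of F)) (\<one>\<^bsub>F\<^esub> \<ominus>\<^bsub>F\<^esub> a) | a.
      a \<in> carrier F - {\<zero>\<^bsub>F\<^esub>, \<one>\<^bsub>F\<^esub>}}"
    unfolding symbol_rels_def mil_rels_def by blast
  then show ?thesis by (simp add: k_mil_def K_mil_def Let_def)
qed

lemma k_mult_tensor_quot:
  "k_mult H = igr_mod2 (tensor_quot \<Z> (power_module (hmult_of H))
    (symbol_rels \<Z> (hmult_of H) (mult_rels H)) (hneg H \<one>\<^bsub>H\<^esub>))"
proof -
  have "symbol_rels \<Z> (hmult_of H) (mult_rels H) =
    {tensor_incl \<Z> (power_module (hmult_of H)) a \<otimes>\<^bsub>tensor_algebra \<Z> (power_module (hmult_of H))\<^esub>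
      tensor_incl \<Z> (power_module (hmult_of H)) b | a b.
      a \<in> carrier H - {hzero H, \<one>\<^bsub>H\<^esub>} \<and> b \<in> hadd H \<one>\<^bsub>H\<^esub> (hneg H a)}"
    unfolding symbol_rels_def mult_rels_def by blast
  then show ?thesis by (simp add: k_mult_def K_mult_def Let_def)
qed

lemma (in field) mult_of_comm_group: "comm_group (mult_of R)"
  by (rule group.group_comm_groupI[OF field_mult_group]) (auto simp: m_comm)

lemma (in field) inv_nonzero:
  assumes "a \<in> carrier R" "a \<noteq> \<zero>"
  shows "inv a \<in> carrier R" "inv a \<noteq> \<zero>" "a \<otimes> inv a = \<one>" "inv a \<otimes> a = \<one>"
proof -
  have a: "a \<in> Units R" using assms field_Units by auto
  then show "inv a \<in> carrier R" "a \<otimes> inv a = \<one>" "inv a \<otimes> a = \<one>" by auto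
  then show "inv a \<noteq> \<zero>" using assms by auto
qed

lemma (in field) milnor_neg:
  assumes "symbol_map (mult_of R) B P \<sigma>"
    and steinberg: "\<And>a. a \<in> carrier R \<Longrightarrow> a \<noteq> \<zero> \<Longrightarrow> a \<noteq> \<one> \<Longrightarrow> \<sigma> a \<otimes>\<^bsub>B\<^esub> \<sigma> (\<one> \<ominus> a) = \<zero>\<^bsub>B\<^esub>"
    and a: "a \<in> carrier R" "a \<noteq> \<zero>"
  shows "\<sigma> a \<otimes>\<^bsub>B\<^esub> \<sigma> (\<ominus> a) = \<zero>\<^bsub>B\<^esub>"
proof -
  interpret \<sigma>: symbol_map "mult_of R" B P \<sigma> by fact
  have \<sigma>_mult: "\<sigma> (x \<otimes> y) = \<sigma> x \<oplus>\<^bsub>B\<^esub> \<sigma> y" if "x \<in> carrier R - {\<zero>}" "y \<in> carrier R - {\<zero>}" for x y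
    using \<sigma>.map_mult[of x y] that by simp
  have \<sigma>_closed: "\<sigma> x \<in> carrier B" if "x \<in> carrier R - {\<zero>}" for x
    using \<sigma>.closed[of x] that by simp
  have neg: "\<ominus> a \<in> carrier R - {\<zero>}" using a by (metis DiffI a_inv_closed minus_minus minus_zero singletonD)
  show ?thesis
  proof (cases "a = \<one>")
    case True
    then show ?thesis using \<sigma>.map_one neg \<sigma>_closed by simp
  next
    case False
    let ?b = "inv a"
    note b = inv_nonzero[OF a]
    have b1: "?b \<noteq> \<one>" using b a False by (metis l_one)
    have eq: "\<one> \<ominus> a = \<ominus> a \<otimes> (\<one> \<ominus> ?b)"
    proof -
      have "\<ominus> a \<otimes> (\<one> \<ominus> ?b) = \<ominus> a \<oplus> a \<otimes> ?b" using a(1) b(1) by algebra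
      then show ?thesis using a(1) b by (simp add: a_minus_def a_comm)
    qed
    have nz: "\<one> \<ominus> a \<in> carrier R - {\<zero>}" "\<one> \<ominus> ?b \<in> carrier R - {\<zero>}"
      using a b b1 False by (auto simp: r_right_minus_eq)
    \<comment> \<open>In characteristic 2 the symbols of \<open>a\<close> and \<open>1/a\<close>
      agree, so the second summand obtained below is the Steinberg product of
      \<open>1/a\<close>.\<close>
    have ab: "\<sigma> ?b = \<sigma> a"
      using \<sigma>.map_inv[of a] a m_inv_mult_of[of a] by simp
    have "\<sigma> (\<one> \<ominus> a) = \<sigma> (\<ominus> a) \<oplus>\<^bsub>B\<^esub> \<sigma> (\<one> \<ominus> ?b)"
      unfolding eq by (rule \<sigma>_mult[OF neg nz(2)])
    then have "\<sigma> (\<ominus> a) = \<sigma> (\<one> \<ominus> a) \<oplus>\<^bsub>B\<^esub> \<sigma> (\<one> \<ominus> ?b)"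
      using \<sigma>_closed[OF neg] \<sigma>_closed[OF nz(2)] by (simp add: \<sigma>.B.a_assoc)
    then have "\<sigma> a \<otimes>\<^bsub>B\<^esub> \<sigma> (\<ominus> a) = \<sigma> a \<otimes>\<^bsub>B\<^esub> \<sigma> (\<one> \<ominus> a) \<oplus>\<^bsub>B\<^esub> \<sigma> ?b \<otimes>\<^bsub>B\<^esub> \<sigma> (\<one> \<ominus> ?b)"
      using \<sigma>_closed nz a by (simp add: ab \<sigma>.B.r_distr)
    then show ?thesis
      using steinberg[OF a False] steinberg[OF b(1,2) b1] by simp
  qed
qed

text \<open>The two sources of special groups are handled at once: \<open>T\<close> is the set of all squares
  for \<open>G(F)\<close> and the preordering for \<open>G\<^sub>T(F)\<close>.\<close>

locale square_semigroup = field F for F :: "('a, 'm) ring_scheme" (structure) +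
  fixes T :: "'a set"
  assumes two: "\<one> \<oplus> \<one> \<noteq> \<zero>"
    and T_closed: "T \<subseteq> carrier F"
    and T_square: "x \<in> carrier F \<Longrightarrow> x \<otimes> x \<in> T"
    and T_mult: "s \<in> T \<Longrightarrow> t \<in> T \<Longrightarrow> s \<otimes> t \<in> T"
begin

abbreviation "S \<equiv> T - {\<zero>}"
abbreviation "Fx \<equiv> carrier F - {\<zero>}"
abbreviation "cl a \<equiv> S #>\<^bsub>mult_of F\<^esub> a"

sublocale U: comm_group "mult_of F" by (rule mult_of_comm_group)

lemma one_T: "\<one> \<in> T" and zero_T: "\<zero> \<in> T"
  using T_square[of \<one>] T_square[of \<zero>] by auto

text \<open>\<open>1/s = s \<cdot> (1/s)^2\<close> is an element of \<open>T\<close> times a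
  square.\<close>

lemma S_inv: "s \<in> S \<Longrightarrow> inv s \<in> S"
proof -
  assume s: "s \<in> S"
  then have s': "s \<in> carrier F" "s \<noteq> \<zero>" using T_closed by auto
  note i = inv_nonzero[OF s']
  have "s \<otimes> (inv s \<otimes> inv s) = inv s" using s' i by (simp flip: m_assoc)
  then show ?thesis using T_mult[of s "inv s \<otimes> inv s"] T_square[OF i(1)] s i(2) by auto
qed

lemma S_subset: "S \<subseteq> Fx" using T_closed by auto

lemma Fx_mult: "a \<in> Fx \<Longrightarrow> b \<in> Fx \<Longrightarrow> a \<otimes> b \<in> Fx"
  using integral by auto

lemma Fx_inv: "a \<in> Fx \<Longrightarrow> inv a \<in> Fx"
  using inv_nonzero[of a] by auto

lemma Fx_neg: "a \<in> Fx \<Longrightarrow> \<ominus> a \<in> Fx"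
  by (metis DiffD1 DiffD2 DiffI a_inv_closed minus_minus minus_zero singletonD singletonI)

lemma S_mult: "s \<in> S \<Longrightarrow> t \<in> S \<Longrightarrow> s \<otimes> t \<in> S"
  using T_mult Fx_mult S_subset by blast

lemma S_subgroup: "subgroup S (mult_of F)"
proof (rule U.subgroupI)
  show "S \<noteq> {}" using one_T by auto
  show "inv\<^bsub>mult_of F\<^esub> a \<in> S" if "a \<in> S" for a
  proof -
    have "a \<in> carrier (mult_of F)" using that S_subset by auto
    then show ?thesis using S_inv[OF that] by (simp only: m_inv_mult_of)
  qed
qed (use S_subset S_mult in auto)

lemma S_normal: "S \<lhd> mult_of F"
  by (rule U.subgroup_imp_normal[OF S_subgroup])

lemma cl_eqI: "s \<in> S \<Longrightarrow> b \<in> Fx \<Longrightarrow> cl (s \<otimes> b) = cl b"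
proof -
  assume s: "s \<in> S" and b: "b \<in> Fx"
  have "s \<otimes> b \<in> cl b" using s by (auto simp: r_coset_def)
  then show ?thesis
    using U.repr_independence[of "s \<otimes> b" S b] b S_subgroup by simp
qed

lemma cl_mem: "b \<in> cl a \<longleftrightarrow> (\<exists>s \<in> S. b = s \<otimes> a)"
  by (auto simp: r_coset_def)

lemma cl_self: "a \<in> Fx \<Longrightarrow> a \<in> cl a"
  unfolding cl_mem using one_T by (intro bexI[of _ \<one>]) auto

lemma cl_of_mem: "a \<in> cl b \<Longrightarrow> b \<in> Fx \<Longrightarrow> a \<in> Fx \<and> cl a = cl b"
proof -
  assume "a \<in> cl b" and b: "b \<in> Fx"
  then obtain s where s: "s \<in> S" "a = s \<otimes> b" unfolding cl_mem by blast
  have "s \<otimes> b \<in> Fx" by (rule Fx_mult[OF subsetD[OF S_subset s(1)] b])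
  then show ?thesis using cl_eqI[OF s(1) b] unfolding s(2) by blast
qed

end

text \<open>Interface between special groups and the comparison of K-theories: the underlying group
  is that of nonzero elements modulo \<open>S\<close>, and \<open>G_rep\<close> describes the
  classes represented by \<open>\<langle>1, b\<rangle>\<close> through nonzero elements of
  \<open>T + b T\<close>. It hides \<open>form_equiv\<close>, so isometry and preorderings are told
  apart only where this description is proved.\<close>

locale field_sgroup = square_semigroup F T for F :: "('a, 'm) ring_scheme" (structure) and T +
  fixes G :: "'a set sgroup"
  assumes G_carrier: "carrier G = carrier (mult_of F Mod (T - {\<zero>}))"
    and G_mult: "mult G = mult (mult_of F Mod (T - {\<zero>}))"
    and G_one: "one G = T - {\<zero>}"
    and G_minus_one: "minus_one G = (T - {\<zero>}) #>\<^bsub>mult_of F\<^esub> (\<ominus> \<one>)"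
    and G_rep: "b \<in> carrier F - {\<zero>} \<Longrightarrow> sg_rep G \<one>\<^bsub>G\<^esub> ((T - {\<zero>}) #>\<^bsub>mult_of F\<^esub> b) =
      {(T - {\<zero>}) #>\<^bsub>mult_of F\<^esub> c | c. c \<in> carrier F - {\<zero>} \<and> (\<exists>s \<in> T. \<exists>t \<in> T. c = s \<oplus> b \<otimes> t)}"
begin

lemma G_comm_group: "comm_group G"
proof -
  have Q: "comm_group (mult_of F Mod S)"
    by (rule U.abelian_FactGroup[OF S_subgroup])
  interpret Q: comm_group "mult_of F Mod S" by (rule Q)
  have one: "\<one>\<^bsub>mult_of F Mod S\<^esub> = \<one>\<^bsub>G\<^esub>" by (simp add: G_one FactGroup_def)
  show ?thesis
  proof (rule comm_groupI, unfold G_carrier G_mult one[symmetric])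
    fix x assume "x \<in> carrier (mult_of F Mod S)"
    then show "\<exists>y\<in>carrier (mult_of F Mod S). y \<otimes>\<^bsub>mult_of F Mod S\<^esub> x = \<one>\<^bsub>mult_of F Mod S\<^esub>"
      by (rule Q.l_inv_ex)
  qed (fact Q.m_closed Q.one_closed Q.m_assoc Q.m_comm Q.l_one)+
qed

sublocale G: comm_group G by (rule G_comm_group)

lemma cl_closed [simp]: "a \<in> Fx \<Longrightarrow> cl a \<in> carrier G"
  by (auto simp: G_carrier FactGroup_def RCOSETS_def)

lemma cl_cases:
  assumes "X \<in> carrier G"
  obtains a where "a \<in> Fx" "X = cl a"
  using assms by (auto simp: G_carrier FactGroup_def RCOSETS_def)

lemma cl_mult: "a \<in> Fx \<Longrightarrow> b \<in> Fx \<Longrightarrow> cl a \<otimes>\<^bsub>G\<^esub> cl b = cl (a \<otimes> b)"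
  using normal.rcos_sum[OF S_normal, of a b] by (simp add: G_mult FactGroup_def)

lemma cl_S: "a \<in> S \<Longrightarrow> cl a = \<one>\<^bsub>G\<^esub>"
  using U.coset_join2[OF _ S_subgroup, of a] S_subset by (auto simp: G_one)

lemma cl_one: "cl \<one> = \<one>\<^bsub>G\<^esub>"
  using cl_S one_T by simp

lemma cl_eq_one: "cl a = \<one>\<^bsub>G\<^esub> \<Longrightarrow> a \<in> Fx \<Longrightarrow> a \<in> S"
  using cl_self G_one by metis

lemma minus_one_closed: "minus_one G \<in> carrier G"
  unfolding G_minus_one using Fx_neg[of \<one>] by simp

lemma dm_relI:
  assumes "c \<in> Fx" "b \<in> Fx" "s \<in> T" "t \<in> T" "c = s \<oplus> b \<otimes> t"
  shows "(cl c, cl (c \<otimes> b)) \<in> dm_rels G"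
proof -
  have "cl c \<in> sg_rep G \<one>\<^bsub>G\<^esub> (cl b)" using G_rep[OF assms(2)] assms by auto
  moreover have "cl (c \<otimes> b) = cl c \<otimes>\<^bsub>G\<^esub> cl b" using assms cl_mult by simp
  ultimately show ?thesis using assms unfolding dm_rels_def by auto
qed

lemma dm_relE:
  assumes "(X, Y) \<in> dm_rels G"
  obtains c b s t where "c \<in> Fx" "b \<in> Fx" "s \<in> T" "t \<in> T" "c = s \<oplus> b \<otimes> t"
    "X = cl c" "Y = cl (c \<otimes> b)"
proof -
  obtain Z where Z: "X \<in> sg_rep G \<one>\<^bsub>G\<^esub> Z" "Z \<in> carrier G" "Y = X \<otimes>\<^bsub>G\<^esub> Z"
    using assms unfolding dm_rels_def by auto
  obtain b where b: "b \<in> Fx" "Z = cl b" using cl_cases[OF Z(2)] .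
  obtain c s t where c: "c \<in> Fx" "X = cl c" "s \<in> T" "t \<in> T" "c = s \<oplus> b \<otimes> t"
    using Z(1) unfolding b(2) G_rep[OF b(1)] by auto
  show ?thesis
    using that[OF c(1) b(1) c(3,4,5,2)] Z(3) c(1,2) b cl_mult by simp
qed

lemma dm_rels_closed: "dm_rels G \<subseteq> carrier G \<times> carrier G"
  unfolding dm_rels_def by auto

text \<open>With \<open>u = (a + 1)/2\<close> and \<open>v = (a - 1)/2\<close> one has
  \<open>a = u^2 - v^2\<close>, so the class of \<open>a\<close> lies in \<open>D(1, -1)\<close>,
  and the defining relation for the class of \<open>-1\<close> is the claim. Halving is where
  characteristic different from 2 enters.\<close>

lemma dm_neg:
  assumes "symbol_map G B (dm_rels G) \<tau>" "a \<in> Fx"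
  shows "\<tau> (cl a) \<otimes>\<^bsub>B\<^esub> \<tau> (cl (\<ominus> a)) = \<zero>\<^bsub>B\<^esub>"
proof -
  interpret \<tau>: symbol_map G B "dm_rels G" \<tau> by fact
  have a: "a \<in> carrier F" using assms by auto
  define h where "h = inv (\<one> \<oplus> \<one>)"
  have h: "h \<in> carrier F" "(\<one> \<oplus> \<one>) \<otimes> h = \<one>"
    using inv_nonzero[of "\<one> \<oplus> \<one>"] two by (auto simp: h_def)
  let ?u = "(a \<oplus> \<one>) \<otimes> h" and ?v = "(a \<ominus> \<one>) \<otimes> h"
  have uv: "?u \<in> carrier F" "?v \<in> carrier F" using a h by auto
  have "?u \<otimes> ?u \<oplus> \<ominus> \<one> \<otimes> (?v \<otimes> ?v) = a \<otimes> ((\<one> \<oplus> \<one>) \<otimes> h) \<otimes> ((\<one> \<oplus> \<one>) \<otimes> h)"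
    using a h(1) by algebra
  also have "\<dots> = a" using a by (simp add: h(2))
  finally have "(cl a, cl (a \<otimes> \<ominus> \<one>)) \<in> dm_rels G"
    using T_square uv Fx_neg[of \<one>] assms(2) by (intro dm_relI[of _ _ "?u \<otimes> ?u" "?v \<otimes> ?v"]) auto
  moreover have "a \<otimes> \<ominus> \<one> = \<ominus> a" using a by (simp add: r_minus)
  ultimately show ?thesis using \<tau>.map_rel by metis
qed

text \<open>Modulo squares \<open>-b\<close> is the product of \<open>c b\<close> and
  \<open>-c\<close>, so its symbol splits into two summands. The product of
  \<open>\<tau> (cl c)\<close> with the first vanishes by the defining relation, with the second by
  \<open>dm_neg\<close>.\<close>

lemma dm_steinberg:
  assumes "symbol_map G B (dm_rels G) \<tau>"
    and "c \<in> Fx" "b \<in> Fx" "s \<in> T" "t \<in> T" "c = s \<oplus> b \<otimes> t"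
  shows "\<tau> (cl c) \<otimes>\<^bsub>B\<^esub> \<tau> (cl (\<ominus> b)) = \<zero>\<^bsub>B\<^esub>"
proof -
  interpret \<tau>: symbol_map G B "dm_rels G" \<tau> by fact
  have F: "c \<in> carrier F" "b \<in> carrier F" using assms by auto
  have cc: "c \<otimes> c \<in> S" using T_square[OF F(1)] Fx_mult[OF assms(2,2)] by auto
  have "(c \<otimes> b) \<otimes> (\<ominus> c) = (c \<otimes> c) \<otimes> (\<ominus> b)" using F by algebra
  then have "cl (\<ominus> b) = cl (c \<otimes> b) \<otimes>\<^bsub>G\<^esub> cl (\<ominus> c)"
    using cl_eqI[OF cc Fx_neg[OF assms(3)]] cl_mult[OF Fx_mult Fx_neg, OF assms(2,3,2)] by simp
  then have "\<tau> (cl (\<ominus> b)) = \<tau> (cl (c \<otimes> b)) \<oplus>\<^bsub>B\<^esub> \<tau> (cl (\<ominus> c))"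
    using \<tau>.map_mult[OF cl_closed cl_closed, OF Fx_mult Fx_neg, OF assms(2,3,2)] by simp
  moreover have "\<tau> (cl c) \<otimes>\<^bsub>B\<^esub> \<tau> (cl (c \<otimes> b)) = \<zero>\<^bsub>B\<^esub>"
    by (rule \<tau>.map_rel[OF dm_relI[OF assms(2-6)]])
  ultimately show ?thesis
    using dm_neg[OF assms(1,2)] assms(2,3)
      \<tau>.closed[OF cl_closed] Fx_mult Fx_neg by (simp add: \<tau>.B.r_distr)
qed

text \<open>Multiplication by \<open>minus_one G\<close> takes the class of \<open>a\<close> to that
  of \<open>-a\<close>, so \<open>dm_neg\<close> is the hypothesis of
  \<open>commute_if_neg\<close>.\<close>

lemma dm_commute:
  assumes "symbol_map G B (dm_rels G) \<tau>" "X \<in> carrier G" "Y \<in> carrier G"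
  shows "\<tau> X \<otimes>\<^bsub>B\<^esub> \<tau> Y = \<tau> Y \<otimes>\<^bsub>B\<^esub> \<tau> X"
    and "\<tau> X \<otimes>\<^bsub>B\<^esub> \<tau> (minus_one G \<otimes>\<^bsub>G\<^esub> X) = \<zero>\<^bsub>B\<^esub>"
proof -
  interpret \<tau>: symbol_map G B "dm_rels G" \<tau> by fact
  have neg: "\<tau> Z \<otimes>\<^bsub>B\<^esub> \<tau> (minus_one G \<otimes>\<^bsub>G\<^esub> Z) = \<zero>\<^bsub>B\<^esub>" if Z: "Z \<in> carrier G" for Z
  proof -
    obtain a where a: "a \<in> Fx" "Z = cl a" using cl_cases[OF Z] .
    then have "minus_one G \<otimes>\<^bsub>G\<^esub> Z = cl (\<ominus> a)"
      using cl_mult[OF Fx_neg[of \<one>] a(1)] by (simp add: G_minus_one l_minus)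
    then show ?thesis using dm_neg[OF assms(1) a(1)] a(2) by simp
  qed
  show "\<tau> X \<otimes>\<^bsub>B\<^esub> \<tau> Y = \<tau> Y \<otimes>\<^bsub>B\<^esub> \<tau> X"
    by (rule \<tau>.commute_if_neg[OF minus_one_closed neg assms(2,3)])
  show "\<tau> X \<otimes>\<^bsub>B\<^esub> \<tau> (minus_one G \<otimes>\<^bsub>G\<^esub> X) = \<zero>\<^bsub>B\<^esub>" by (rule neg[OF assms(2)])
qed

text \<open>The Steinberg argument divides by \<open>s\<close> and needs \<open>t\<close> nonzero,
  which leaves two degenerate cases. For \<open>s = 0\<close> the symbols of \<open>c\<close> and
  \<open>b\<close> agree, so that of \<open>c b\<close> is zero; for \<open>t = 0\<close> the symbol
  of \<open>c = s\<close> is itself zero.\<close>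

lemma milnor_dm_rel:
  assumes "symbol_map (mult_of F) B P \<sigma>"
    and S: "\<And>s. s \<in> S \<Longrightarrow> \<sigma> s = \<zero>\<^bsub>B\<^esub>"
    and steinberg: "\<And>a. a \<in> carrier F \<Longrightarrow> a \<noteq> \<zero> \<Longrightarrow> a \<noteq> \<one> \<Longrightarrow> \<sigma> a \<otimes>\<^bsub>B\<^esub> \<sigma> (\<one> \<ominus> a) = \<zero>\<^bsub>B\<^esub>"
    and c: "c \<in> Fx" and b: "b \<in> Fx" and st: "s \<in> T" "t \<in> T" and eq: "c = s \<oplus> b \<otimes> t"
  shows "\<sigma> c \<otimes>\<^bsub>B\<^esub> \<sigma> (c \<otimes> b) = \<zero>\<^bsub>B\<^esub>"
proof -
  interpret \<sigma>: symbol_map "mult_of F" B P \<sigma> by fact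
  have \<sigma>_mult: "\<sigma> (x \<otimes> y) = \<sigma> x \<oplus>\<^bsub>B\<^esub> \<sigma> y" if "x \<in> Fx" "y \<in> Fx" for x y
    using \<sigma>.map_mult[of x y] that by simp
  have \<sigma>_closed: "\<sigma> x \<in> carrier B" if "x \<in> Fx" for x
    using \<sigma>.closed[of x] that by simp
  have F: "c \<in> carrier F" "b \<in> carrier F" "s \<in> carrier F" "t \<in> carrier F"
    using c b st T_closed by auto
  note cB = \<sigma>_closed[OF c] and bB = \<sigma>_closed[OF b]
  consider "s = \<zero>" | "t = \<zero>" | "s \<in> S" "t \<in> S" using st by auto
  then show ?thesis
  proof cases
    case 1
    then have "c = b \<otimes> t" using eq F by simp
    moreover from this have t: "t \<in> S" using st c F by auto
    ultimately have "\<sigma> c = \<sigma> b"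
      using \<sigma>_mult[OF b] S[OF t] S_subset bB by auto
    then have "\<sigma> (c \<otimes> b) = \<zero>\<^bsub>B\<^esub>" using \<sigma>_mult[OF c b] bB by simp
    then show ?thesis using cB by simp
  next
    case 2
    then have "c = s" using eq F by simp
    then have "\<sigma> c = \<zero>\<^bsub>B\<^esub>" using S st c by auto
    then show ?thesis using \<sigma>_closed[OF Fx_mult[OF c b]] by simp
  next
    case 3
    have sF: "s \<in> Fx" "t \<in> Fx" using 3 S_subset by auto
    have i: "inv s \<in> Fx" "inv s \<in> S" "s \<otimes> inv s = \<one>"
      using Fx_inv[OF sF(1)] S_inv[OF 3(1)] inv_nonzero[of s] sF by auto
    define u where "u = c \<otimes> inv s"
    define w where "w = \<ominus> b \<otimes> (t \<otimes> inv s)"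
    have uw: "u \<in> Fx" "w \<in> Fx"
      unfolding u_def w_def
      by (rule Fx_mult[OF c i(1)], rule Fx_mult[OF Fx_neg[OF b] Fx_mult[OF sF(2) i(1)]])
    have "u = s \<otimes> inv s \<oplus> b \<otimes> (t \<otimes> inv s)"
      unfolding u_def eq using F i(1) by (simp add: l_distr m_assoc)
    then have u: "u = \<one> \<ominus> w" unfolding w_def i(3) using F i(1) by (simp add: a_minus_def l_minus)
    have "w \<in> carrier F" using uw(2) by simp
    then have w: "w = \<one> \<ominus> u" unfolding u by algebra
    have "u \<noteq> \<one>"
    proof
      assume "u = \<one>"
      then have "w = \<zero>" using w by (simp add: a_minus_def r_neg)
      with uw show False by simp
    qed
    then have "\<sigma> u \<otimes>\<^bsub>B\<^esub> \<sigma> w = \<zero>\<^bsub>B\<^esub>"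
      unfolding w using steinberg uw by auto
    moreover have "\<sigma> u = \<sigma> c"
      unfolding u_def using \<sigma>_mult[OF c i(1)] S[OF i(2)] cB by simp
    moreover have "\<sigma> w = \<sigma> (\<ominus> b)"
      unfolding w_def
      using \<sigma>_mult[OF Fx_neg[OF b] Fx_mult[OF sF(2) i(1)]] S[OF S_mult[OF 3(2) i(2)]]
        \<sigma>_closed[OF Fx_neg[OF b]] by simp
    ultimately have 1: "\<sigma> c \<otimes>\<^bsub>B\<^esub> \<sigma> (\<ominus> b) = \<zero>\<^bsub>B\<^esub>" by simp
    have 2: "\<sigma> c \<otimes>\<^bsub>B\<^esub> \<sigma> (\<ominus> c) = \<zero>\<^bsub>B\<^esub>"
      by (rule milnor_neg[OF assms(1) steinberg F(1)]) (use c in auto)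
    \<comment> \<open>This splits the symbol of \<open>c b\<close> into that of \<open>-c\<close>,
      handled by \<open>milnor_neg\<close>, and that of \<open>-b\<close>, handled by the Steinberg
      product.\<close>
    have "c \<otimes> b = \<ominus> c \<otimes> \<ominus> b" using F by algebra
    then have "\<sigma> (c \<otimes> b) = \<sigma> (\<ominus> c) \<oplus>\<^bsub>B\<^esub> \<sigma> (\<ominus> b)"
      using \<sigma>_mult[OF Fx_neg[OF c] Fx_neg[OF b]] by simp
    then show ?thesis
      using 1 2 cB \<sigma>_closed[OF Fx_neg[OF c]] \<sigma>_closed[OF Fx_neg[OF b]]
      by (simp add: \<sigma>.B.r_distr)
  qed
qed

end

section \<open>Comparison of the integral theories with \<open>k_dm\<close>\<close>

context field_sgroup
begin

lemma cl_hom: "cl \<in> hom (mult_of F) G"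
  using cl_mult cl_closed by (simp add: hom_def)

lemma one_minus_Fx: "a \<in> Fx \<Longrightarrow> a \<noteq> \<one> \<Longrightarrow> \<one> \<ominus> a \<in> Fx"
  by (auto simp: r_right_minus_eq)

text \<open>The witnesses are \<open>s = t = 1\<close>. The set \<open>V\<close> will be
  \<open>T\<close> for Milnor K-theory and for \<open>M(G)\<close>, and \<open>S\<close> for the
  quotient hyperfield, where coefficients are nonzero.\<close>

lemma one_minus_rep:
  assumes "x \<in> Fx" "x \<noteq> \<one>" "\<one> \<in> V"
  shows "\<exists>c\<in>Fx. \<exists>s\<in>V. \<exists>t\<in>V. cl (\<one> \<ominus> x) = cl c \<and> c = s \<oplus> \<ominus> x \<otimes> t"
proof (rule bexI[OF _ one_minus_Fx[OF assms(1,2)]], rule bexI[OF _ assms(3)], rule bexI[OF _ assms(3)])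
  show "cl (\<one> \<ominus> x) = cl (\<one> \<ominus> x) \<and> \<one> \<ominus> x = \<one> \<oplus> \<ominus> x \<otimes> \<one>"
    using assms(1) by (simp add: a_minus_def)
qed

lemma cl_image: "cl ` Fx = carrier G"
proof
  show "cl ` Fx \<subseteq> carrier G" using cl_closed by blast
  show "carrier G \<subseteq> cl ` Fx"
  proof
    fix X assume "X \<in> carrier G"
    then obtain a where "a \<in> Fx" "X = cl a" by (rule cl_cases)
    then show "X \<in> cl ` Fx" by (rule rev_image_eqI)
  qed
qed

text \<open>Template for all five isomorphisms. \<open>rel\<close> makes every relation upstairs
  hold in \<open>k_dm\<close>, \<open>steinberg\<close> ensures that there are enough relations
  upstairs, and \<open>lift_one\<close> lets symbols upstairs descend along \<open>q\<close>.
  Elements with \<open>cl x\<close> trivial are exempt in \<open>steinberg\<close>, because the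
  relations of a hyperfield leave out the element one.\<close>

lemma k_dm_iso:
  fixes A :: "('x, 'n) monoid_scheme"
  assumes A: "comm_group A" and P: "P \<subseteq> carrier A \<times> carrier A"
    and q: "q \<in> hom A G" "q ` carrier A = carrier G"
    and e: "e \<in> carrier A" "q e = minus_one G"
    and rel: "\<And>a b. (a, b) \<in> P \<Longrightarrow> \<exists>x\<in>Fx. \<exists>c\<in>Fx. \<exists>s\<in>T. \<exists>t\<in>T.
      q a = cl x \<and> q b = cl c \<and> c = s \<oplus> \<ominus> x \<otimes> t"
    and steinberg: "\<And>x. x \<in> Fx \<Longrightarrow> x \<noteq> \<one> \<Longrightarrow> cl x \<noteq> \<one>\<^bsub>G\<^esub> \<Longrightarrow>
      \<exists>(a, b)\<in>P. q a = cl x \<and> q b = cl (\<one> \<ominus> x)"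
    and lift_one: "\<And>(B :: ('x list \<Rightarrow> int) set set set ring) \<sigma> a. symbol_map A B P \<sigma> \<Longrightarrow>
      a \<in> carrier A \<Longrightarrow> q a = \<one>\<^bsub>G\<^esub> \<Longrightarrow> \<sigma> a = \<zero>\<^bsub>B\<^esub>"
  shows "igr_iso (k_dm G) (igr_mod2 (tensor_quot \<Z> (power_module A) (symbol_rels \<Z> A P) e))"
proof -
  interpret A: comm_group A by (rule A)
  have pA: "symbol_presentation A \<Z> P"
    using A P by (simp add: symbol_presentation_def symbol_presentation_axioms_def)
  have pG: "symbol_presentation G (residue_ring 2) (dm_rels G)"
    using G_comm_group dm_rels_closed
    by (simp add: symbol_presentation_def symbol_presentation_axioms_def)
  note symb = symbol_presentation.symbol_symbol_map[OF pG refl]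
  have "igr_iso (igr_mod2 (tensor_quot \<Z> (power_module A) (symbol_rels \<Z> A P) e))
    (tensor_quot (residue_ring 2) (power_module G)
      (symbol_rels (residue_ring 2) G (dm_rels G)) (q e))"
  proof (rule symbol_mod2_iso[OF pA pG q e(1)])
    fix a b assume "(a, b) \<in> P"
    then obtain x c s t where x: "x \<in> Fx" "c \<in> Fx" "s \<in> T" "t \<in> T" "q a = cl x" "q b = cl c"
        "c = s \<oplus> \<ominus> x \<otimes> t"
      using rel by blast
    \<comment> \<open>The pair in \<open>P\<close> has \<open>x\<close> first and \<open>c\<close>
      second, the reverse of what \<open>dm_steinberg\<close> gives for \<open>b = -x\<close>;
      commutativity swaps the factors.\<close>
    have "\<ominus> (\<ominus> x) = x" using x(1) by simp
    then show "symbol (residue_ring 2) G (dm_rels G) (q a)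
        \<otimes>\<^bsub>symbol_ring (residue_ring 2) G (dm_rels G)\<^esub> symbol (residue_ring 2) G (dm_rels G) (q b)
      = \<zero>\<^bsub>symbol_ring (residue_ring 2) G (dm_rels G)\<^esub>"
      using dm_steinberg[OF symb x(2) Fx_neg[OF x(1)] x(3,4,7)]
        dm_commute(1)[OF symb cl_closed[OF x(1)] cl_closed[OF x(2)]] x(5,6) by simp
  next
    fix X assume "X \<in> carrier G"
    then show "symbol (residue_ring 2) G (dm_rels G) X
        \<otimes>\<^bsub>symbol_ring (residue_ring 2) G (dm_rels G)\<^esub>
        symbol (residue_ring 2) G (dm_rels G) (q e \<otimes>\<^bsub>G\<^esub> X)
      = \<zero>\<^bsub>symbol_ring (residue_ring 2) G (dm_rels G)\<^esub>"
      unfolding e(2) by (rule dm_commute(2)[OF symb]) (rule minus_one_closed)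
  next
    fix B :: "('x list \<Rightarrow> int) set set set ring" and \<sigma> a b
    assume \<sigma>: "symbol_map A B P \<sigma>" and ab: "a \<in> carrier A" "b \<in> carrier A" "(q a, q b) \<in> dm_rels G"
    interpret \<sigma>: symbol_map A B P \<sigma> by (rule \<sigma>)
    note cong = \<sigma>.map_cong[OF G.is_group q(1) lift_one[OF \<sigma>]]
    \<comment> \<open>The symbol is pulled back to elements of the field through preimages under
      \<open>q\<close>, so that the field computation \<open>milnor_dm_rel\<close> applies whatever
      \<open>A\<close> is.\<close>
    define \<tau> where "\<tau> x = \<sigma> (SOME a. a \<in> carrier A \<and> q a = cl x)" for x
    have \<tau>: "\<tau> x = \<sigma> a" if "a \<in> carrier A" "q a = cl x" for x a
    proof -
      have "(SOME a. a \<in> carrier A \<and> q a = cl x) \<in> carrier A \<and>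
          q (SOME a. a \<in> carrier A \<and> q a = cl x) = cl x"
        by (rule someI[of "\<lambda>a. a \<in> carrier A \<and> q a = cl x"]) (use that in simp)
      then show ?thesis unfolding \<tau>_def using that by (intro cong) auto
    qed
    have lift: "\<exists>a \<in> carrier A. q a = cl x" if "x \<in> Fx" for x
    proof -
      have "cl x \<in> q ` carrier A" unfolding q(2) by (rule cl_closed[OF that])
      then show ?thesis by (auto elim!: imageE simp: eq_commute)
    qed
    have \<tau>_one: "\<tau> x = \<zero>\<^bsub>B\<^esub>" if "x \<in> Fx" "cl x = \<one>\<^bsub>G\<^esub>" for x
    proof -
      obtain a where a: "a \<in> carrier A" "q a = cl x" using lift[OF \<open>x \<in> Fx\<close>] by blast
      show ?thesis unfolding \<tau>[OF a] by (rule lift_one[OF \<sigma> a(1)]) (simp only: a(2) that(2))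
    qed
    \<comment> \<open>The relation set is empty here: the Steinberg relations of
      \<open>\<tau>\<close> follow separately, with a case distinction.\<close>
    have \<tau>_map: "symbol_map (mult_of F) B {} \<tau>"
    proof (intro symbol_map.intro symbol_map_axioms.intro)
      fix x assume "x \<in> carrier (mult_of F)"
      then obtain a where "a \<in> carrier A" "q a = cl x" using lift[of x] by auto
      then show "\<tau> x \<in> carrier B" using \<tau> by simp
    next
      fix x y assume xy: "x \<in> carrier (mult_of F)" "y \<in> carrier (mult_of F)"
      then obtain a b where ab: "a \<in> carrier A" "q a = cl x" "b \<in> carrier A" "q b = cl y"
        using lift[of x] lift[of y] by auto
      have "q (a \<otimes>\<^bsub>A\<^esub> b) = cl (x \<otimes> y)"
        using hom_mult[OF q(1) ab(1,3)] ab(2,4) xy cl_mult by simp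
      then have "\<tau> (x \<otimes> y) = \<sigma> (a \<otimes>\<^bsub>A\<^esub> b)" using ab by (intro \<tau>) auto
      then show "\<tau> (x \<otimes>\<^bsub>mult_of F\<^esub> y) = \<tau> x \<oplus>\<^bsub>B\<^esub> \<tau> y"
        using ab by (simp add: \<tau>[OF ab(1,2)] \<tau>[OF ab(3,4)] \<sigma>.map_mult)
    qed (auto intro: mult_of_comm_group \<sigma>.B.ring_axioms \<sigma>.two)
    have \<tau>_closed: "\<tau> x \<in> carrier B" if "x \<in> Fx" for x
      using symbol_map.closed[OF \<tau>_map, of x] that by simp
    have \<tau>_steinberg: "\<tau> x \<otimes>\<^bsub>B\<^esub> \<tau> (\<one> \<ominus> x) = \<zero>\<^bsub>B\<^esub>"
      if x: "x \<in> carrier F" "x \<noteq> \<zero>" "x \<noteq> \<one>" for x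
    proof -
      have xF: "x \<in> Fx" using x by simp
      show ?thesis
      proof (cases "cl x = \<one>\<^bsub>G\<^esub>")
        \<comment> \<open>The symbol of \<open>x\<close> is itself zero, which makes up for the
          exempted relation.\<close>
        case True
        then show ?thesis
          using \<tau>_one[OF xF] \<tau>_closed[OF one_minus_Fx[OF xF x(3)]] by simp
      next
        case False
        obtain a b where ab: "(a, b) \<in> P" "q a = cl x" "q b = cl (\<one> \<ominus> x)"
          using steinberg[OF xF x(3) False] by blast
        then have "a \<in> carrier A" "b \<in> carrier A" using P by auto
        then show ?thesis using \<tau> ab \<sigma>.map_rel[OF ab(1)] by simp
      qed
    qed
    obtain c x s t where cx: "c \<in> Fx" "x \<in> Fx" "s \<in> T" "t \<in> T" "c = s \<oplus> x \<otimes> t"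
        "q a = cl c" "q b = cl (c \<otimes> x)"
      using dm_relE[OF ab(3)] .
    have "\<tau> c \<otimes>\<^bsub>B\<^esub> \<tau> (c \<otimes> x) = \<zero>\<^bsub>B\<^esub>"
    proof (rule milnor_dm_rel[OF \<tau>_map _ \<tau>_steinberg cx(1-5)])
      show "\<tau> s = \<zero>\<^bsub>B\<^esub>" if "s \<in> S" for s
        by (rule \<tau>_one[OF subsetD[OF S_subset that] cl_S[OF that]])
    qed
    then show "\<sigma> a \<otimes>\<^bsub>B\<^esub> \<sigma> b = \<zero>\<^bsub>B\<^esub>"
      by (simp only: \<tau>[OF ab(1) cx(6)] \<tau>[OF ab(2) cx(7)])
  qed (rule lift_one)
  then show ?thesis unfolding k_dm_tensor_quot e(2)[symmetric] by (rule igr_iso_sym)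
qed

text \<open>By the choice of \<open>T\<close> the kernel of \<open>cl\<close> consists of the
  nonzero squares, on which symbols in characteristic 2 vanish. The Steinberg pairs are the
  relations themselves.\<close>

lemma k_mil_iso:
  assumes T: "T = {x \<otimes> x | x. x \<in> carrier F}"
  shows "igr_iso (k_dm G) (k_mil F)"
  unfolding k_mil_tensor_quot
proof (rule k_dm_iso[where q = cl])
  show "mil_rels F \<subseteq> carrier (mult_of F) \<times> carrier (mult_of F)"
    using one_minus_Fx by (auto simp: mil_rels_def)
  show "cl ` carrier (mult_of F) = carrier G"
    using cl_image by simp
  show "\<ominus> \<one> \<in> carrier (mult_of F)" using Fx_neg[of \<one>] by simp
  show "cl (\<ominus> \<one>) = minus_one G" by (rule G_minus_one[symmetric])
next
  fix a b assume "(a, b) \<in> mil_rels F"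
  then have a: "a \<in> Fx" "a \<noteq> \<one>" "b = \<one> \<ominus> a" by (auto simp: mil_rels_def)
  show "\<exists>x\<in>Fx. \<exists>c\<in>Fx. \<exists>s\<in>T. \<exists>t\<in>T. cl a = cl x \<and> cl b = cl c \<and> c = s \<oplus> \<ominus> x \<otimes> t"
    by (rule bexI[OF _ a(1)]) (use one_minus_rep[OF a(1,2) one_T] in \<open>simp add: a(3)\<close>)
next
  fix x assume "x \<in> Fx" "x \<noteq> \<one>"
  then show "\<exists>(a, b)\<in>mil_rels F. cl a = cl x \<and> cl b = cl (\<one> \<ominus> x)"
    by (intro bexI[of _ "(x, \<one> \<ominus> x)"]) (auto simp: mil_rels_def)
next
  fix B :: "('a list \<Rightarrow> int) set set set ring" and \<sigma> a
  assume \<sigma>: "symbol_map (mult_of F) B (mil_rels F) \<sigma>"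
    and a: "a \<in> carrier (mult_of F)" "cl a = \<one>\<^bsub>G\<^esub>"
  have "a \<in> S" using cl_eq_one[OF a(2)] a(1) by simp
  then obtain x where x: "x \<in> carrier F" "a = x \<otimes> x" "a \<noteq> \<zero>" using T by auto
  then have "x \<in> carrier (mult_of F)" by auto
  then show "\<sigma> a = \<zero>\<^bsub>B\<^esub>" using symbol_map.map_square[OF \<sigma>, of x] x(2) by simp
qed (rule mult_of_comm_group, rule cl_hom)

section \<open>The hyperfield of a special group\<close>

lemma sg_hyperfield_simps:
  "carrier (hmult_of (sg_hyperfield G)) = Some ` carrier G"
  "Some X \<otimes>\<^bsub>hmult_of (sg_hyperfield G)\<^esub> Some Y = Some (X \<otimes>\<^bsub>G\<^esub> Y)"
  "\<one>\<^bsub>hmult_of (sg_hyperfield G)\<^esub> = Some \<one>\<^bsub>G\<^esub>"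
  by (auto simp: hmult_of_def sg_hyperfield_def)

lemma cl_neg: "x \<in> Fx \<Longrightarrow> minus_one G \<otimes>\<^bsub>G\<^esub> cl x = cl (\<ominus> x)"
  using cl_mult[OF Fx_neg[of \<one>], of x] by (simp add: G_minus_one l_minus)

text \<open>For a nonzero \<open>a\<close>, the clause of \<open>sg_hyperfield\<close> in which
  \<open>1 + (-a)\<close> is the whole hyperfield occurs exactly when \<open>a\<close> is one. As
  \<open>mult_rels\<close> excludes this, the sum is \<open>D(1, -a)\<close> and
  \<open>G_rep\<close> applies.\<close>

lemma sg_hyperfield_rel_iff:
  assumes "x \<in> Fx"
  shows "(Some (cl x), b) \<in> mult_rels (sg_hyperfield G) \<longleftrightarrow>
    cl x \<noteq> \<one>\<^bsub>G\<^esub> \<and> (\<exists>c\<in>Fx. \<exists>s\<in>T. \<exists>t\<in>T. b = Some (cl c) \<and> c = s \<oplus> \<ominus> x \<otimes> t)"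
proof -
  have "minus_one G \<otimes>\<^bsub>G\<^esub> cl x = minus_one G \<otimes>\<^bsub>G\<^esub> \<one>\<^bsub>G\<^esub> \<longleftrightarrow> cl x = \<one>\<^bsub>G\<^esub>"
    by (rule G.Units_l_cancel) (use assms minus_one_closed cl_closed[OF assms] in \<open>simp_all add: G.Units_eq\<close>)
  then have "(Some (cl x), b) \<in> mult_rels (sg_hyperfield G) \<longleftrightarrow>
      cl x \<noteq> \<one>\<^bsub>G\<^esub> \<and> b \<in> Some ` sg_rep G \<one>\<^bsub>G\<^esub> (minus_one G \<otimes>\<^bsub>G\<^esub> cl x)"
    using cl_closed[OF assms] by (auto simp: mult_rels_def sg_hyperfield_def sg_neg_def)
  then show ?thesis
    unfolding cl_neg[OF assms] G_rep[OF Fx_neg[OF assms]] by blast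
qed

text \<open>\<open>the\<close> identifies the nonzero elements of \<open>M(G)\<close> with
  \<open>G\<close>, so the kernel is trivial and the comparison reduces to the relations.\<close>

lemma k_mult_sg_hyperfield_iso: "igr_iso (k_dm G) (k_mult (sg_hyperfield G))"
  unfolding k_mult_tensor_quot
proof (rule k_dm_iso[where q = the])
  let ?A = "hmult_of (sg_hyperfield G)" and ?P = "mult_rels (sg_hyperfield G)"
  show "comm_group ?A"
  proof (rule comm_groupI)
    fix x assume "x \<in> carrier ?A"
    then obtain X where "X \<in> carrier G" "x = Some X" by (auto simp: sg_hyperfield_simps)
    then show "\<exists>y\<in>carrier ?A. y \<otimes>\<^bsub>?A\<^esub> x = \<one>\<^bsub>?A\<^esub>"
      using G.l_inv_ex[of X] by (auto simp: sg_hyperfield_simps)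
  qed (auto simp: sg_hyperfield_simps G.m_ac)
  have rel_cases: "\<exists>x\<in>Fx. \<exists>c\<in>Fx. \<exists>s\<in>T. \<exists>t\<in>T.
      a = Some (cl x) \<and> b = Some (cl c) \<and> c = s \<oplus> \<ominus> x \<otimes> t" if ab: "(a, b) \<in> ?P" for a b
  proof -
    have "a \<in> Some ` carrier G" using ab by (auto simp: mult_rels_def sg_hyperfield_def)
    then obtain X where X: "X \<in> carrier G" "a = Some X" by auto
    obtain x where x: "x \<in> Fx" "X = cl x" using cl_cases[OF X(1)] .
    then show ?thesis using ab sg_hyperfield_rel_iff[OF x(1)] X(2) by blast
  qed
  show "?P \<subseteq> carrier ?A \<times> carrier ?A"
    using rel_cases by (fastforce simp: sg_hyperfield_simps)
  show "the \<in> hom ?A G" "the ` carrier ?A = carrier G"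
    by (auto simp: hom_def sg_hyperfield_simps image_image)
  show "hneg (sg_hyperfield G) \<one>\<^bsub>sg_hyperfield G\<^esub> \<in> carrier ?A"
    "the (hneg (sg_hyperfield G) \<one>\<^bsub>sg_hyperfield G\<^esub>) = minus_one G"
    using minus_one_closed
    by (auto simp: sg_hyperfield_simps, auto simp: sg_hyperfield_def sg_neg_def)
  show "\<exists>x\<in>Fx. \<exists>c\<in>Fx. \<exists>s\<in>T. \<exists>t\<in>T. the a = cl x \<and> the b = cl c \<and> c = s \<oplus> \<ominus> x \<otimes> t"
    if "(a, b) \<in> ?P" for a b
    using rel_cases[OF that] by force
  show "\<exists>(a, b)\<in>?P. the a = cl x \<and> the b = cl (\<one> \<ominus> x)"
    if x: "x \<in> Fx" "x \<noteq> \<one>" "cl x \<noteq> \<one>\<^bsub>G\<^esub>" for x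
  proof -
    have "(Some (cl x), Some (cl (\<one> \<ominus> x))) \<in> ?P"
      unfolding sg_hyperfield_rel_iff[OF x(1)] option.inject
      by (rule conjI[OF x(3) one_minus_rep[OF x(1,2) one_T]])
    then show ?thesis by force
  qed
  show "\<sigma> a = \<zero>\<^bsub>B\<^esub>" if \<sigma>: "symbol_map ?A B ?P \<sigma>" and a: "a \<in> carrier ?A" "the a = \<one>\<^bsub>G\<^esub>"
    for B :: "('a set option list \<Rightarrow> int) set set set ring" and \<sigma> a
  proof -
    obtain X where "a = Some X" using a(1) unfolding sg_hyperfield_simps by blast
    then have "a = \<one>\<^bsub>?A\<^esub>" using a(2) unfolding sg_hyperfield_simps by simp
    then show ?thesis using symbol_map.map_one[OF \<sigma>] by simp
  qed
qed

section \<open>The quotient hyperfield of a field\<close>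

abbreviation "MQ \<equiv> mquot (multiring_of F) S"

text \<open>\<open>S\<close> is a group, so \<open>a s = b t\<close> can be solved as
  \<open>b = (s/t) a\<close>; the equivalence of the multiring quotient is that of cosets.\<close>

lemma mclass_cl:
  assumes "a \<in> Fx"
  shows "mclass (multiring_of F) S a = cl a"
proof
  show "mclass (multiring_of F) S a \<subseteq> cl a"
  proof
    fix b assume "b \<in> mclass (multiring_of F) S a"
    then obtain s t where *: "b \<in> carrier F" "s \<in> S" "t \<in> S" "a \<otimes> s = b \<otimes> t"
      by (auto simp: mclass_def multiring_of_def)
    then have st: "s \<in> carrier F" "t \<in> Fx" using S_subset by auto
    have t: "inv t \<in> carrier F" "t \<otimes> inv t = \<one>" using inv_nonzero[of t] st by auto
    have "b = b \<otimes> t \<otimes> inv t" using * st t by (simp add: m_assoc)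
    also have "\<dots> = (s \<otimes> inv t) \<otimes> a"
      unfolding *(4)[symmetric] using assms st t by (simp add: m_ac)
    finally show "b \<in> cl a"
      unfolding cl_mem using S_mult[OF *(2) S_inv[OF *(3)]] by blast
  qed
  show "cl a \<subseteq> mclass (multiring_of F) S a"
  proof
    fix b assume "b \<in> cl a"
    then obtain s where s: "s \<in> S" "b = s \<otimes> a" unfolding cl_mem by blast
    have sF: "s \<in> carrier F" using s T_closed by auto
    have "a \<otimes> s = b \<otimes> \<one>" "b \<in> carrier F" using s(2) sF assms by (auto simp: m_comm)
    moreover have "\<one> \<in> S" using one_T by simp
    ultimately show "b \<in> mclass (multiring_of F) S a"
      using s(1) unfolding mclass_def multiring_of_def
      by (simp, intro bexI[of _ s] bexI[of _ \<one>]) simp_all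
  qed
qed

lemma mclass_zero: "mclass (multiring_of F) S \<zero> = {\<zero>}"
proof -
  have "b = \<zero>" if "b \<in> carrier F" "s \<in> S" "t \<in> S" "\<zero> \<otimes> s = b \<otimes> t" for b s t
  proof -
    have "s \<in> carrier F" "t \<in> Fx" using that S_subset by auto
    then show ?thesis using that integral[of b t] by auto
  qed
  moreover have "\<exists>s\<in>S. \<exists>t\<in>S. \<zero> \<otimes> s = \<zero> \<otimes> t"
    using one_T by (intro bexI[of _ \<one>]) auto
  ultimately show ?thesis unfolding mclass_def multiring_of_def by auto
qed

lemma zero_notin: "{\<zero>} \<notin> carrier G"
proof
  assume "{\<zero>} \<in> carrier G"
  then obtain a where "a \<in> Fx" "{\<zero>} = cl a" using cl_cases by blast
  then show False using cl_self[of a] by auto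
qed

lemma MQ_carrier: "carrier MQ = insert {\<zero>} (carrier G)"
proof -
  have "carrier MQ = mclass (multiring_of F) S ` insert \<zero> Fx"
    by (auto simp: mquot_def multiring_of_def)
  also have "\<dots> = insert {\<zero>} (cl ` Fx)"
    by (simp only: image_insert mclass_zero image_cong[OF refl mclass_cl])
  also have "cl ` Fx = carrier G" by (rule cl_image)
  finally show ?thesis .
qed

lemma MQ_zero: "hzero MQ = {\<zero>}"
  using mclass_zero by (simp add: mquot_def multiring_of_def)

lemma MQ_one: "\<one>\<^bsub>MQ\<^esub> = \<one>\<^bsub>G\<^esub>"
  using mclass_cl[of \<one>] cl_one by (simp add: mquot_def multiring_of_def)

lemma MQ_mult:
  assumes "X \<in> carrier G" "Y \<in> carrier G"
  shows "X \<otimes>\<^bsub>MQ\<^esub> Y = X \<otimes>\<^bsub>G\<^esub> Y"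
proof -
  obtain x where x: "x \<in> Fx" "X = cl x" using cl_cases[OF assms(1)] .
  obtain y where y: "y \<in> Fx" "Y = cl y" using cl_cases[OF assms(2)] .
  have "mclass (multiring_of F) S (a \<otimes> b) = X \<otimes>\<^bsub>G\<^esub> Y" if "a \<in> X" "b \<in> Y" for a b
  proof -
    have a: "a \<in> Fx \<and> cl a = X" using cl_of_mem[OF _ x(1)] that(1) unfolding x(2) .
    have b: "b \<in> Fx \<and> cl b = Y" using cl_of_mem[OF _ y(1)] that(2) unfolding y(2) .
    show ?thesis
      using mclass_cl[OF Fx_mult] cl_mult[of a b] a b by simp
  qed
  moreover have "x \<in> X" "y \<in> Y" using x y cl_self by auto
  ultimately have "(\<Union>a\<in>X. \<Union>b\<in>Y. mclass (multiring_of F) S (a \<otimes> b)) = X \<otimes>\<^bsub>G\<^esub> Y"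
    by blast
  then show ?thesis by (simp add: mquot_def multiring_of_def)
qed

lemma MQ_neg:
  assumes "x \<in> Fx"
  shows "hneg MQ (cl x) = cl (\<ominus> x)"
proof -
  have "mclass (multiring_of F) S (\<ominus> a) = cl (\<ominus> x)" if a: "a \<in> cl x" for a
  proof -
    obtain s where s: "s \<in> S" "a = s \<otimes> x" using a unfolding cl_mem by blast
    have aF: "a \<in> Fx" using cl_of_mem[OF a assms] by simp
    have "\<ominus> a = s \<otimes> \<ominus> x" using s T_closed assms by (auto simp: r_minus)
    then show ?thesis
      using mclass_cl[OF Fx_neg[OF aF]] cl_eqI[OF s(1) Fx_neg[OF assms]] by simp
  qed
  then have "(\<Union>a\<in>cl x. mclass (multiring_of F) S (\<ominus> a)) = cl (\<ominus> x)"
    using cl_self[OF assms] by blast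
  then show ?thesis by (simp add: mquot_def multiring_of_def)
qed

text \<open>The sum of classes allows factors from \<open>S\<close> on the summands and on the
  result; dividing by \<open>v\<close> brings the condition to \<open>c = s - x t\<close> with
  nonzero \<open>s\<close> and \<open>t\<close>. Compared with \<open>M(G)\<close>, representations
  with a zero coefficient are absent.\<close>

lemma MQ_rel_iff:
  assumes x: "x \<in> Fx"
  shows "(cl x, Y) \<in> mult_rels MQ \<longleftrightarrow>
    cl x \<noteq> \<one>\<^bsub>G\<^esub> \<and> (\<exists>c\<in>Fx. \<exists>s\<in>S. \<exists>t\<in>S. Y = cl c \<and> c = s \<oplus> \<ominus> x \<otimes> t)"
proof -
  have mem: "(cl x, Y) \<in> mult_rels MQ \<longleftrightarrow> cl x \<noteq> \<one>\<^bsub>G\<^esub> \<and>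
      (\<exists>c a b s t v. Y = mclass (multiring_of F) S c \<and> c \<in> carrier F \<and> a \<in> S \<and> b \<in> cl (\<ominus> x) \<and>
        s \<in> S \<and> t \<in> S \<and> v \<in> S \<and> c \<otimes> v = a \<otimes> s \<oplus> b \<otimes> t)"
  proof -
    have "hadd MQ \<one>\<^bsub>G\<^esub> (cl (\<ominus> x)) = {mclass (multiring_of F) S c | c a b s t v.
        c \<in> carrier F \<and> a \<in> S \<and> b \<in> cl (\<ominus> x) \<and> s \<in> S \<and> t \<in> S \<and> v \<in> S \<and>
        c \<otimes> v = a \<otimes> s \<oplus> b \<otimes> t}"
      by (simp add: mquot_def multiring_of_def G_one)
    moreover have "cl x \<in> carrier MQ - {hzero MQ, \<one>\<^bsub>MQ\<^esub>} \<longleftrightarrow> cl x \<noteq> \<one>\<^bsub>G\<^esub>"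
      using cl_closed[OF x] zero_notin unfolding MQ_carrier MQ_zero MQ_one by auto
    ultimately show ?thesis
      unfolding mult_rels_def MQ_one by (simp add: MQ_neg[OF x]) blast
  qed
  show ?thesis
  proof
    assume "(cl x, Y) \<in> mult_rels MQ"
    then obtain c a b s t v where ne: "cl x \<noteq> \<one>\<^bsub>G\<^esub>" and Y: "Y = mclass (multiring_of F) S c"
      and c: "c \<in> carrier F" and abst: "a \<in> S" "b \<in> cl (\<ominus> x)" "s \<in> S" "t \<in> S" "v \<in> S"
      and eq: "c \<otimes> v = a \<otimes> s \<oplus> b \<otimes> t"
      unfolding mem by blast
    obtain r where r: "r \<in> S" "b = r \<otimes> \<ominus> x" using abst(2) unfolding cl_mem by blast
    have F: "a \<in> carrier F" "s \<in> carrier F" "t \<in> carrier F" "v \<in> carrier F" "r \<in> carrier F"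
      "x \<in> carrier F" "v \<noteq> \<zero>"
      using abst r x T_closed by auto
    note v = inv_nonzero[OF F(4,7)]
    let ?s = "a \<otimes> s \<otimes> inv v" and ?t = "r \<otimes> t \<otimes> inv v"
    have st: "?s \<in> S" "?t \<in> S"
      by (rule S_mult[OF S_mult[OF abst(1,3)] S_inv[OF abst(5)]],
          rule S_mult[OF S_mult[OF r(1) abst(4)] S_inv[OF abst(5)]])
    have "c = c \<otimes> v \<otimes> inv v" using c F v by (simp add: m_assoc)
    also have "\<dots> = ?s \<oplus> \<ominus> x \<otimes> ?t" unfolding eq r(2) using F v(1) by algebra
    finally have c_eq: "c = ?s \<oplus> \<ominus> x \<otimes> ?t" .
    \<comment> \<open>Zero could be in the sum only if \<open>x t = s\<close> for these
      coefficients, which would make the class of \<open>x\<close> trivial.\<close>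
    have "c \<noteq> \<zero>"
    proof
      assume "c = \<zero>"
      then have "\<zero> = ?s \<oplus> \<ominus> x \<otimes> ?t" using c_eq by simp
      then have "x \<otimes> ?t = (?s \<oplus> \<ominus> x \<otimes> ?t) \<oplus> x \<otimes> ?t" using F v(1) by simp
      also have "\<dots> = ?s" using F v(1) by algebra
      finally have "?t \<otimes> x = ?s" using F v(1) by (simp add: m_comm)
      then have "cl x = cl ?s" using cl_eqI[OF st(2) x] by simp
      then show False using ne cl_S[OF st(1)] by simp
    qed
    with c have cF: "c \<in> Fx" by simp
    have "Y = cl c \<and> c = ?s \<oplus> \<ominus> x \<otimes> ?t"
      using Y mclass_cl[OF cF] c_eq by blast
    then have "\<exists>c\<in>Fx. \<exists>s\<in>S. \<exists>t\<in>S. Y = cl c \<and> c = s \<oplus> \<ominus> x \<otimes> t"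
      by (rule bexI[OF _ cF, OF bexI[OF _ st(1), OF bexI[OF _ st(2)]]])
    with ne show "cl x \<noteq> \<one>\<^bsub>G\<^esub> \<and> (\<exists>c\<in>Fx. \<exists>s\<in>S. \<exists>t\<in>S. Y = cl c \<and> c = s \<oplus> \<ominus> x \<otimes> t)"
      by (rule conjI)
  next
    assume *: "cl x \<noteq> \<one>\<^bsub>G\<^esub> \<and> (\<exists>c\<in>Fx. \<exists>s\<in>S. \<exists>t\<in>S. Y = cl c \<and> c = s \<oplus> \<ominus> x \<otimes> t)"
    then obtain c s t where c: "c \<in> Fx" "s \<in> S" "t \<in> S" "Y = cl c" "c = s \<oplus> \<ominus> x \<otimes> t" by blast
    have one: "\<one> \<in> S" using one_T by simp
    have "s \<in> carrier F" "c \<in> carrier F" using c T_closed by auto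
    then have mem_c: "Y = mclass (multiring_of F) S c \<and> c \<in> carrier F \<and> \<one> \<in> S \<and> \<ominus> x \<in> cl (\<ominus> x) \<and>
        s \<in> S \<and> t \<in> S \<and> \<one> \<in> S \<and> c \<otimes> \<one> = \<one> \<otimes> s \<oplus> \<ominus> x \<otimes> t"
      using c one mclass_cl[OF c(1)] cl_self[OF Fx_neg[OF x]] by (intro conjI) simp_all
    show "(cl x, Y) \<in> mult_rels MQ"
      unfolding mem
      by (rule conjI, rule conjunct1[OF *], rule exI[of _ c], rule exI[of _ \<one>],
          rule exI[of _ "\<ominus> x"], rule exI[of _ s], rule exI[of _ t], rule exI[of _ \<one>], rule mem_c)
  qed
qed

text \<open>Only nonzero coefficients occur, but the Steinberg pairs have \<open>s = t = 1\<close>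
  and so are included, and \<open>S \<subseteq> T\<close> makes every relation valid in
  \<open>k_dm\<close>.\<close>

lemma k_mult_mquot_iso: "igr_iso (k_dm G) (k_mult MQ)"
  unfolding k_mult_tensor_quot
proof (rule k_dm_iso[where q = "\<lambda>X. X"])
  let ?A = "hmult_of MQ" and ?P = "mult_rels MQ"
  have A: "carrier ?A = carrier G" "\<one>\<^bsub>?A\<^esub> = \<one>\<^bsub>G\<^esub>"
    "\<And>X Y. X \<in> carrier G \<Longrightarrow> Y \<in> carrier G \<Longrightarrow> X \<otimes>\<^bsub>?A\<^esub> Y = X \<otimes>\<^bsub>G\<^esub> Y"
    using zero_notin MQ_mult by (auto simp: hmult_of_def MQ_carrier MQ_zero MQ_one)
  show "comm_group ?A"
    by (rule comm_groupI) (auto simp: A G.m_ac G.l_inv_ex)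
  have rel_cases: "\<exists>x\<in>Fx. \<exists>c\<in>Fx. \<exists>s\<in>T. \<exists>t\<in>T. X = cl x \<and> Y = cl c \<and> c = s \<oplus> \<ominus> x \<otimes> t"
    if XY: "(X, Y) \<in> ?P" for X Y
  proof -
    have "X \<in> carrier G"
      using XY unfolding mult_rels_def MQ_carrier MQ_zero by auto
    then obtain x where x: "x \<in> Fx" "X = cl x" by (rule cl_cases)
    show ?thesis using XY x(1) unfolding x(2) MQ_rel_iff[OF x(1)] by blast
  qed
  show "?P \<subseteq> carrier ?A \<times> carrier ?A"
  proof (rule subrelI)
    fix X Y assume "(X, Y) \<in> ?P"
    then obtain x c where "x \<in> Fx" "c \<in> Fx" "X = cl x" "Y = cl c" using rel_cases by meson
    then show "(X, Y) \<in> carrier ?A \<times> carrier ?A" using cl_closed unfolding A(1) by simp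
  qed
  show "\<exists>x\<in>Fx. \<exists>c\<in>Fx. \<exists>s\<in>T. \<exists>t\<in>T. a = cl x \<and> b = cl c \<and> c = s \<oplus> \<ominus> x \<otimes> t"
    if "(a, b) \<in> ?P" for a b
    by (rule rel_cases[OF that])
  show "(\<lambda>X. X) \<in> hom ?A G" "(\<lambda>X. X) ` carrier ?A = carrier G"
    by (auto simp: hom_def A)
  have "hneg MQ \<one>\<^bsub>MQ\<^esub> = minus_one G"
    using MQ_neg[of \<one>] cl_one by (simp add: MQ_one G_minus_one)
  then show "hneg MQ \<one>\<^bsub>MQ\<^esub> = minus_one G" "hneg MQ \<one>\<^bsub>MQ\<^esub> \<in> carrier ?A"
    using minus_one_closed by (simp_all add: A)
  show "\<exists>(a, b)\<in>?P. a = cl x \<and> b = cl (\<one> \<ominus> x)"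
    if x: "x \<in> Fx" "x \<noteq> \<one>" "cl x \<noteq> \<one>\<^bsub>G\<^esub>" for x
  proof -
    have one: "\<one> \<in> S" using one_T by simp
    have "(cl x, cl (\<one> \<ominus> x)) \<in> ?P"
      unfolding MQ_rel_iff[OF x(1)]
      by (rule conjI[OF x(3) one_minus_rep[OF x(1,2) one]])
    then show ?thesis by blast
  qed
  show "\<sigma> a = \<zero>\<^bsub>B\<^esub>" if \<sigma>: "symbol_map ?A B ?P \<sigma>" and a: "a = \<one>\<^bsub>G\<^esub>"
    for B :: "('a set list \<Rightarrow> int) set set set ring" and \<sigma> a
    using symbol_map.map_one[OF \<sigma>] a by (simp add: A)
qed

end

section \<open>Isometry of binary forms\<close>

context field
begin

text \<open>\<open>c\<close> is the value of the first form at \<open>(1, 0)\<close>. The change of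
  variables sends the first column of its inverse matrix, \<open>(s/det, -r/det)\<close>, to
  \<open>(1, 0)\<close>, so the second form takes the value \<open>c\<close> at that column.\<close>

lemma isometric_value:
  assumes c: "{c, d, u, v} \<subseteq> carrier R" and iso: "isometric R (c, d) (u, v)"
  shows "\<exists>x\<in>carrier R. \<exists>y\<in>carrier R. c = u \<otimes> (x \<otimes> x) \<oplus> v \<otimes> (y \<otimes> y)"
proof -
  obtain p q r s where pqrs: "p \<in> carrier R" "q \<in> carrier R" "r \<in> carrier R" "s \<in> carrier R"
    and det: "p \<otimes> s \<ominus> q \<otimes> r \<noteq> \<zero>"
    and eq: "\<And>x y. x \<in> carrier R \<Longrightarrow> y \<in> carrier R \<Longrightarrow>
      diag_form R c d (p \<otimes> x \<oplus> q \<otimes> y) (r \<otimes> x \<oplus> s \<otimes> y) = diag_form R u v x y"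
    using iso by (auto simp: isometric_def)
  define i where "i = inv (p \<otimes> s \<ominus> q \<otimes> r)"
  have i: "i \<in> carrier R" "(p \<otimes> s \<ominus> q \<otimes> r) \<otimes> i = \<one>"
    using inv_nonzero[OF _ det] pqrs by (auto simp: i_def)
  let ?x = "s \<otimes> i" and ?y = "\<ominus> (r \<otimes> i)"
  have xy: "?x \<in> carrier R" "?y \<in> carrier R" using pqrs i by auto
  have "p \<otimes> ?x \<oplus> q \<otimes> ?y = (p \<otimes> s \<ominus> q \<otimes> r) \<otimes> i" using pqrs i(1) by algebra
  then have 1: "p \<otimes> ?x \<oplus> q \<otimes> ?y = \<one>" using i(2) by simp
  have 2: "r \<otimes> ?x \<oplus> s \<otimes> ?y = \<zero>" using pqrs i(1) by algebra
  have "c = diag_form R c d \<one> \<zero>" using c by (simp add: diag_form_def)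
  also have "\<dots> = diag_form R u v ?x ?y" using eq[OF xy] unfolding 1 2 .
  finally show ?thesis using xy unfolding diag_form_def by blast
qed

text \<open>The isometry is multiplication by \<open>(x + y \<surd>(-b)) / c\<close>, which multiplies the norm form by
  \<open>1 / c\<close>.\<close>

lemma isometric_norm:
  assumes c: "b \<in> carrier R" "x \<in> carrier R" "y \<in> carrier R"
    and eq: "c = x \<otimes> x \<oplus> b \<otimes> (y \<otimes> y)" and nz: "c \<noteq> \<zero>"
  shows "isometric R (c, c \<otimes> b) (\<one>, b)"
proof -
  have cR: "c \<in> carrier R" using c eq by simp
  define i where "i = inv c"
  have i: "i \<in> carrier R" "i \<noteq> \<zero>" "c \<otimes> i = \<one>"
    using inv_nonzero[OF cR nz] by (auto simp: i_def)
  have form: "diag_form R c (c \<otimes> b) (x \<otimes> i \<otimes> X \<oplus> \<ominus> (b \<otimes> y \<otimes> i) \<otimes> Y) (y \<otimes> i \<otimes> X \<oplus> x \<otimes> i \<otimes> Y)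
      = diag_form R \<one> b X Y" if XY: "X \<in> carrier R" "Y \<in> carrier R" for X Y
  proof -
    define p where "p = x \<otimes> X \<ominus> b \<otimes> y \<otimes> Y"
    define q where "q = y \<otimes> X \<oplus> x \<otimes> Y"
    have pq: "p \<in> carrier R" "q \<in> carrier R" using c XY by (auto simp: p_def q_def)
    have 1: "x \<otimes> i \<otimes> X \<oplus> \<ominus> (b \<otimes> y \<otimes> i) \<otimes> Y = i \<otimes> p"
      unfolding p_def using c(1-3) i(1) XY by algebra
    have 2: "y \<otimes> i \<otimes> X \<oplus> x \<otimes> i \<otimes> Y = i \<otimes> q"
      unfolding q_def using c(1-3) i(1) XY by algebra
    \<comment> \<open>Multiplicativity of the norm, with \<open>p + q \<surd>(-b)\<close> the
      product of \<open>x + y \<surd>(-b)\<close> and \<open>X + Y \<surd>(-b)\<close>.\<close>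
    have norm: "p \<otimes> p \<oplus> b \<otimes> (q \<otimes> q) = c \<otimes> (X \<otimes> X \<oplus> b \<otimes> (Y \<otimes> Y))"
      unfolding p_def q_def eq using c(1-3) XY by algebra
    have "diag_form R c (c \<otimes> b) (i \<otimes> p) (i \<otimes> q) = (c \<otimes> i) \<otimes> i \<otimes> (p \<otimes> p \<oplus> b \<otimes> (q \<otimes> q))"
      unfolding diag_form_def using cR c(1) i(1) pq by algebra
    also have "\<dots> = (c \<otimes> i) \<otimes> (c \<otimes> i) \<otimes> (X \<otimes> X \<oplus> b \<otimes> (Y \<otimes> Y))"
      unfolding norm using cR c(1) i(1) XY by algebra
    also have "\<dots> = diag_form R \<one> b X Y"
      unfolding i(3) diag_form_def using XY c(1) by simp
    finally show ?thesis unfolding 1 2 .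
  qed
  \<comment> \<open>The determinant is \<open>(x^2 + b y^2)/c^2 = 1/c\<close>, hence
    nonzero.\<close>
  have "(x \<otimes> i) \<otimes> (x \<otimes> i) \<ominus> \<ominus> (b \<otimes> y \<otimes> i) \<otimes> (y \<otimes> i) = ((x \<otimes> x \<oplus> b \<otimes> (y \<otimes> y)) \<otimes> i) \<otimes> i"
    using c i(1) by algebra
  then have det: "(x \<otimes> i) \<otimes> (x \<otimes> i) \<ominus> \<ominus> (b \<otimes> y \<otimes> i) \<otimes> (y \<otimes> i) \<noteq> \<zero>"
    unfolding eq[symmetric] i(3) using i by simp
  have closed: "x \<otimes> i \<in> carrier R" "\<ominus> (b \<otimes> y \<otimes> i) \<in> carrier R" "y \<otimes> i \<in> carrier R"
    using c i(1) by auto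
  show ?thesis
    unfolding isometric_def prod.case
    by (rule bexI[OF _ closed(1)], rule bexI[OF _ closed(2)], rule bexI[OF _ closed(3)],
        rule bexI[OF _ closed(1)]) (use det form in blast)
qed

end

section \<open>Representation sets of the two special groups\<close>

context square_semigroup
begin

abbreviation "QG \<equiv> mult_of F Mod S"

lemma QG_carrier: "carrier QG = cl ` Fx"
  by (auto simp: FactGroup_def RCOSETS_def)

lemma QG_mult: "a \<in> Fx \<Longrightarrow> b \<in> Fx \<Longrightarrow> cl a \<otimes>\<^bsub>QG\<^esub> cl b = cl (a \<otimes> b)"
  using normal.rcos_sum[OF S_normal, of a b] by (simp add: FactGroup_def)

lemma cl_unit: "cl \<one> = S"
  using S_subset U.coset_mult_one[of S] by simp

lemma mem_class_Fx:
  assumes "a \<in> X" "X \<in> cl ` Fx"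
  shows "a \<in> Fx"
proof -
  obtain x where x: "x \<in> Fx" "X = cl x" using assms(2) by blast
  show ?thesis using cl_of_mem[OF _ x(1)] assms(1) unfolding x(2) by blast
qed

text \<open>For \<open>c\<close> represented by \<open>\<langle>1, b\<rangle>\<close> the second
  entry demanded by \<open>sg_rep\<close> is \<open>c b\<close>, as the discriminant dictates. The
  premises \<open>sound\<close> and \<open>complete\<close> isolate what depends on the relation;
  the former has to represent just one element of the class.\<close>

lemma sg_rep_eqI:
  assumes b: "b \<in> Fx" and G: "carrier G = carrier QG"
    and sound: "\<And>C D. C \<in> cl ` Fx \<Longrightarrow> D \<in> cl ` Fx \<Longrightarrow> ((C, D), (S, cl b)) \<in> form_equiv G \<Longrightarrow>
      \<exists>c\<in>C. \<exists>s\<in>T. \<exists>t\<in>T. c = s \<oplus> b \<otimes> t"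
    and complete: "\<And>c s t. c \<in> Fx \<Longrightarrow> s \<in> T \<Longrightarrow> t \<in> T \<Longrightarrow> c = s \<oplus> b \<otimes> t \<Longrightarrow>
      ((cl c, cl (c \<otimes> b)), (S, cl b)) \<in> form_equiv G"
  shows "sg_rep G S (cl b) = {cl c | c. c \<in> Fx \<and> (\<exists>s \<in> T. \<exists>t \<in> T. c = s \<oplus> b \<otimes> t)}"
proof (intro equalityI subsetI)
  fix C assume "C \<in> sg_rep G S (cl b)"
  then obtain D where CD: "C \<in> cl ` Fx" "D \<in> cl ` Fx" "((C, D), (S, cl b)) \<in> form_equiv G"
    unfolding sg_rep_def G QG_carrier by blast
  obtain c where c: "c \<in> C" "\<exists>s\<in>T. \<exists>t\<in>T. c = s \<oplus> b \<otimes> t" using sound[OF CD] by blast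
  obtain x where x: "x \<in> Fx" "C = cl x" using CD(1) by blast
  have "c \<in> Fx \<and> cl c = C" using cl_of_mem[OF _ x(1)] c(1) unfolding x(2) .
  then show "C \<in> {cl c | c. c \<in> Fx \<and> (\<exists>s \<in> T. \<exists>t \<in> T. c = s \<oplus> b \<otimes> t)}" using c(2) by blast
next
  fix C assume "C \<in> {cl c | c. c \<in> Fx \<and> (\<exists>s \<in> T. \<exists>t \<in> T. c = s \<oplus> b \<otimes> t)}"
  then obtain c s t where c: "C = cl c" "c \<in> Fx" "s \<in> T" "t \<in> T" "c = s \<oplus> b \<otimes> t" by blast
  have "cl c \<in> carrier G" "cl (c \<otimes> b) \<in> carrier G"
    unfolding G QG_carrier by (rule imageI[OF c(2)], rule imageI[OF Fx_mult[OF c(2) b]])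
  then show "C \<in> sg_rep G S (cl b)"
    unfolding sg_rep_def c(1) using complete[OF c(2-5)] by blast
qed

text \<open>\<open>T + b T\<close> is closed under multiplication, by the norm identity, and under
  division by \<open>c\<close>, since \<open>1/c = c (1/c)^2\<close> and \<open>T\<close> contains
  squares. So multiplication by \<open>c\<close> maps its nonzero elements onto themselves.\<close>

lemma pre_rep_scale:
  assumes add: "\<And>s t. s \<in> T \<Longrightarrow> t \<in> T \<Longrightarrow> s \<oplus> t \<in> T"
    and b: "b \<in> Fx" and c: "c \<in> Fx" and st: "s \<in> T" "t \<in> T" and eq: "c = s \<oplus> b \<otimes> t"
  shows "pre_rep F T c (c \<otimes> b) = pre_rep F T \<one> b"
proof -
  have bF: "b \<in> carrier F" and cF: "c \<in> carrier F" using b c by auto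
  have norm: "\<exists>s''\<in>T. \<exists>t''\<in>T. (s \<oplus> b \<otimes> t) \<otimes> (s' \<oplus> b \<otimes> t') = s'' \<oplus> b \<otimes> t''"
    if "s' \<in> T" "t' \<in> T" for s' t'
  proof -
    have F: "s \<in> carrier F" "t \<in> carrier F" "s' \<in> carrier F" "t' \<in> carrier F"
      using st that T_closed by auto
    \<comment> \<open>The term with \<open>b^2\<close> joins the first coefficient because squares
      lie in \<open>T\<close>.\<close>
    have "(s \<oplus> b \<otimes> t) \<otimes> (s' \<oplus> b \<otimes> t')
        = (s \<otimes> s' \<oplus> (b \<otimes> b) \<otimes> (t \<otimes> t')) \<oplus> b \<otimes> (s \<otimes> t' \<oplus> t \<otimes> s')"
      using F bF by algebra
    moreover have "s \<otimes> s' \<oplus> (b \<otimes> b) \<otimes> (t \<otimes> t') \<in> T" "s \<otimes> t' \<oplus> t \<otimes> s' \<in> T"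
      using st that T_square[OF bF] by (auto intro!: add T_mult)
    ultimately show ?thesis by blast
  qed
  show ?thesis
  proof (intro equalityI subsetI)
    fix z assume "z \<in> pre_rep F T c (c \<otimes> b)"
    then obtain s' t' where z: "z \<in> carrier (mult_of F)" "s' \<in> T" "t' \<in> T"
        "z = c \<otimes> s' \<oplus> c \<otimes> b \<otimes> t'"
      unfolding pre_rep_def by blast
    have F: "s' \<in> carrier F" "t' \<in> carrier F" using z T_closed by auto
    have "z = c \<otimes> (s' \<oplus> b \<otimes> t')" unfolding z(4) using F bF cF by algebra
    then obtain s'' t'' where st'': "s'' \<in> T" "t'' \<in> T" "z = s'' \<oplus> b \<otimes> t''"
      using norm[OF z(2,3)] unfolding eq by auto
    moreover have "s'' \<oplus> b \<otimes> t'' = \<one> \<otimes> s'' \<oplus> b \<otimes> t''" using st'' T_closed by auto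
    ultimately show "z \<in> pre_rep F T \<one> b" unfolding pre_rep_def using z(1) by auto
  next
    fix z assume "z \<in> pre_rep F T \<one> b"
    then obtain s' t' where z: "z \<in> carrier (mult_of F)" "s' \<in> T" "t' \<in> T"
        "z = \<one> \<otimes> s' \<oplus> b \<otimes> t'"
      unfolding pre_rep_def by blast
    have F: "s' \<in> carrier F" using z T_closed by auto
    obtain s'' t'' where st'': "s'' \<in> T" "t'' \<in> T" "c \<otimes> (s' \<oplus> b \<otimes> t') = s'' \<oplus> b \<otimes> t''"
      using norm[OF z(2,3)] unfolding eq by auto
    have F'': "s'' \<in> carrier F" "t'' \<in> carrier F" using st'' T_closed by auto
    note i = inv_nonzero[of c]
    have iF: "inv c \<in> carrier F" "c \<otimes> inv c = \<one>" using i c by auto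
    let ?j = "inv c \<otimes> inv c"
    have j: "?j \<in> T" by (rule T_square[OF iF(1)])
    have zF: "z \<in> carrier F" using z(1) by simp
    have "z = (c \<otimes> inv c) \<otimes> (c \<otimes> inv c) \<otimes> z" using zF by (simp add: iF(2))
    also have "\<dots> = c \<otimes> (c \<otimes> z) \<otimes> ?j" using zF cF iF(1) by algebra
    also have "c \<otimes> z = s'' \<oplus> b \<otimes> t''" using st''(3) z(4) F by simp
    also have "c \<otimes> (s'' \<oplus> b \<otimes> t'') \<otimes> ?j = c \<otimes> (s'' \<otimes> ?j) \<oplus> c \<otimes> b \<otimes> (t'' \<otimes> ?j)"
      using cF iF(1) F'' bF by algebra
    finally have zz: "z = c \<otimes> (s'' \<otimes> ?j) \<oplus> c \<otimes> b \<otimes> (t'' \<otimes> ?j)" .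
    have "\<exists>s\<in>T. \<exists>t\<in>T. z = c \<otimes> s \<oplus> c \<otimes> b \<otimes> t"
      by (rule bexI[OF _ T_mult[OF st''(1) j]], rule bexI[OF _ T_mult[OF st''(2) j]], rule zz)
    then show "z \<in> pre_rep F T c (c \<otimes> b)" unfolding pre_rep_def using z(1) by blast
  qed
qed

text \<open>When \<open>T\<close> is the set of squares, \<open>T + b T\<close> is the set of values
  of \<open>\<langle>1, b\<rangle>\<close>. An isometry makes the first coefficient a value of the
  other form; conversely \<open>isometric_norm\<close> turns a representation into an
  isometry.\<close>

lemma sg_field_sgroup:
  assumes T: "T = {x \<otimes> x | x. x \<in> carrier F}"
  shows "field_sgroup F T (sg_field F)"
proof -
  have sq: "nonzero_squares F = S"
  proof -
    have "x \<otimes> x \<in> S \<longleftrightarrow> x \<in> Fx" if "x \<in> carrier F" for x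
      using that T integral[of x x] by auto
    then show ?thesis unfolding nonzero_squares_def T by auto
  qed
  have fe: "((A, B), (C, D)) \<in> form_equiv (sg_field F) \<longleftrightarrow> {A, B, C, D} \<subseteq> carrier QG \<and>
      (\<exists>a\<in>A. \<exists>b\<in>B. \<exists>c\<in>C. \<exists>d\<in>D. isometric F (a, b) (c, d))" for A B C D
    by (simp add: sg_field_def Let_def sq)
  have car: "carrier (sg_field F) = carrier QG" by (simp add: sg_field_def Let_def sq)
  have one: "\<one>\<^bsub>sg_field F\<^esub> = S" by (simp add: sg_field_def Let_def sq FactGroup_def)
  have rep: "sg_rep (sg_field F) S (cl b) =
      {cl c | c. c \<in> Fx \<and> (\<exists>s \<in> T. \<exists>t \<in> T. c = s \<oplus> b \<otimes> t)}" if b: "b \<in> Fx" for b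
  proof (rule sg_rep_eqI[OF b car])
    fix C D assume C: "C \<in> cl ` Fx" and D: "D \<in> cl ` Fx"
      and CD: "((C, D), (S, cl b)) \<in> form_equiv (sg_field F)"
    have "\<exists>c\<in>C. \<exists>d\<in>D. \<exists>u\<in>S. \<exists>v\<in>cl b. isometric F (c, d) (u, v)"
      by (rule conjunct2[OF CD[unfolded fe]])
    then obtain c d u v where cd: "c \<in> C" "d \<in> D" "u \<in> S" "v \<in> cl b" and iso: "isometric F (c, d) (u, v)"
      by meson
    have "{c, d, u, v} \<subseteq> carrier F"
      using mem_class_Fx[OF cd(1) C] mem_class_Fx[OF cd(2) D] subsetD[OF S_subset cd(3)]
        cl_of_mem[OF cd(4) b] by simp
    then obtain x y where xy: "x \<in> carrier F" "y \<in> carrier F" "c = u \<otimes> (x \<otimes> x) \<oplus> v \<otimes> (y \<otimes> y)"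
      using isometric_value[OF _ iso] by meson
    \<comment> \<open>The isometry concerns arbitrary representatives of the classes of one and of
      \<open>b\<close>; their factors \<open>u\<close> and \<open>r\<close> from \<open>S\<close>
      are absorbed into the coefficients.\<close>
    obtain r where r: "r \<in> S" "v = r \<otimes> b" using cd(4) unfolding cl_mem by blast
    have rT: "r \<in> T" "r \<in> carrier F" using r(1) T_closed by auto
    have "v \<otimes> (y \<otimes> y) = b \<otimes> (r \<otimes> (y \<otimes> y))" using rT xy(2) b r(2) by (simp add: m_ac)
    then have eq: "c = u \<otimes> (x \<otimes> x) \<oplus> b \<otimes> (r \<otimes> (y \<otimes> y))" using xy(3) by simp
    have uT: "u \<in> T" using cd(3) by simp
    have "\<exists>s\<in>T. \<exists>t\<in>T. c = s \<oplus> b \<otimes> t"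
      by (rule bexI[OF _ T_mult[OF uT T_square[OF xy(1)]]],
          rule bexI[OF _ T_mult[OF rT(1) T_square[OF xy(2)]]], rule eq)
    then show "\<exists>c\<in>C. \<exists>s\<in>T. \<exists>t\<in>T. c = s \<oplus> b \<otimes> t" using cd(1) by blast
  next
    fix c s t assume c: "c \<in> Fx" "s \<in> T" "t \<in> T" "c = s \<oplus> b \<otimes> t"
    obtain x where x: "x \<in> carrier F" "s = x \<otimes> x" using c(2) unfolding T by blast
    obtain y where y: "y \<in> carrier F" "t = y \<otimes> y" using c(3) unfolding T by blast
    have "isometric F (c, c \<otimes> b) (\<one>, b)"
      by (rule isometric_norm[of b x y]) (use b c x y in auto)
    moreover have "c \<in> cl c" "c \<otimes> b \<in> cl (c \<otimes> b)" "b \<in> cl b"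
      by (rule cl_self[OF c(1)], rule cl_self[OF Fx_mult[OF c(1) b]], rule cl_self[OF b])
    moreover have "\<one> \<in> S" using one_T by simp
    moreover have "S \<in> carrier QG" using cl_unit unfolding QG_carrier by force
    moreover have "cl c \<in> carrier QG" "cl (c \<otimes> b) \<in> carrier QG" "cl b \<in> carrier QG"
      unfolding QG_carrier by (rule imageI[OF c(1)], rule imageI[OF Fx_mult[OF c(1) b]], rule imageI[OF b])
    ultimately show "((cl c, cl (c \<otimes> b)), (S, cl b)) \<in> form_equiv (sg_field F)"
      unfolding fe by blast
  qed
  show ?thesis
    by (intro field_sgroup.intro square_semigroup_axioms field_sgroup_axioms.intro)
      (simp_all only: car one rep, simp_all add: sg_field_def Let_def sq)
qed

text \<open>Equality of value sets puts \<open>c\<close> among the values of the second form, and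
  \<open>pre_rep_scale\<close>, where closure of \<open>T\<close> under sums enters, gives the
  converse.\<close>

lemma sg_pre_sgroup:
  assumes add: "\<And>s t. s \<in> T \<Longrightarrow> t \<in> T \<Longrightarrow> s \<oplus> t \<in> T"
  shows "field_sgroup F T (sg_pre F T)"
proof -
  have fe: "((A, B), (C, D)) \<in> form_equiv (sg_pre F T) \<longleftrightarrow> {A, B, C, D} \<subseteq> carrier QG \<and>
      A \<otimes>\<^bsub>QG\<^esub> B = C \<otimes>\<^bsub>QG\<^esub> D \<and>
      (\<exists>a\<in>A. \<exists>b\<in>B. \<exists>c\<in>C. \<exists>d\<in>D. pre_rep F T a b = pre_rep F T c d)" for A B C D
    by (simp add: sg_pre_def Let_def del: mult_FactGroup)
  have car: "carrier (sg_pre F T) = carrier QG" by (simp add: sg_pre_def Let_def)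
  have one: "\<one>\<^bsub>sg_pre F T\<^esub> = S" by (simp add: sg_pre_def Let_def FactGroup_def)
  have rep: "sg_rep (sg_pre F T) S (cl b) =
      {cl c | c. c \<in> Fx \<and> (\<exists>s \<in> T. \<exists>t \<in> T. c = s \<oplus> b \<otimes> t)}" if b: "b \<in> Fx" for b
  proof (rule sg_rep_eqI[OF b car])
    fix C D assume C: "C \<in> cl ` Fx" and D: "D \<in> cl ` Fx"
      and CD: "((C, D), (S, cl b)) \<in> form_equiv (sg_pre F T)"
    have "\<exists>c\<in>C. \<exists>d\<in>D. \<exists>u\<in>S. \<exists>v\<in>cl b. pre_rep F T c d = pre_rep F T u v"
      by (rule conjunct2[OF conjunct2[OF CD[unfolded fe]]])
    then obtain c d u v where cd: "c \<in> C" "d \<in> D" "u \<in> S" "v \<in> cl b"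
      and eq: "pre_rep F T c d = pre_rep F T u v"
      by meson
    have cF: "c \<in> Fx" and dF: "d \<in> Fx"
      by (rule mem_class_Fx[OF cd(1) C], rule mem_class_Fx[OF cd(2) D])
    \<comment> \<open>\<open>c\<close> is a value of its own form, with coefficients one and zero,
      both in \<open>T\<close>.\<close>
    have "c = c \<otimes> \<one> \<oplus> d \<otimes> \<zero>" using cF dF by simp
    then have "\<exists>s\<in>T. \<exists>t\<in>T. c = c \<otimes> s \<oplus> d \<otimes> t"
      by (rule bexI[OF _ one_T, OF bexI[OF _ zero_T]])
    then have "c \<in> pre_rep F T c d" unfolding pre_rep_def using cF by simp
    then have "c \<in> pre_rep F T u v" unfolding eq .
    then obtain s t where st: "s \<in> T" "t \<in> T" "c = u \<otimes> s \<oplus> v \<otimes> t"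
      unfolding pre_rep_def by blast
    obtain r where r: "r \<in> S" "v = r \<otimes> b" using cd(4) unfolding cl_mem by blast
    have rT: "r \<in> T" "r \<in> carrier F" "t \<in> carrier F" using r(1) st T_closed by auto
    have "v \<otimes> t = b \<otimes> (r \<otimes> t)" using rT b r(2) by (simp add: m_ac)
    then have eq': "c = u \<otimes> s \<oplus> b \<otimes> (r \<otimes> t)" using st(3) by simp
    have uT: "u \<in> T" using cd(3) by simp
    have "\<exists>s\<in>T. \<exists>t\<in>T. c = s \<oplus> b \<otimes> t"
      by (rule bexI[OF _ T_mult[OF uT st(1)]], rule bexI[OF _ T_mult[OF rT(1) st(2)]], rule eq')
    then show "\<exists>c\<in>C. \<exists>s\<in>T. \<exists>t\<in>T. c = s \<oplus> b \<otimes> t" using cd(1) by blast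
  next
    fix c s t assume c: "c \<in> Fx" "s \<in> T" "t \<in> T" "c = s \<oplus> b \<otimes> t"
    have "pre_rep F T c (c \<otimes> b) = pre_rep F T \<one> b"
      by (rule pre_rep_scale[OF add b c])
    moreover have "c \<in> cl c" "c \<otimes> b \<in> cl (c \<otimes> b)" "b \<in> cl b"
      by (rule cl_self[OF c(1)], rule cl_self[OF Fx_mult[OF c(1) b]], rule cl_self[OF b])
    moreover have one': "\<one> \<in> S" "\<one> \<in> Fx" using one_T by simp_all
    moreover have "S \<in> carrier QG" using cl_unit unfolding QG_carrier by force
    moreover have "cl c \<in> carrier QG" "cl (c \<otimes> b) \<in> carrier QG" "cl b \<in> carrier QG"
      unfolding QG_carrier by (rule imageI[OF c(1)], rule imageI[OF Fx_mult[OF c(1) b]], rule imageI[OF b])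
    moreover have "cl c \<otimes>\<^bsub>QG\<^esub> cl (c \<otimes> b) = S \<otimes>\<^bsub>QG\<^esub> cl b"
    proof -
      have cF: "c \<in> carrier F" "b \<in> carrier F" using c b by auto
      have cc: "c \<otimes> c \<in> S" using T_square[OF cF(1)] Fx_mult[OF c(1) c(1)] by simp
      have "cl c \<otimes>\<^bsub>QG\<^esub> cl (c \<otimes> b) = cl (c \<otimes> (c \<otimes> b))"
        by (rule QG_mult[OF c(1) Fx_mult[OF c(1) b]])
      also have "c \<otimes> (c \<otimes> b) = (c \<otimes> c) \<otimes> b" using cF by (simp add: m_assoc)
      also have "cl ((c \<otimes> c) \<otimes> b) = cl (\<one> \<otimes> b)" using cl_eqI[OF cc b] cF by simp
      also have "\<dots> = S \<otimes>\<^bsub>QG\<^esub> cl b" using QG_mult[OF one'(2) b] unfolding cl_unit by (rule sym)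
      finally show ?thesis .
    qed
    ultimately show "((cl c, cl (c \<otimes> b)), (S, cl b)) \<in> form_equiv (sg_pre F T)"
      unfolding fe by blast
  qed
  show ?thesis
    by (intro field_sgroup.intro square_semigroup_axioms field_sgroup_axioms.intro)
      (simp_all only: car one rep, simp_all add: sg_pre_def Let_def)
qed

end

section \<open>The isomorphisms for fields and preorderings\<close>

theorem theorem4p9:
  fixes F :: "('a, 'm) ring_scheme" (structure)
  assumes "field F" and "\<one> \<oplus> \<one> \<noteq> \<zero>"
  shows
    "igr_iso (k_mil F) (k_dm (sg_field F)) \<and>
     igr_iso (k_dm (sg_field F)) (k_mult (sg_hyperfield (sg_field F))) \<and>
     (\<forall>T. formally_real F \<and> field_preordering F T \<longrightarrow>
        igr_iso (k_dm (sg_pre F T)) (k_mult (sg_hyperfield (sg_pre F T)))) \<and>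
     igr_iso (k_dm (sg_field F)) (k_mult (mquot (multiring_of F) (nonzero_squares F))) \<and>
     (\<forall>T. formally_real F \<and> field_preordering F T \<longrightarrow>
        igr_iso (k_dm (sg_pre F T)) (k_mult (mquot (multiring_of F) (T - {\<zero>}))))"
proof -
  interpret F: field F by fact
  let ?T = "{x \<otimes> x | x. x \<in> carrier F}"
  have "square_semigroup F ?T"
  proof (intro square_semigroup.intro square_semigroup_axioms.intro)
    fix s t assume "s \<in> ?T" "t \<in> ?T"
    then obtain x y where xy: "x \<in> carrier F" "y \<in> carrier F" "s = x \<otimes> x" "t = y \<otimes> y" by blast
    then have "s \<otimes> t = (x \<otimes> y) \<otimes> (x \<otimes> y)" by (simp add: F.m_ac)
    then show "s \<otimes> t \<in> ?T" using F.m_closed[OF xy(1,2)] by blast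
  qed (use assms in auto)
  then have "field_sgroup F ?T (sg_field F)"
    by (rule square_semigroup.sg_field_sgroup) (rule refl)
  then interpret G: field_sgroup F ?T "sg_field F" .
  have sq: "?T - {\<zero>} = nonzero_squares F"
    using F.integral by (auto simp: nonzero_squares_def)
  \<comment> \<open>A preordering contains the squares and is closed under products, so it fits the
    locale used for squares; its closure under sums is the further input of
    \<open>sg_pre_sgroup\<close>.\<close>
  have pre: "field_sgroup F T (sg_pre F T)" if "field_preordering F T" for T
    using that assms
    by (intro square_semigroup.sg_pre_sgroup square_semigroup.intro square_semigroup_axioms.intro)
      (auto simp: field_preordering_def)
  show ?thesis
    using igr_iso_sym[OF G.k_mil_iso[OF refl]] G.k_mult_sg_hyperfield_iso G.k_mult_mquot_iso[unfolded sq]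
      field_sgroup.k_mult_sg_hyperfield_iso[OF pre] field_sgroup.k_mult_mquot_iso[OF pre]
    by blast
qed

end
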